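(* (i) Let $U\subseteq\mathbb{R}^n$ be r.e. open, $f:U\to\mathbb{R}^m$ computable and continuously differentiable with computable derivative, and $\vec x_0\in U$ computable with $\operatorname{rank}f'(\vec x_0)=m$. Then there exist a rational $\delta>0$ and a computable, continuously differentiable function $g:B(f(\vec x_0),\delta)\to U$ with computable derivative such that $g(f(\vec x_0))=\vec x_0$ and $f(g(\vec y))=\vec y$ for all $\vec y\in B(f(\vec x_0),\delta)$. (ii) Moreover, let $X\subseteq\mathbb{R}^n$ be r.e. open and $f:X\to\mathbb{R}^m$ computable and continuously differentiable with computable derivative $f':X\to\mathbb{R}^{m\times n}$. Then the multi-valued mapping $I:\mathfrak{O}^n\times X\rightrightarrows\mathbb{N}$ whose graph is the set of $(U,\vec x_0,k)$ such that $\vec x_0\in U\subseteq X$ with $U$ open, $\operatorname{rank}f'(\vec x_0)=m$, and there exists $g:B(f(\vec x_0),2^{-k})\to U$ with $g(f(\vec x_0))=\vec x_0$ and $f(g(\vec y))=\vec y$ for all $\vec y\in B(f(\vec x_0),2^{-k})$, is $(\theta^n_<\times\rho^n\rightrightarrows\nu)$-computable.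
   Context: Type-2 computability (Weihrauch). $\rho^n$: Cauchy representation of $\mathbb{R}^n$; $\nu$: standard notation of $\mathbb{N}$; $\mathfrak{O}^n$: open subsets of $\mathbb{R}^n$, represented by $\theta^n_<$ (a name lists rational centers and radii of open balls with union the set). r.e. open: has a computable $\theta^n_<$-name. A multi-valued $h:A\rightrightarrows\mathbb{N}$ is computable if a machine, given any names of the inputs in the domain, outputs some element of $h$ of the inputs. $B(\vec y,r)$: open Euclidean ball. *)

theory Defs
  imports "HOL-Analysis.Analysis" "HOL-Library.Nat_Bijection"
begin

datatype recf = Zr | Sc | Idx nat | Cn recf "recf list" | Pr recf recf | Mn recf

inductive rf_eval :: "recf \<Rightarrow> nat list \<Rightarrow> nat \<Rightarrow> bool" where
  zero: "rf_eval Zr xs 0"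
| succ: "rf_eval Sc (x # xs) (Suc x)"
| proj: "i < length xs \<Longrightarrow> rf_eval (Idx i) xs (xs ! i)"
| comp: "list_all2 (\<lambda>g y. rf_eval g xs y) gs ys \<Longrightarrow> rf_eval f ys z \<Longrightarrow> rf_eval (Cn f gs) xs z"
| pr0: "rf_eval f xs y \<Longrightarrow> rf_eval (Pr f g) (0 # xs) y"
| prS: "rf_eval (Pr f g) (n # xs) y \<Longrightarrow> rf_eval g (n # y # xs) z \<Longrightarrow> rf_eval (Pr f g) (Suc n # xs) z"
| mn: "rf_eval f (n # xs) 0 \<Longrightarrow> (\<forall>i<n. \<exists>y. rf_eval f (i # xs) (Suc y)) \<Longrightarrow> rf_eval (Mn f) xs n"

definition computable_seq :: "(nat \<Rightarrow> nat) \<Rightarrow> bool" where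
  "computable_seq p \<longleftrightarrow> (\<exists>f. \<forall>i. rf_eval f [i] (p i))"

definition prefix :: "(nat \<Rightarrow> nat) \<Rightarrow> nat \<Rightarrow> nat list" where
  "prefix p k = map p [0..<k]"

text \<open>The partial recursive phi, used as a Type-2 machine, transforms input p into output q:
  for every n it converges on (n, some finite prefix of p), and every value it produces
  on (n, prefix of p) equals q n.  (Equivalent to Type-2 Turing machine computation.)\<close>
definition t2_out :: "recf \<Rightarrow> (nat \<Rightarrow> nat) \<Rightarrow> (nat \<Rightarrow> nat) \<Rightarrow> bool" where
  "t2_out phi p q \<longleftrightarrow>
     (\<forall>n. (\<exists>k v. rf_eval phi [n, list_encode (prefix p k)] v) \<and>
          (\<forall>k v. rf_eval phi [n, list_encode (prefix p k)] v \<longrightarrow> v = q n))"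

text \<open>Representations are relations "p is a name of x".\<close>
type_synonym 'a rep = "(nat \<Rightarrow> nat) \<Rightarrow> 'a \<Rightarrow> bool"

definition comp_mv :: "'a rep \<Rightarrow> 'b rep \<Rightarrow> 'a set \<Rightarrow> ('a \<Rightarrow> 'b \<Rightarrow> bool) \<Rightarrow> bool" where
  "comp_mv d1 d2 D R \<longleftrightarrow>
     (\<exists>phi. \<forall>p x. x \<in> D \<longrightarrow> d1 p x \<longrightarrow> (\<exists>q y. R x y \<and> d2 q y \<and> t2_out phi p q))"

definition comp_fun :: "'a rep \<Rightarrow> 'b rep \<Rightarrow> 'a set \<Rightarrow> ('a \<Rightarrow> 'b) \<Rightarrow> bool" where
  "comp_fun d1 d2 D f \<longleftrightarrow> comp_mv d1 d2 D (\<lambda>x y. y = f x)"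

definition computable_elem :: "'a rep \<Rightarrow> 'a \<Rightarrow> bool" where
  "computable_elem d x \<longleftrightarrow> (\<exists>p. computable_seq p \<and> d p x)"

definition nu_Q :: "nat \<Rightarrow> rat" where
  "nu_Q c = (case prod_decode c of (a, b) \<Rightarrow> of_int (int_decode a) / of_nat (Suc b))"

definition nu_N :: "nat rep" where
  "nu_N p k \<longleftrightarrow> p 0 = k"

definition rho :: "real rep" where
  "rho p x \<longleftrightarrow> (\<forall>i. \<bar>real_of_rat (nu_Q (p i)) - x\<bar> \<le> (1/2) ^ i)"

definition cidx :: "'n::finite \<Rightarrow> nat" where
  "cidx = (SOME h. bij_betw h (UNIV :: 'n set) {..<CARD('n)})"

definition rep_vec :: "'a rep \<Rightarrow> ('a ^ 'n::finite) rep" where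
  "rep_vec d p x \<longleftrightarrow> (\<forall>j. d (\<lambda>k. p (prod_encode (cidx j, k))) (x $ j))"

definition rho_n :: "(real ^ 'n::finite) rep" where
  "rho_n = rep_vec rho"

definition rho_mat :: "(real ^ 'n::finite ^ 'm::finite) rep" where
  "rho_mat = rep_vec (rep_vec rho)"

definition qvec :: "nat \<Rightarrow> real ^ 'n::finite" where
  "qvec c = (\<chi> j. (let xs = list_decode c in
                   if cidx j < length xs then real_of_rat (nu_Q (xs ! cidx j)) else 0))"

definition theta_lt :: "(real ^ 'n::finite) set rep" where
  "theta_lt p U \<longleftrightarrow>
     U = (\<Union>i. ball (qvec (fst (prod_decode (p i)))) (real_of_rat (nu_Q (snd (prod_decode (p i))))))"

definition re_open :: "(real ^ 'n::finite) set \<Rightarrow> bool" where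
  "re_open U \<longleftrightarrow> computable_elem theta_lt U"

definition rep_prod :: "'a rep \<Rightarrow> 'b rep \<Rightarrow> ('a \<times> 'b) rep" where
  "rep_prod d1 d2 p z \<longleftrightarrow> d1 (\<lambda>i. p (2 * i)) (fst z) \<and> d2 (\<lambda>i. p (2 * i + 1)) (snd z)"

definition C1_with_deriv :: "(real ^ 'n::finite \<Rightarrow> real ^ 'm::finite) \<Rightarrow> (real ^ 'n \<Rightarrow> real ^ 'n ^ 'm) \<Rightarrow> (real ^ 'n) set \<Rightarrow> bool" where
  "C1_with_deriv f Df S \<longleftrightarrow>
     (\<forall>x\<in>S. (f has_derivative (\<lambda>h. Df x *v h)) (at x)) \<and> continuous_on S Df"

end

theory Submission
  imports Defs
begin

text \<open>Let \<open>M\<close> be a rational matrix close to a right inverse of \<open>f' x0\<close>. On a small ball, the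
  derivative of \<open>F z = f (x0 + M z)\<close> differs from the identity by at most \<open>1/2\<close> in norm. By
  Banach's fixed point theorem, \<open>F\<close> maps the ball of radius \<open>r\<close> onto a superset of
  \<open>B(f x0, r/2)\<close>, and \<open>F\<close> shrinks distances at most by a factor of \<open>2\<close>. Hence a rational \<open>q\<close>
  for which \<open>F q\<close> is close to \<open>y\<close> is close to the preimage of \<open>y\<close>, and the preimage is computed
  by searching for such \<open>q\<close>. The inverse matrices in the derivative are found in the same way.

  For the second part, a halting computation of the machine for \<open>f'\<close> reads a finite word only, and
  that word begins a name of every point near \<open>x0\<close>. One computation therefore bounds the
  oscillation of \<open>f'\<close> on an explicit neighbourhood, so the hypotheses of the fixed point argument
  are semidecidable.

  Computability is handled through relations that are semidecidable with an oracle: these are closed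
  under existential and bounded universal quantification, contain the graph of every partial
  recursive function, and can be uniformized by a machine.\<close>

section \<open>Total recursive functions\<close>

text \<open>A strict inequality between computable reals can be confirmed by a finite computation,
  but in general it cannot be refuted. Every numerical condition in a search is therefore either a
  strict inequality between reals or a statement about rationals, and the conditions of the second
  part leave a margin: \<open>1/4 + 1/4\<close> makes up the \<open>1/2\<close> that the fixed point
  argument tolerates. No root, determinant or product of two real matrices is computed. Candidates
  are rational, and a candidate is accepted when a residual is small, since the residual controls
  the distance to the exact object. In the first part the rational matrix and the radius are
  constants of the machine, so their mere existence suffices. In the second part they must be found
  from the input, and two names of the same input may lead to different radii; this is why the
  answer is multi-valued. Fixing M also settles which of the many right inverses of f is taken: the
  one with values in the affine space x0 + range M.\<close>

inductive_cases Zr_elim: "rf_eval Zr xs y"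
inductive_cases Sc_elim: "rf_eval Sc xs y"
inductive_cases Idx_elim: "rf_eval (Idx i) xs y"
inductive_cases Cn_elim: "rf_eval (Cn f gs) xs y"
inductive_cases Pr_0_elim: "rf_eval (Pr f g) (0 # xs) y"
inductive_cases Pr_Suc_elim: "rf_eval (Pr f g) (Suc n # xs) y"
inductive_cases Pr_elim: "rf_eval (Pr f g) xs y"
inductive_cases Mn_elim: "rf_eval (Mn f) xs y"

text \<open>Evaluation is only a relation; determinism makes each term a partial function, so that a
  value known from one derivation can be identified with the value from another.\<close>

lemma rf_eval_det: "rf_eval f xs y \<Longrightarrow> rf_eval f xs z \<Longrightarrow> y = z"
proof (induction arbitrary: z rule: rf_eval.induct)
  case (zero xs)
  then show ?case by (elim Zr_elim) simp
next
  case (succ x xs)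
  then show ?case by (elim Sc_elim) simp
next
  case (proj i xs)
  then show ?case by (elim Idx_elim) simp
next
  case (comp xs gs ys f z za)
  from comp.prems obtain ys' where ys': "list_all2 (\<lambda>g y. rf_eval g xs y) gs ys'" "rf_eval f ys' za"
    by (rule Cn_elim)
  have "ys = ys'"
  proof (rule nth_equalityI)
    show "length ys = length ys'"
      using comp.IH(1) ys'(1) by (simp add: list_all2_conv_all_nth)
    show "ys ! i = ys' ! i" if "i < length ys" for i
    proof -
      have "i < length gs" using comp.IH(1) that by (simp add: list_all2_conv_all_nth)
      with comp.IH(1) ys'(1) show ?thesis
        unfolding list_all2_conv_all_nth by blast
    qed
  qed
  with ys'(2) show ?case by (intro comp.IH(2)) simp
next
  case (pr0 f xs y g)
  then show ?case by (elim Pr_0_elim) blast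
next
  case (prS f g n xs y z za)
  from prS.prems obtain y' where "rf_eval (Pr f g) (n # xs) y'" "rf_eval g (n # y' # xs) za"
    by (rule Pr_Suc_elim)
  with prS.IH show ?case by blast
next
  case (mn f n xs)
  from mn.prems obtain 1: "rf_eval f (z # xs) 0" and 2: "\<forall>i<z. \<exists>y. rf_eval f (i # xs) (Suc y)"
    by (rule Mn_elim)
  have "\<not> n < z"
  proof
    assume "n < z"
    with 2 obtain y where "rf_eval f (n # xs) (Suc y)" by blast
    from mn.IH(1)[OF this] show False by simp
  qed
  moreover have "\<not> z < n"
  proof
    assume "z < n"
    with mn.IH(2) obtain y where y: "\<And>v. rf_eval f (z # xs) v \<Longrightarrow> Suc y = v" by blast
    from y[OF 1] show False by simp
  qed
  ultimately show ?case by simp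
qed


text \<open>Terms of \<open>recf\<close> carry no arity, so it is imposed through the length of the
  argument list; behaviour on lists of other lengths is left open.\<close>

definition rcf :: "nat \<Rightarrow> (nat list \<Rightarrow> nat) \<Rightarrow> bool" where
  "rcf n g \<longleftrightarrow> (\<exists>F. \<forall>xs. length xs = n \<longrightarrow> rf_eval F xs (g xs))"

lemma rcf_nth: "i < n \<Longrightarrow> rcf n (\<lambda>xs. xs ! i)"
  unfolding rcf_def by (rule exI[of _ "Idx i"]) (auto intro: rf_eval.proj)

lemma rcf_comp1:
  assumes "rcf 1 (\<lambda>xs. f (xs ! 0))" "rcf n g"
  shows "rcf n (\<lambda>xs. f (g xs))"
proof -
  obtain F G where F: "\<And>xs. length xs = 1 \<Longrightarrow> rf_eval F xs (f (xs ! 0))"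
    and G: "\<And>xs. length xs = n \<Longrightarrow> rf_eval G xs (g xs)"
    using assms unfolding rcf_def by metis
  have "rf_eval (Cn F [G]) xs (f (g xs))" if "length xs = n" for xs
    using F[of "[g xs]"] G[OF that] by (auto intro!: rf_eval.comp[where ys = "[g xs]"])
  then show ?thesis unfolding rcf_def by blast
qed

lemma rcf_comp2:
  assumes "rcf 2 (\<lambda>xs. f (xs ! 0) (xs ! 1))" "rcf n g" "rcf n h"
  shows "rcf n (\<lambda>xs. f (g xs) (h xs))"
proof -
  obtain F G H where F: "\<And>xs. length xs = 2 \<Longrightarrow> rf_eval F xs (f (xs ! 0) (xs ! 1))"
    and G: "\<And>xs. length xs = n \<Longrightarrow> rf_eval G xs (g xs)"
    and H: "\<And>xs. length xs = n \<Longrightarrow> rf_eval H xs (h xs)"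
    using assms unfolding rcf_def by metis
  have "rf_eval (Cn F [G, H]) xs (f (g xs) (h xs))" if "length xs = n" for xs
    using F[of "[g xs, h xs]"] G[OF that] H[OF that]
    by (auto intro!: rf_eval.comp[where ys = "[g xs, h xs]"])
  then show ?thesis unfolding rcf_def by blast
qed

lemma rcf_Suc: "rcf n g \<Longrightarrow> rcf n (\<lambda>xs. Suc (g xs))"
proof (rule rcf_comp1[of Suc])
  have "rf_eval Sc xs (Suc (xs ! 0))" if "length xs = 1" for xs
    using that by (cases xs) (auto intro: rf_eval.succ)
  then show "rcf 1 (\<lambda>xs. Suc (xs ! 0))"
    unfolding rcf_def by blast
qed

lemma rcf_const: "rcf n (\<lambda>xs. c)"
proof (induction c)
  case 0
  show ?case unfolding rcf_def by (rule exI[of _ Zr]) (auto intro: rf_eval.zero)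
next
  case (Suc c)
  then show ?case by (rule rcf_Suc)
qed

lemma rcf_rec_nat:
  assumes "rcf 1 (\<lambda>xs. a (xs ! 0))" "rcf 3 (\<lambda>xs. g (xs ! 0) (xs ! 1) (xs ! 2))"
  shows "rcf 2 (\<lambda>xs. rec_nat (a (xs ! 1)) (\<lambda>i y. g i y (xs ! 1)) (xs ! 0))"
proof -
  obtain F G where F: "\<And>xs. length xs = 1 \<Longrightarrow> rf_eval F xs (a (xs ! 0))"
    and G: "\<And>xs. length xs = 3 \<Longrightarrow> rf_eval G xs (g (xs ! 0) (xs ! 1) (xs ! 2))"
    using assms unfolding rcf_def by metis
  have *: "rf_eval (Pr F G) [n, x] (rec_nat (a x) (\<lambda>i y. g i y x) n)" for n x
  proof (induction n)
    case 0
    show ?case using F[of "[x]"] by (auto intro: rf_eval.pr0)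
  next
    case (Suc n)
    show ?case
      using rf_eval.prS[OF Suc] G[of "[n, rec_nat (a x) (\<lambda>i y. g i y x) n, x]"] by simp
  qed
  have "rf_eval (Pr F G) xs (rec_nat (a (xs ! 1)) (\<lambda>i y. g i y (xs ! 1)) (xs ! 0))"
    if "length xs = 2" for xs
    using that *[of "xs ! 0" "xs ! 1"]
    by (auto simp: numeral_2_eq_2 length_Suc_conv)
  then show ?thesis unfolding rcf_def by blast
qed

lemma rcf_Least:
  assumes "rcf 2 (\<lambda>xs. f (xs ! 0) (xs ! 1))" "\<And>x. \<exists>v. f v x = 0"
  shows "rcf 1 (\<lambda>xs. LEAST v. f v (xs ! 0) = 0)"
proof -
  obtain F where F: "\<And>xs. length xs = 2 \<Longrightarrow> rf_eval F xs (f (xs ! 0) (xs ! 1))"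
    using assms unfolding rcf_def by metis
  have "rf_eval (Mn F) [x] (LEAST v. f v x = 0)" for x
  proof (rule rf_eval.mn)
    have "f (LEAST v. f v x = 0) x = 0"
      using assms(2) by (rule LeastI_ex)
    then show "rf_eval F [LEAST v. f v x = 0, x] 0"
      using F[of "[LEAST v. f v x = 0, x]"] by simp
    show "\<forall>i<(LEAST v. f v x = 0). \<exists>y. rf_eval F [i, x] (Suc y)"
    proof (intro allI impI)
      fix i assume "i < (LEAST v. f v x = 0)"
      then have "f i x \<noteq> 0" by (rule not_less_Least)
      then show "\<exists>y. rf_eval F [i, x] (Suc y)"
        using F[of "[i, x]"] by (auto simp: gr0_conv_Suc)
    qed
  qed
  then show ?thesis unfolding rcf_def
    by (intro exI[of _ "Mn F"]) (auto simp: length_Suc_conv)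
qed

lemma rcf_add: "rcf n g \<Longrightarrow> rcf n h \<Longrightarrow> rcf n (\<lambda>xs. g xs + h xs)"
proof (rule rcf_comp2[of "(+)"])
  have "rec_nat y (\<lambda>i z. Suc z) x = x + y" for x y :: nat
    by (induction x) auto
  then show "rcf 2 (\<lambda>xs. xs ! 0 + xs ! 1)"
    using rcf_rec_nat[of "\<lambda>x. x" "\<lambda>i y x. Suc y"] by (simp add: rcf_nth rcf_Suc)
qed

lemma rcf_mult: "rcf n g \<Longrightarrow> rcf n h \<Longrightarrow> rcf n (\<lambda>xs. g xs * h xs)"
proof (rule rcf_comp2[of "(*)"])
  have "rec_nat 0 (\<lambda>i z. z + y) x = x * y" for x y :: nat
    by (induction x) auto
  then show "rcf 2 (\<lambda>xs. xs ! 0 * xs ! 1)"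
    using rcf_rec_nat[of "\<lambda>x. 0" "\<lambda>i z y. z + y"] by (simp add: rcf_nth rcf_add rcf_const)
qed

lemma rcf_pred: "rcf n g \<Longrightarrow> rcf n (\<lambda>xs. g xs - 1)"
proof (rule rcf_comp1[of "\<lambda>x. x - 1"])
  have "rec_nat 0 (\<lambda>i z. i) x = x - 1" for x :: nat
    by (cases x) auto
  then have "rcf 2 (\<lambda>xs. xs ! 0 - 1)"
    using rcf_rec_nat[of "\<lambda>x. 0" "\<lambda>i z y. i"] by (simp add: rcf_nth rcf_const)
  from rcf_comp2[OF this, of 1 "\<lambda>xs. xs ! 0" "\<lambda>xs. xs ! 0"]
  show "rcf 1 (\<lambda>xs. xs ! 0 - 1)" by (simp add: rcf_nth)
qed

lemma rcf_diff: "rcf n g \<Longrightarrow> rcf n h \<Longrightarrow> rcf n (\<lambda>xs. g xs - h xs)"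
proof (rule rcf_comp2[of "\<lambda>x y. x - y"])
  have "rec_nat y (\<lambda>i z. z - 1) x = y - x" for x y :: nat
    by (induction x) auto
  then have "rcf 2 (\<lambda>xs. xs ! 1 - xs ! 0)"
    using rcf_rec_nat[of "\<lambda>x. x" "\<lambda>i z y. z - 1"] rcf_pred[OF rcf_nth, of 1 3]
    by (simp add: rcf_nth)
  from rcf_comp2[OF this, of 2 "\<lambda>xs. xs ! 1" "\<lambda>xs. xs ! 0"]
  show "rcf 2 (\<lambda>xs. xs ! 0 - xs ! 1)" by (simp add: rcf_nth)
qed

lemma rcf_triangle: "rcf n g \<Longrightarrow> rcf n (\<lambda>xs. triangle (g xs))"
proof (rule rcf_comp1[of triangle])
  have "rec_nat 0 (\<lambda>i z. z + Suc i) x = triangle x" for x :: nat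
    by (induction x) auto
  then have "rcf 2 (\<lambda>xs. triangle (xs ! 0))"
    using rcf_rec_nat[of "\<lambda>x. 0" "\<lambda>i z y. z + Suc i"]
    by (simp add: rcf_nth rcf_const rcf_add rcf_Suc del: add_Suc_right)
  from rcf_comp2[OF this, of 1 "\<lambda>xs. xs ! 0" "\<lambda>xs. xs ! 0"]
  show "rcf 1 (\<lambda>xs. triangle (xs ! 0))" by (simp add: rcf_nth)
qed

abbreviation pair :: "nat \<Rightarrow> nat \<Rightarrow> nat" where
  "pair a b \<equiv> prod_encode (a, b)"

abbreviation pr1 :: "nat \<Rightarrow> nat" where
  "pr1 z \<equiv> fst (prod_decode z)"

abbreviation pr2 :: "nat \<Rightarrow> nat" where
  "pr2 z \<equiv> snd (prod_decode z)"

lemma rcf_pair: "rcf n g \<Longrightarrow> rcf n h \<Longrightarrow> rcf n (\<lambda>xs. pair (g xs) (h xs))"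
  unfolding prod_encode_def by (simp add: rcf_add rcf_triangle)

lemma triangle_mono: "m \<le> n \<Longrightarrow> triangle m \<le> triangle n"
  by (induction n) (auto simp: le_Suc_eq)

lemma le_triangle: "n \<le> triangle n"
  by (induction n) auto

text \<open>The Cantor code of (a, b) is \<open>triangle (a + b) + a\<close>. It lies in the block
  between the triangular numbers of index a + b and a + b + 1, so a search for the block recovers a
  + b.\<close>

lemma Least_triangle: "(LEAST v. z < triangle (Suc v)) = pr1 z + pr2 z"
proof -
  obtain a b where z: "z = pair a b"
    by (metis prod_decode_inverse surj_pair)
  have "a + b \<le> v" if "z < triangle (Suc v)" for v
  proof (rule ccontr)
    assume "\<not> a + b \<le> v"
    then have "triangle (Suc v) \<le> triangle (a + b)"
      by (intro triangle_mono) auto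
    with that show False unfolding z prod_encode_def by simp
  qed
  moreover have "z < triangle (Suc (a + b))"
    unfolding z prod_encode_def by simp
  ultimately have "(LEAST v. z < triangle (Suc v)) = a + b"
    by (intro Least_equality)
  then show ?thesis
    by (simp add: z del: triangle_Suc)
qed

text \<open>Once a + b is found by minimization, a is the offset of the code in its block and b is
  what remains of the sum.\<close>

lemma rcf_pr1: "rcf n g \<Longrightarrow> rcf n (\<lambda>xs. pr1 (g xs))"
  and rcf_pr2: "rcf n g \<Longrightarrow> rcf n (\<lambda>xs. pr2 (g xs))"
proof -
  have eq: "(LEAST v. Suc z - triangle (Suc v) = 0) = pr1 z + pr2 z" for z
    using Least_triangle[of z] by (simp only: diff_is_0_eq Suc_le_eq)
  have s: "rcf 1 (\<lambda>xs. pr1 (xs ! 0) + pr2 (xs ! 0))"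
    unfolding eq[symmetric]
  proof (rule rcf_Least)
    show "rcf 2 (\<lambda>xs. Suc (xs ! 1) - triangle (Suc (xs ! 0)))"
      by (intro rcf_diff rcf_Suc rcf_triangle rcf_nth) auto
    show "\<exists>v. Suc x - triangle (Suc v) = 0" for x
      by (rule exI[of _ x]) (use le_triangle[of "Suc x"] in simp)
  qed
  have 1: "pr1 z = z - triangle (pr1 z + pr2 z)" for z
  proof -
    obtain a b where z: "prod_decode z = (a, b)" by fastforce
    then have "z = triangle (a + b) + a"
      using prod_decode_inverse[of z] by (simp add: prod_encode_def)
    then have "z - triangle (a + b) = a" by linarith
    with z show ?thesis by simp
  qed
  have "rcf 1 (\<lambda>xs. xs ! 0 - triangle (pr1 (xs ! 0) + pr2 (xs ! 0)))"
    by (intro rcf_diff rcf_triangle s rcf_nth) auto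
  then have p1: "rcf 1 (\<lambda>xs. pr1 (xs ! 0))"
    unfolding 1[symmetric] .
  have "rcf 1 (\<lambda>xs. (pr1 (xs ! 0) + pr2 (xs ! 0)) - pr1 (xs ! 0))"
    by (intro rcf_diff s p1)
  then have p2: "rcf 1 (\<lambda>xs. pr2 (xs ! 0))"
    by simp
  show "rcf n g \<Longrightarrow> rcf n (\<lambda>xs. pr1 (g xs))"
    by (rule rcf_comp1[of pr1, OF p1])
  show "rcf n g \<Longrightarrow> rcf n (\<lambda>xs. pr2 (g xs))"
    by (rule rcf_comp1[of pr2, OF p2])
qed

subsection \<open>Unary functions on coded tuples\<close>

lemma computable_seq_iff_rcf: "computable_seq f \<longleftrightarrow> rcf 1 (\<lambda>xs. f (xs ! 0))"
proof
  assume "computable_seq f"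
  then obtain F where F: "\<And>i. rf_eval F [i] (f i)"
    unfolding computable_seq_def by blast
  show "rcf 1 (\<lambda>xs. f (xs ! 0))"
    unfolding rcf_def by (rule exI[of _ F]) (auto simp: length_Suc_conv F)
next
  assume "rcf 1 (\<lambda>xs. f (xs ! 0))"
  then obtain F where F: "\<And>xs. length xs = 1 \<Longrightarrow> rf_eval F xs (f (xs ! 0))"
    unfolding rcf_def by blast
  show "computable_seq f"
    unfolding computable_seq_def
    by (rule exI[of _ F]) (use F[of "[_]"] in simp)
qed

lemma rcf_compose: "computable_seq f \<Longrightarrow> rcf n g \<Longrightarrow> rcf n (\<lambda>xs. f (g xs))"
  unfolding computable_seq_iff_rcf by (rule rcf_comp1)

lemma tc_id: "computable_seq (\<lambda>x. x)"
  and tc_const: "computable_seq (\<lambda>x. c)"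
  by (simp_all add: computable_seq_iff_rcf rcf_nth rcf_const)

lemma tc_comp: "computable_seq f \<Longrightarrow> computable_seq g \<Longrightarrow> computable_seq (\<lambda>x. f (g x))"
  unfolding computable_seq_iff_rcf[of g] computable_seq_iff_rcf[of "\<lambda>x. f (g x)"] by (rule rcf_compose)

lemma tc_Suc: "computable_seq f \<Longrightarrow> computable_seq (\<lambda>x. Suc (f x))"
  and tc_pr1: "computable_seq f \<Longrightarrow> computable_seq (\<lambda>x. pr1 (f x))"
  and tc_pr2: "computable_seq f \<Longrightarrow> computable_seq (\<lambda>x. pr2 (f x))"
  by (simp_all add: computable_seq_iff_rcf rcf_Suc rcf_pr1 rcf_pr2)

lemma tc_add: "computable_seq f \<Longrightarrow> computable_seq g \<Longrightarrow> computable_seq (\<lambda>x. f x + g x)"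
  and tc_mult: "computable_seq f \<Longrightarrow> computable_seq g \<Longrightarrow> computable_seq (\<lambda>x. f x * g x)"
  and tc_diff: "computable_seq f \<Longrightarrow> computable_seq g \<Longrightarrow> computable_seq (\<lambda>x. f x - g x)"
  and tc_pair: "computable_seq f \<Longrightarrow> computable_seq g \<Longrightarrow> computable_seq (\<lambda>x. pair (f x) (g x))"
  by (simp_all add: computable_seq_iff_rcf rcf_add rcf_mult rcf_diff rcf_pair)

lemma tc_rec_nat:
  assumes a: "computable_seq a" and b: "computable_seq b"
    and g: "computable_seq (\<lambda>z. g (pr1 z) (pr1 (pr2 z)) (pr2 (pr2 z)))"
  shows "computable_seq (\<lambda>x. rec_nat (a x) (\<lambda>i y. g i y x) (b x))"
proof -
  have "rcf 3 (\<lambda>xs. g (xs ! 0) (xs ! 1) (xs ! 2))"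
    using rcf_compose[OF g, of 3 "\<lambda>xs. pair (xs ! 0) (pair (xs ! 1) (xs ! 2))"]
    by (simp add: rcf_pair rcf_nth)
  from rcf_rec_nat[OF a[unfolded computable_seq_iff_rcf] this]
  have "rcf 2 (\<lambda>xs. rec_nat (a (xs ! 1)) (\<lambda>i y. g i y (xs ! 1)) (xs ! 0))" .
  from rcf_comp2[OF this, of 1 "\<lambda>xs. b (xs ! 0)" "\<lambda>xs. xs ! 0"]
  show ?thesis
    using b by (simp add: computable_seq_iff_rcf rcf_nth)
qed

lemma tc_funpow:
  assumes "computable_seq h" "computable_seq f" "computable_seq g"
  shows "computable_seq (\<lambda>x. (h ^^ f x) (g x))"
proof -
  have "rec_nat y (\<lambda>i z. h z) n = (h ^^ n) y" for y n
    by (induction n) auto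
  then show ?thesis
    using tc_rec_nat[OF assms(3,2), of "\<lambda>i y x. h y"] assms(1)
    by (simp add: tc_comp[OF assms(1)] tc_pr1 tc_pr2 tc_id)
qed

lemma tc_power:
  assumes "computable_seq f" "computable_seq g"
  shows "computable_seq (\<lambda>x. f x ^ g x)"
proof -
  have "rec_nat 1 (\<lambda>i z. m * z) n = m ^ n" for m n :: nat
    by (induction n) auto
  then show ?thesis
    using tc_rec_nat[OF tc_const[of 1] assms(2), of "\<lambda>i y x. f x * y"]
    by (simp add: tc_comp[OF assms(1)] tc_mult tc_pr1 tc_pr2 tc_id)
qed

section \<open>Decidable predicates of natural numbers\<close>

definition dec :: "(nat \<Rightarrow> bool) \<Rightarrow> bool" where
  "dec P \<longleftrightarrow> computable_seq (\<lambda>x. of_bool (P x))"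

lemma dec_const: "dec (\<lambda>x. c)"
  unfolding dec_def by (rule tc_const)

lemma dec_comp: "dec P \<Longrightarrow> computable_seq f \<Longrightarrow> dec (\<lambda>x. P (f x))"
  unfolding dec_def by (rule tc_comp)

lemma dec_not: "dec P \<Longrightarrow> dec (\<lambda>x. \<not> P x)"
  proof -
  have "1 - of_bool (P x) = (of_bool (\<not> P x) :: nat)" for x
    by simp
  then show "dec P \<Longrightarrow> dec (\<lambda>x. \<not> P x)"
    unfolding dec_def using tc_diff[OF tc_const[of 1], of "\<lambda>x. of_bool (P x)"] by (simp only:)
qed

lemma dec_conj: "dec P \<Longrightarrow> dec Q \<Longrightarrow> dec (\<lambda>x. P x \<and> Q x)"
  unfolding dec_def of_bool_conj by (rule tc_mult)

lemma dec_disj: "dec P \<Longrightarrow> dec Q \<Longrightarrow> dec (\<lambda>x. P x \<or> Q x)"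
  using dec_not[OF dec_conj[OF dec_not dec_not], of P Q] by simp

lemma dec_imp: "dec P \<Longrightarrow> dec Q \<Longrightarrow> dec (\<lambda>x. P x \<longrightarrow> Q x)"
  unfolding imp_conv_disj by (intro dec_disj dec_not)

lemma dec_less:
  fixes f g :: "nat \<Rightarrow> nat"
  shows "computable_seq f \<Longrightarrow> computable_seq g \<Longrightarrow> dec (\<lambda>x. f x < g x)"
proof -
  assume "computable_seq f" "computable_seq g"
  then have "computable_seq (\<lambda>x. 1 - (1 - (g x - f x)))"
    by (intro tc_diff tc_const)
  moreover have "1 - (1 - (n - m)) = of_bool (m < n)" for m n :: nat
    by auto
  ultimately show ?thesis unfolding dec_def by simp
qed

lemma dec_le:
  fixes f g :: "nat \<Rightarrow> nat"
  shows "computable_seq f \<Longrightarrow> computable_seq g \<Longrightarrow> dec (\<lambda>x. f x \<le> g x)"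
  using dec_not[OF dec_less, of g f] by (simp add: not_less)

lemma dec_eq:
  fixes f g :: "nat \<Rightarrow> nat"
  shows "computable_seq f \<Longrightarrow> computable_seq g \<Longrightarrow> dec (\<lambda>x. f x = g x)"
  unfolding order_eq_iff[where 'a = nat] by (intro dec_conj dec_le)

text \<open>A bounded universal quantifier is a product of truth values, accumulated by primitive
  recursion.\<close>

lemma dec_ball:
  assumes "computable_seq b" "dec (\<lambda>z. P (pr1 z) (pr2 z))"
  shows "dec (\<lambda>x. \<forall>i<b x. P i x)"
proof -
  have "rec_nat 1 (\<lambda>i y. y * of_bool (P i x)) n = (of_bool (\<forall>i<n. P i x) :: nat)" for x n
    by (induction n) (auto simp: less_Suc_eq)
  moreover have "dec (\<lambda>z. P (pr1 z) (pr2 (pr2 z)))"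
    using dec_comp[OF assms(2), of "\<lambda>z. pair (pr1 z) (pr2 (pr2 z))"]
    by (simp add: tc_pair tc_pr1 tc_pr2 tc_id)
  then have "computable_seq (\<lambda>x. rec_nat 1 (\<lambda>i y. y * of_bool (P i x)) (b x))"
    by (intro tc_rec_nat tc_const assms tc_mult) (simp_all add: tc_pr1 tc_pr2 tc_id dec_def)
  ultimately show ?thesis unfolding dec_def by simp
qed

lemma dec_bex:
  assumes "computable_seq b" "dec (\<lambda>z. P (pr1 z) (pr2 z))"
  shows "dec (\<lambda>x. \<exists>i<b x. P i x)"
  using dec_not[OF dec_ball[OF assms(1) dec_not[OF assms(2)]]] by simp

lemma tc_if:
  assumes "dec P" "computable_seq f" "computable_seq g"
  shows "computable_seq (\<lambda>x. if P x then f x else g x)"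
proof -
  have "computable_seq (\<lambda>x. of_bool (P x) * f x + of_bool (\<not> P x) * g x)"
    using assms dec_not[OF assms(1)] unfolding dec_def by (intro tc_add tc_mult)
  moreover have "of_bool (P x) * f x + of_bool (\<not> P x) * g x = (if P x then f x else g x)" for x
    by simp
  ultimately show ?thesis by simp
qed

lemma tc_Least:
  assumes P: "dec (\<lambda>z. P (pr1 z) (pr2 z))" and ex: "\<And>x. \<exists>v. P v x"
  shows "computable_seq (\<lambda>x. LEAST v. P v x)"
proof -
  have "rcf 2 (\<lambda>xs. of_bool (\<not> P (xs ! 0) (xs ! 1)))"
    using rcf_compose[OF dec_not[OF P, unfolded dec_def], of 2 "\<lambda>xs. pair (xs ! 0) (xs ! 1)"]
    by (simp add: rcf_pair rcf_nth del: of_bool_not_iff)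
  from rcf_Least[OF this] ex show ?thesis
    by (simp add: computable_seq_iff_rcf)
qed

lemma Least_div_2: "(LEAST v. n < 2 * Suc v) = n div 2"
  by (rule Least_equality) auto

lemma tc_div_2:
  assumes "computable_seq f"
  shows "computable_seq (\<lambda>x. f x div 2)"
proof -
  have "computable_seq (\<lambda>n. LEAST v. n < 2 * Suc v)"
  proof (rule tc_Least)
    show "dec (\<lambda>z. pr2 z < 2 * Suc (pr1 z))"
      by (intro dec_less tc_pr2 tc_pr1 tc_mult tc_const tc_Suc tc_id)
    show "\<exists>v. n < 2 * Suc v" for n by (rule exI[of _ n]) simp
  qed
  then show ?thesis
    unfolding Least_div_2 using assms by (rule tc_comp)
qed

lemmas tc_intros = tc_id tc_const tc_Suc tc_pr1 tc_pr2 tc_add tc_mult tc_diff tc_pair tc_power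
  tc_if tc_div_2

lemmas dec_intros = dec_const dec_not dec_conj dec_disj dec_imp dec_less dec_le dec_eq
  dec_ball dec_bex

subsection \<open>Coded lists\<close>

text \<open>In \<open>list_encode\<close>, 0 is the empty list and a nonempty list is the successor
  of the pair of its head and the code of its tail. As 0 decodes to the pair (0, 0), the empty list
  is its own tail, and entries beyond the end read as 0.\<close>

definition tlc :: "nat \<Rightarrow> nat" where
  "tlc c = pr2 (c - 1)"

definition nthc :: "nat \<Rightarrow> nat \<Rightarrow> nat" where
  "nthc c i = pr1 ((tlc ^^ i) c - 1)"

definition lenc :: "nat \<Rightarrow> nat" where
  "lenc c = (LEAST i. (tlc ^^ i) c = 0)"

abbreviation consc :: "nat \<Rightarrow> nat \<Rightarrow> nat" where
  "consc a c \<equiv> Suc (pair a c)"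

lemma prod_decode_0: "prod_decode 0 = (0, 0)"
  by (simp add: prod_decode_def prod_decode_aux.simps)

lemma tlc_list_encode: "tlc (list_encode xs) = list_encode (tl xs)"
  by (cases xs) (auto simp: tlc_def prod_decode_0)

lemma tlc_funpow_list_encode: "(tlc ^^ i) (list_encode xs) = list_encode (drop i xs)"
  by (induction i) (auto simp: tlc_list_encode tl_drop drop_Suc)

lemma nthc_list_encode: "nthc (list_encode xs) i = (if i < length xs then xs ! i else 0)"
proof (cases "i < length xs")
  case True
  then have "drop i xs = xs ! i # drop (Suc i) xs"
    by (simp add: Cons_nth_drop_Suc)
  with True show ?thesis by (simp add: nthc_def tlc_funpow_list_encode)
qed (simp add: nthc_def tlc_funpow_list_encode prod_decode_0)

lemma list_encode_eq_0: "list_encode xs = 0 \<longleftrightarrow> xs = []"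
  by (cases xs) auto

lemma lenc_list_encode: "lenc (list_encode xs) = length xs"
  unfolding lenc_def tlc_funpow_list_encode list_encode_eq_0
  by (rule Least_equality) auto

lemma nthc_eq: "nthc c i = (if i < length (list_decode c) then list_decode c ! i else 0)"
  using nthc_list_encode[of "list_decode c"] by simp

lemma lenc_eq: "lenc c = length (list_decode c)"
  using lenc_list_encode[of "list_decode c"] by simp

lemma list_decode_consc: "list_decode (consc a c) = a # list_decode c"
  by simp

lemma list_decode_tlc: "list_decode (tlc c) = tl (list_decode c)"
  using tlc_list_encode[of "list_decode c"] by (metis list_decode_inverse list_encode_inverse)

lemma tc_tlc: "computable_seq f \<Longrightarrow> computable_seq (\<lambda>x. tlc (f x))"
  unfolding tlc_def by (intro tc_intros)

lemma tc_nthc: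
  assumes "computable_seq f" "computable_seq g"
  shows "computable_seq (\<lambda>x. nthc (f x) (g x))"
  unfolding nthc_def
  by (intro tc_pr1 tc_diff tc_const tc_funpow assms) (intro tc_tlc tc_id)

lemma tc_lenc: "computable_seq f \<Longrightarrow> computable_seq (\<lambda>x. lenc (f x))"
proof (rule tc_comp[of lenc])
  show "computable_seq lenc"
    unfolding lenc_def[abs_def]
  proof (rule tc_Least)
    have "computable_seq tlc" using tc_tlc[OF tc_id] by simp
    then show "dec (\<lambda>z. (tlc ^^ pr1 z) (pr2 z) = 0)"
      by (intro dec_eq tc_funpow tc_intros)
    show "\<exists>i. (tlc ^^ i) c = 0" for c
      using tlc_funpow_list_encode[of "length (list_decode c)" "list_decode c"] by auto
  qed
qed

text \<open>This turns a finite history, such as the successive values of a primitive recursion,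
  into a single number that an existential quantifier can range over.\<close>

lemma ex_code_of_fun: "\<exists>c. lenc c = n \<and> (\<forall>i<n. nthc c i = s i)"
  by (rule exI[of _ "list_encode (map s [0..<n])"]) (auto simp: lenc_list_encode nthc_list_encode)

lemmas tc_intros' = tc_intros tc_nthc tc_lenc tc_tlc

section \<open>Semidecidable relations with an oracle\<close>

abbreviation pcode :: "(nat \<Rightarrow> nat) \<Rightarrow> nat \<Rightarrow> nat" where
  "pcode p k \<equiv> list_encode (prefix p k)"

definition pfx :: "(nat \<Rightarrow> nat) \<Rightarrow> nat \<Rightarrow> bool" where
  "pfx p u \<longleftrightarrow> (\<forall>j<lenc u. nthc u j = p j)"

definition ispre :: "nat \<Rightarrow> nat \<Rightarrow> bool" where
  "ispre v u \<longleftrightarrow> lenc v \<le> lenc u \<and> (\<forall>j<lenc v. nthc v j = nthc u j)"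

lemma lenc_pcode: "lenc (pcode p k) = k"
  by (simp add: lenc_list_encode prefix_def)

lemma nthc_pcode: "j < k \<Longrightarrow> nthc (pcode p k) j = p j"
  by (simp add: nthc_list_encode prefix_def)

lemma pfx_pcode: "pfx p (pcode p k)"
  by (simp add: pfx_def lenc_pcode nthc_pcode)

lemma pfx_ispre: "pfx p u \<Longrightarrow> ispre v u \<Longrightarrow> pfx p v"
  by (auto simp: pfx_def ispre_def)

lemma ispre_pcode: "pfx p v \<Longrightarrow> lenc v \<le> k \<Longrightarrow> ispre v (pcode p k)"
  by (auto simp: pfx_def ispre_def lenc_pcode nthc_pcode)

lemma dec_ispre:
  assumes "computable_seq f" "computable_seq g"
  shows "dec (\<lambda>x. ispre (f x) (g x))"
  unfolding ispre_def
  by (intro dec_intros tc_intros' tc_comp[OF assms(1)] tc_comp[OF assms(2)])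

text \<open>In the code \<open>c\<close> of a computation, the first component is the finite part of the oracle
  that the computation has read.\<close>

definition sg :: "((nat \<Rightarrow> nat) \<Rightarrow> bool) \<Rightarrow> ((nat \<Rightarrow> nat) \<Rightarrow> nat \<Rightarrow> bool) \<Rightarrow> bool" where
  "sg D S \<longleftrightarrow> (\<exists>T. dec T \<and> (\<forall>p x. D p \<longrightarrow> (S p x \<longleftrightarrow> (\<exists>c. T (pair x c) \<and> pfx p (pr1 c)))))"

lemma sgI:
  assumes "dec T" "\<And>p x. D p \<Longrightarrow> S p x \<longleftrightarrow> (\<exists>c. T (pair x c) \<and> pfx p (pr1 c))"
  shows "sg D S"
  using assms unfolding sg_def by blast

lemma sgE:
  assumes "sg D S"
  obtains T where "dec T" "\<And>p x. D p \<Longrightarrow> S p x \<longleftrightarrow> (\<exists>c. T (pair x c) \<and> pfx p (pr1 c))"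
  using assms unfolding sg_def by blast

lemma sg_cong:
  assumes "sg D S" "\<And>p x. D p \<Longrightarrow> S' p x \<longleftrightarrow> S p x"
  shows "sg D S'"
  using assms unfolding sg_def by simp

lemma sg_subst:
  assumes "sg D S" "computable_seq f"
  shows "sg D (\<lambda>p x. S p (f x))"
proof -
  obtain T where T: "dec T" "\<And>p x. D p \<Longrightarrow> S p x \<longleftrightarrow> (\<exists>c. T (pair x c) \<and> pfx p (pr1 c))"
    using assms(1) by (rule sgE) blast
  show ?thesis
  proof (rule sgI)
    show "dec (\<lambda>z. T (pair (f (pr1 z)) (pr2 z)))"
      by (intro dec_comp[OF T(1)] tc_intros tc_comp[OF assms(2)])
  qed (simp add: T(2))
qed

lemma sg_dec: "dec P \<Longrightarrow> sg D (\<lambda>p x. P x)"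
proof (rule sgI)
  assume "dec P"
  then show "dec (\<lambda>z. P (pr1 z))"
    by (rule dec_comp) (intro tc_intros)
  show "P x \<longleftrightarrow> (\<exists>c. P (pr1 (pair x c)) \<and> pfx p (pr1 c))" for p x
    using pfx_pcode[of p 0] by (auto intro: exI[of _ "pair (pcode p 0) 0"])
qed

lemma sg_oracle:
  assumes "computable_seq f" "computable_seq g"
  shows "sg D (\<lambda>p x. p (f x) = g x)"
proof (rule sgI)
  show "dec (\<lambda>z. f (pr1 z) < lenc (pr1 (pr2 z)) \<and> nthc (pr1 (pr2 z)) (f (pr1 z)) = g (pr1 z))"
    by (intro dec_intros tc_intros' tc_comp[OF assms(1)] tc_comp[OF assms(2)])
  show "p (f x) = g x \<longleftrightarrow> (\<exists>c. (f (pr1 (pair x c)) < lenc (pr1 (pr2 (pair x c))) \<and>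
      nthc (pr1 (pr2 (pair x c))) (f (pr1 (pair x c))) = g (pr1 (pair x c))) \<and> pfx p (pr1 c))" for p x
  proof
    assume "p (f x) = g x"
    then show "\<exists>c. (f (pr1 (pair x c)) < lenc (pr1 (pr2 (pair x c))) \<and>
      nthc (pr1 (pr2 (pair x c))) (f (pr1 (pair x c))) = g (pr1 (pair x c))) \<and> pfx p (pr1 c)"
      by (intro exI[of _ "pair (pcode p (Suc (f x))) 0"]) (simp add: lenc_pcode nthc_pcode pfx_pcode)
  qed (auto simp: pfx_def)
qed

lemma sg_disj:
  assumes "sg D S" "sg D S'"
  shows "sg D (\<lambda>p x. S p x \<or> S' p x)"
proof -
  obtain T where T: "dec T" "\<And>p x. D p \<Longrightarrow> S p x \<longleftrightarrow> (\<exists>c. T (pair x c) \<and> pfx p (pr1 c))"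
    using assms(1) by (rule sgE) blast
  obtain T' where T': "dec T'" "\<And>p x. D p \<Longrightarrow> S' p x \<longleftrightarrow> (\<exists>c. T' (pair x c) \<and> pfx p (pr1 c))"
    using assms(2) by (rule sgE) blast
  show ?thesis
    by (rule sgI[OF dec_disj[OF T(1) T'(1)]]) (auto simp: T(2) T'(2))
qed

lemma sg_imp: "dec P \<Longrightarrow> sg D S \<Longrightarrow> sg D (\<lambda>p x. P x \<longrightarrow> S p x)"
  using sg_disj[OF sg_dec[OF dec_not], of P D S] by (simp add: imp_conv_disj[symmetric])

text \<open>The witnesses for all i below the bound need not be listed. The joint code holds a
  strict upper bound W for them and one prefix of the oracle long enough for all that they read; the
  search below W for witnesses whose oracle part is an initial part of that prefix is
  decidable.\<close>

lemma sg_ball: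
  assumes b: "computable_seq b" and S: "sg D (\<lambda>p z. S p (pr1 z) (pr2 z))"
  shows "sg D (\<lambda>p x. \<forall>i<b x. S p i x)"
proof -
  obtain T where T: "dec T"
    and ST: "\<And>p x. D p \<Longrightarrow> S p (pr1 x) (pr2 x) \<longleftrightarrow> (\<exists>c. T (pair x c) \<and> pfx p (pr1 c))"
    using S by (rule sgE) blast
  define T' where "T' x c \<longleftrightarrow>
    (\<forall>i<b x. \<exists>e<pr2 c. T (pair (pair i x) e) \<and> ispre (pr1 e) (pr1 c))" for x c
  show ?thesis
  proof (rule sgI)
    show "dec (\<lambda>z. T' (pr1 z) (pr2 z))"
      unfolding T'_def
      by (intro dec_ball dec_bex dec_conj dec_ispre dec_comp[OF T] tc_intros tc_comp[OF b])
    fix p x assume p: "D p"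
    have ST': "S p i x \<longleftrightarrow> (\<exists>c. T (pair (pair i x) c) \<and> pfx p (pr1 c))" for i
      using ST[OF p, of "pair i x"] by simp
    have "(\<forall>i<b x. S p i x) \<longleftrightarrow> (\<exists>c. T' x c \<and> pfx p (pr1 c))"
    proof
      assume "\<forall>i<b x. S p i x"
      then have "\<forall>i<b x. \<exists>c. T (pair (pair i x) c) \<and> pfx p (pr1 c)"
        using ST' by blast
      then obtain C where C: "\<And>i. i < b x \<Longrightarrow> T (pair (pair i x) (C i)) \<and> pfx p (pr1 (C i))"
        by metis
      define W where "W = Suc (\<Sum>i<b x. C i)"
      define k where "k = (\<Sum>i<b x. lenc (pr1 (C i)))"
      have "C i < W" if "i < b x" for i
        using member_le_sum[of i "{..<b x}" C] that by (simp add: W_def less_Suc_eq_le)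
      moreover have "lenc (pr1 (C i)) \<le> k" if "i < b x" for i
        using member_le_sum[of i "{..<b x}" "\<lambda>i. lenc (pr1 (C i))"] that by (simp add: k_def)
      ultimately have "T' x (pair (pcode p k) W)"
        unfolding T'_def using C ispre_pcode by fastforce
      then show "\<exists>c. T' x c \<and> pfx p (pr1 c)"
        by (intro exI[of _ "pair (pcode p k) W"]) (simp add: pfx_pcode)
    next
      assume "\<exists>c. T' x c \<and> pfx p (pr1 c)"
      then show "\<forall>i<b x. S p i x"
        unfolding T'_def ST' using pfx_ispre by blast
    qed
    then show "(\<forall>i<b x. S p i x) \<longleftrightarrow>
        (\<exists>c. T' (pr1 (pair x c)) (pr2 (pair x c)) \<and> pfx p (pr1 c))"
      by simp
  qed
qed

text \<open>A conjunction is treated as a quantifier over two indices, so the merging of two finite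
  oracle parts is inherited from the bounded quantifier.\<close>

lemma sg_conj:
  assumes "sg D S" "sg D S'"
  shows "sg D (\<lambda>p x. S p x \<and> S' p x)"
proof -
  have "sg D (\<lambda>p z. (pr1 z = 0 \<and> S p (pr2 z)) \<or> (pr1 z \<noteq> 0 \<and> S' p (pr2 z)))"
  proof -
    obtain T where T: "dec T" "\<And>p x. D p \<Longrightarrow> S p x \<longleftrightarrow> (\<exists>c. T (pair x c) \<and> pfx p (pr1 c))"
      using assms(1) by (rule sgE) blast
    obtain T' where T': "dec T'" "\<And>p x. D p \<Longrightarrow> S' p x \<longleftrightarrow> (\<exists>c. T' (pair x c) \<and> pfx p (pr1 c))"
      using assms(2) by (rule sgE) blast
    show ?thesis
    proof (rule sgI)
      show "dec (\<lambda>y. (pr1 (pr1 y) = 0 \<and> T (pair (pr2 (pr1 y)) (pr2 y))) \<or>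
          (pr1 (pr1 y) \<noteq> 0 \<and> T' (pair (pr2 (pr1 y)) (pr2 y))))"
        by (intro dec_intros dec_comp[OF T(1)] dec_comp[OF T'(1)] tc_intros)
    qed (auto simp: T(2) T'(2))
  qed
  from sg_ball[OF tc_const[of 2] this] show ?thesis
    by (rule sg_cong) (auto simp: numeral_2_eq_2 less_Suc_eq)
qed

text \<open>The witness is moved into the second component of the code; the first must stay the part
  of the oracle that was read.\<close>

lemma sg_ex:
  assumes "sg D (\<lambda>p z. S p (pr1 z) (pr2 z))"
  shows "sg D (\<lambda>p x. \<exists>v. S p v x)"
proof -
  obtain T where T: "dec T"
    and ST: "\<And>p x. D p \<Longrightarrow> S p (pr1 x) (pr2 x) \<longleftrightarrow> (\<exists>c. T (pair x c) \<and> pfx p (pr1 c))"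
    using assms by (rule sgE) blast
  define T' where "T' x c \<longleftrightarrow> T (pair (pair (pr1 (pr2 c)) x) (pair (pr1 c) (pr2 (pr2 c))))" for x c
  show ?thesis
  proof (rule sgI)
    show "dec (\<lambda>z. T' (pr1 z) (pr2 z))"
      unfolding T'_def by (intro dec_comp[OF T] tc_intros)
    fix p x assume p: "D p"
    have ST': "S p v x \<longleftrightarrow> (\<exists>c. T (pair (pair v x) c) \<and> pfx p (pr1 c))" for v
      using ST[OF p, of "pair v x"] by simp
    have "T' x (pair (pr1 c) (pair v (pr2 c))) \<longleftrightarrow> T (pair (pair v x) c)" for v c
      by (simp add: T'_def)
    then have "(\<exists>v. S p v x) \<longleftrightarrow> (\<exists>c. T' x c \<and> pfx p (pr1 c))"
      unfolding ST' by (metis T'_def fst_conv prod_encode_inverse)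
    then show "(\<exists>v. S p v x) \<longleftrightarrow> (\<exists>c. T' (pr1 (pair x c)) (pr2 (pair x c)) \<and> pfx p (pr1 c))"
      by simp
  qed
qed

lemma sg_finite_ball:
  assumes "finite A" "\<And>i. i \<in> A \<Longrightarrow> sg D (S i)"
  shows "sg D (\<lambda>p x. \<forall>i\<in>A. S i p x)"
  using assms
proof (induction A)
  case empty
  show ?case using sg_dec[OF dec_const[of True]] by simp
next
  case (insert i A)
  then have "sg D (\<lambda>p x. S i p x \<and> (\<forall>i\<in>A. S i p x))"
    by (intro sg_conj) auto
  then show ?case by simp
qed

lemma sg_finite_all:
  fixes S :: "'i::finite \<Rightarrow> _"
  assumes "\<And>i. sg D (S i)"
  shows "sg D (\<lambda>p x. \<forall>i. S i p x)"
  using sg_finite_ball[of UNIV D S] assms by simp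



text \<open>A relational form of Kleene's normal form theorem. A composition is witnessed by the
  coded list of inner values, a primitive recursion by the coded sequence of its stages, and a
  minimization by the nonzero values below its result.\<close>

lemma sg_rf_eval_aux: "sg D (\<lambda>p x. rf_eval f (list_decode (pr1 x)) (pr2 x))"
proof (induction f)
  case Zr
  have "sg D (\<lambda>p x. pr2 x = 0)"
    by (intro sg_dec dec_intros tc_intros)
  then show ?case
    by (rule sg_cong) (auto intro: rf_eval.zero elim: Zr_elim)
next
  case Sc
  have "sg D (\<lambda>p x. 0 < lenc (pr1 x) \<and> pr2 x = Suc (nthc (pr1 x) 0))"
    by (intro sg_dec dec_intros tc_intros')
  moreover have "rf_eval Sc xs y \<longleftrightarrow> 0 < length xs \<and> y = Suc (xs ! 0)" for xs y
    by (cases xs) (auto intro: rf_eval.succ elim: Sc_elim)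
  ultimately show ?case
    by (elim sg_cong) (auto simp: lenc_eq nthc_eq)
next
  case (Idx i)
  have "sg D (\<lambda>p x. i < lenc (pr1 x) \<and> pr2 x = nthc (pr1 x) i)"
    by (intro sg_dec dec_intros tc_intros')
  moreover have "rf_eval (Idx i) xs y \<longleftrightarrow> i < length xs \<and> y = xs ! i" for xs y
    by (auto intro: rf_eval.proj elim: Idx_elim)
  ultimately show ?case
    by (elim sg_cong) (auto simp: lenc_eq nthc_eq)
next
  case (Cn f gs)
  have IH: "sg D (\<lambda>p x. rf_eval h (list_decode (a x)) (b x))"
    if "h = f \<or> h \<in> set gs" "computable_seq a" "computable_seq b" for h a b
    using sg_subst[OF _ tc_pair[OF that(2,3)]] Cn that(1) by fastforce
  have *: "sg D (\<lambda>p x. \<exists>c. lenc c = length gs \<and>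
      (\<forall>i\<in>{..<length gs}. rf_eval (gs ! i) (list_decode (pr1 x)) (nthc c i)) \<and>
      rf_eval f (list_decode c) (pr2 x))"
    by (intro sg_ex sg_conj sg_finite_ball finite_lessThan IH sg_dec[OF dec_eq] tc_intros') auto
  have "rf_eval (Cn f gs) xs y \<longleftrightarrow> (\<exists>c. lenc c = length gs \<and>
      (\<forall>i\<in>{..<length gs}. rf_eval (gs ! i) xs (nthc c i)) \<and> rf_eval f (list_decode c) y)"
    (is "?L \<longleftrightarrow> ?R") for xs y
  proof
    assume ?L
    then obtain ys where ys: "list_all2 (\<lambda>g. rf_eval g xs) gs ys" "rf_eval f ys y"
      by (rule Cn_elim)
    then show ?R
      by (intro exI[of _ "list_encode ys"])
        (simp add: lenc_list_encode nthc_list_encode list_all2_conv_all_nth)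
  next
    assume ?R
    then obtain c where "lenc c = length gs" "\<forall>i<length gs. rf_eval (gs ! i) xs (nthc c i)"
      "rf_eval f (list_decode c) y" by blast
    then show ?L
      by (intro rf_eval.comp[where ys = "list_decode c"])
        (simp_all add: lenc_eq nthc_eq list_all2_conv_all_nth)
  qed
  then show ?case
    by (intro sg_cong[OF *])
next
  case (Pr f g)
  have IHf: "sg D (\<lambda>p x. rf_eval f (list_decode (a x)) (b x))"
    if "computable_seq a" "computable_seq b" for a b
    using sg_subst[OF Pr(1) tc_pair[OF that]] by simp
  have IHg: "sg D (\<lambda>p x. rf_eval g (list_decode (a x)) (b x))"
    if "computable_seq a" "computable_seq b" for a b
    using sg_subst[OF Pr(2) tc_pair[OF that]] by simp
  have *: "sg D (\<lambda>p x. \<exists>s. 0 < lenc (pr1 x) \<and> nthc s (nthc (pr1 x) 0) = pr2 x \<and>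
      rf_eval f (list_decode (tlc (pr1 x))) (nthc s 0) \<and>
      (\<forall>i<nthc (pr1 x) 0.
         rf_eval g (list_decode (consc i (consc (nthc s i) (tlc (pr1 x))))) (nthc s (Suc i))))"
    by (intro sg_ex sg_conj IHf sg_ball IHg sg_dec[OF dec_eq] sg_dec[OF dec_less] tc_intros')
  have "rf_eval (Pr f g) (n # xs) y \<longleftrightarrow> (\<exists>s. nthc s n = y \<and> rf_eval f xs (nthc s 0) \<and>
      (\<forall>i<n. rf_eval g (i # nthc s i # xs) (nthc s (Suc i))))" (is "_ \<longleftrightarrow> ?R n y") for n xs y
  proof
    assume "rf_eval (Pr f g) (n # xs) y"
    then have "\<exists>s. s n = y \<and> rf_eval f xs (s 0) \<and> (\<forall>i<n. rf_eval g (i # s i # xs) (s (Suc i)))"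
    proof (induction n arbitrary: y)
      case 0
      then show ?case by (auto elim: Pr_0_elim)
    next
      case (Suc n)
      from Suc.prems obtain z where "rf_eval (Pr f g) (n # xs) z" "rf_eval g (n # z # xs) y"
        by (rule Pr_Suc_elim)
      with Suc.IH obtain s where "s n = z" "rf_eval f xs (s 0)"
        "\<forall>i<n. rf_eval g (i # s i # xs) (s (Suc i))" by blast
      with \<open>rf_eval g (n # z # xs) y\<close> show ?case
        by (intro exI[of _ "s(Suc n := y)"]) (auto simp: less_Suc_eq)
    qed
    then obtain s where s: "s n = y" "rf_eval f xs (s 0)"
      "\<forall>i<n. rf_eval g (i # s i # xs) (s (Suc i))" by blast
    obtain c where "lenc c = Suc n" "\<forall>i<Suc n. nthc c i = s i"
      using ex_code_of_fun[of "Suc n" s] by blast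
    with s show "?R n y"
      by (intro exI[of _ c]) auto
  next
    assume "?R n y"
    then obtain s where s: "nthc s n = y" "rf_eval f xs (nthc s 0)"
      "\<forall>i<n. rf_eval g (i # nthc s i # xs) (nthc s (Suc i))" by blast
    have "rf_eval (Pr f g) (i # xs) (nthc s i)" if "i \<le> n" for i
      using that
    proof (induction i)
      case 0
      then show ?case using s(2) by (intro rf_eval.pr0)
    next
      case (Suc i)
      then show ?case
        using s(3) by (intro rf_eval.prS[of f g i xs "nthc s i"]) auto
    qed
    with s(1) show "rf_eval (Pr f g) (n # xs) y" by blast
  qed
  \<comment> \<open>On the empty list \<open>nthc\<close> and \<open>tlc\<close> return their
    default 0, which would simulate a recursion with counter 0. The guard \<open>0 < lenc c\<close>
    excludes this.\<close>
  moreover have "\<not> rf_eval (Pr f g) [] y" for y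
    by (auto elim: Pr_elim)
  ultimately have "rf_eval (Pr f g) (list_decode c) y \<longleftrightarrow>
      (\<exists>s. 0 < lenc c \<and> nthc s (nthc c 0) = y \<and> rf_eval f (list_decode (tlc c)) (nthc s 0) \<and>
      (\<forall>i<nthc c 0. rf_eval g (list_decode (consc i (consc (nthc s i) (tlc c)))) (nthc s (Suc i))))"
    for c y
    unfolding list_decode_consc list_decode_tlc lenc_eq nthc_eq[of c]
    by (cases "list_decode c") simp_all
  then show ?case
    by (intro sg_cong[OF *])
next
  case (Mn f)
  have IH: "sg D (\<lambda>p x. rf_eval f (list_decode (a x)) (b x))"
    if "computable_seq a" "computable_seq b" for a b
    using sg_subst[OF Mn tc_pair[OF that]] by simp
  have "sg D (\<lambda>p x. rf_eval f (list_decode (consc (pr2 x) (pr1 x))) 0 \<and>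
     (\<forall>i<pr2 x. \<exists>v. rf_eval f (list_decode (consc i (pr1 x))) (Suc v)))"
    by (intro sg_conj IH sg_ball sg_ex tc_intros')
  then show ?case
    by (rule sg_cong) (auto intro: rf_eval.mn elim: Mn_elim)
qed

lemma sg_rf_eval:
  assumes "computable_seq a" "computable_seq b" "computable_seq c"
  shows "sg D (\<lambda>p x. rf_eval f [a x, b x] (c x))"
proof -
  have "computable_seq (\<lambda>x. pair (consc (a x) (consc (b x) 0)) (c x))"
    by (intro tc_intros assms)
  from sg_subst[OF sg_rf_eval_aux this] show ?thesis by simp
qed

text \<open>\<open>Mn\<close> stops at the value 0, so G has to compute the truth value of the
  negation of P.\<close>

lemma rf_eval_Mn_dec:
  assumes "\<And>v. rf_eval G (v # xs) (of_bool (\<not> P v))"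
  shows "rf_eval (Mn G) xs e \<longleftrightarrow> P e \<and> (\<forall>i<e. \<not> P i)"
proof
  assume "rf_eval (Mn G) xs e"
  then have 1: "rf_eval G (e # xs) 0" and 2: "\<forall>i<e. \<exists>y. rf_eval G (i # xs) (Suc y)"
    by (auto elim: Mn_elim)
  have "P e"
    using rf_eval_det[OF 1 assms] by (cases "P e") auto
  moreover have "\<not> P i" if i: "i < e" for i
  proof -
    obtain y where "rf_eval G (i # xs) (Suc y)" using 2 i by blast
    from rf_eval_det[OF this assms] show ?thesis by (cases "P i") auto
  qed
  ultimately show "P e \<and> (\<forall>i<e. \<not> P i)" by blast
next
  assume e: "P e \<and> (\<forall>i<e. \<not> P i)"
  show "rf_eval (Mn G) xs e"
  proof (rule rf_eval.mn)
    show "rf_eval G (e # xs) 0" using assms[of e] e by simp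
    have "rf_eval G (i # xs) (Suc 0)" if "i < e" for i
      using assms[of i] e that by simp
    then show "\<forall>i<e. \<exists>y. rf_eval G (i # xs) (Suc y)" by blast
  qed
qed

lemma dec_recf3:
  assumes "dec (\<lambda>z. P (pr1 z) (pr1 (pr2 z)) (pr2 (pr2 z)))"
  shows "\<exists>G. \<forall>a b c. rf_eval G [a, b, c] (of_bool (P a b c))"
proof -
  have "rcf 3 (\<lambda>xs. of_bool (P (xs ! 0) (xs ! 1) (xs ! 2)))"
    using rcf_compose[OF assms[unfolded dec_def], of 3 "\<lambda>xs. pair (xs ! 0) (pair (xs ! 1) (xs ! 2))"]
    by (simp add: rcf_pair rcf_nth)
  then obtain G where G: "\<And>xs. length xs = 3 \<Longrightarrow> rf_eval G xs (of_bool (P (xs ! 0) (xs ! 1) (xs ! 2)))"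
    unfolding rcf_def by blast
  show ?thesis
    by (intro exI[of _ G] allI) (use G[of "[_, _, _]"] in simp)
qed

text \<open>The machine searches for the least accepting computation code that is compatible with the
  given finite part of the oracle, and diverges if that code uses more of the oracle than is given.
  This makes the result independent of the length of the given part.\<close>

lemma sg_uniformize:
  assumes sg: "sg D (\<lambda>p z. S p (pr1 z) (pr2 z))" and total: "\<And>p n. D p \<Longrightarrow> \<exists>v. S p n v"
  shows "\<exists>phi. \<forall>p. D p \<longrightarrow> (\<exists>q. t2_out phi p q \<and> (\<forall>n. S p n (q n)))"
proof -
  obtain T where T: "dec T"
    and ST: "\<And>p x. D p \<Longrightarrow> S p (pr1 x) (pr2 x) \<longleftrightarrow> (\<exists>c. T (pair x c) \<and> pfx p (pr1 c))"
    using sg by (rule sgE) blast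
  define acc where "acc n e \<longleftrightarrow> T (pair (pair n (pr1 e)) (pr2 e))" for n e
  define u where "u e = pr1 (pr2 e)" for e
  \<comment> \<open>Agreement is asked only where both lists are defined. Hence a code that is
    correct for p fits every prefix of p, and an incorrect accepting code stops fitting once the
    prefix is long enough to show a disagreement.\<close>
  define fits where "fits e n s \<longleftrightarrow>
    acc n e \<and> (\<forall>j<lenc (u e). j < lenc s \<longrightarrow> nthc (u e) j = nthc s j)" for e n s
  \<comment> \<open>Minimization over r does two things: it outputs the first component of e, and it
    diverges when e refers to more of the oracle than s contains.\<close>
  define ready where "ready r e s \<longleftrightarrow> lenc (u e) \<le> lenc s \<and> r = pr1 e" for r e s
  have "dec (\<lambda>z. \<not> fits (pr1 z) (pr1 (pr2 z)) (pr2 (pr2 z)))"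
    unfolding fits_def acc_def u_def by (intro dec_intros dec_comp[OF T] tc_intros')
  from dec_recf3[OF this] obtain G where
    G: "\<And>e n s. rf_eval G [e, n, s] (of_bool (\<not> fits e n s))" by blast
  have "dec (\<lambda>z. \<not> ready (pr1 z) (pr1 (pr2 z)) (pr2 (pr2 z)))"
    unfolding ready_def u_def by (intro dec_intros tc_intros')
  from dec_recf3[OF this] obtain H where
    H: "\<And>r e s. rf_eval H [r, e, s] (of_bool (\<not> ready r e s))" by blast
  define phi where "phi = Cn (Mn H) [Mn G, Idx 1]"
  have MnG: "rf_eval (Mn G) [n, s] e \<longleftrightarrow> fits e n s \<and> (\<forall>i<e. \<not> fits i n s)" for n s e
    by (rule rf_eval_Mn_dec) (rule G)
  have MnH: "rf_eval (Mn H) [e, s] r \<longleftrightarrow> ready r e s" for e s r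
  proof -
    have "rf_eval (Mn H) [e, s] r \<longleftrightarrow> ready r e s \<and> (\<forall>i<r. \<not> ready i e s)"
      by (rule rf_eval_Mn_dec) (rule H)
    then show ?thesis by (auto simp: ready_def)
  qed
  have phi: "rf_eval phi [n, s] v \<longleftrightarrow>
      (\<exists>e. fits e n s \<and> (\<forall>i<e. \<not> fits i n s) \<and> lenc (u e) \<le> lenc s \<and> v = pr1 e)" for n s v
  proof
    assume "rf_eval phi [n, s] v"
    then obtain ys where "list_all2 (\<lambda>g. rf_eval g [n, s]) [Mn G, Idx 1] ys" "rf_eval (Mn H) ys v"
      unfolding phi_def by (rule Cn_elim)
    then obtain e s' where ys: "ys = [e, s']" "rf_eval (Mn G) [n, s] e" "rf_eval (Idx 1) [n, s] s'"
      by (auto simp: list_all2_Cons1)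
    from ys(3) have "s' = s" by (auto elim: Idx_elim)
    with ys \<open>rf_eval (Mn H) ys v\<close> show "\<exists>e. fits e n s \<and> (\<forall>i<e. \<not> fits i n s) \<and>
        lenc (u e) \<le> lenc s \<and> v = pr1 e"
      by (auto simp: MnG MnH ready_def)
  next
    assume "\<exists>e. fits e n s \<and> (\<forall>i<e. \<not> fits i n s) \<and> lenc (u e) \<le> lenc s \<and> v = pr1 e"
    then obtain e where e: "rf_eval (Mn G) [n, s] e" "rf_eval (Mn H) [e, s] v"
      by (auto simp: MnG MnH ready_def)
    moreover have "rf_eval (Idx 1) [n, s] s"
      using rf_eval.proj[of 1 "[n, s]"] by simp
    ultimately show "rf_eval phi [n, s] v"
      unfolding phi_def by (intro rf_eval.comp[where ys = "[e, s]"]) auto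
  qed
  show ?thesis
  proof (intro exI[of _ phi] allI impI)
    fix p assume p: "D p"
    define good where "good n e \<longleftrightarrow> acc n e \<and> pfx p (u e)" for n e
    define E where "E n = (LEAST e. good n e)" for n
    have ST': "S p n v \<longleftrightarrow> (\<exists>c. T (pair (pair n v) c) \<and> pfx p (pr1 c))" for n v
      using ST[OF p, of "pair n v"] by simp
    have "\<exists>e. good n e" for n
    proof -
      obtain v c where "T (pair (pair n v) c)" "pfx p (pr1 c)"
        using total[OF p, of n] ST' by blast
      then show ?thesis
        by (intro exI[of _ "pair v c"]) (simp add: good_def acc_def u_def)
    qed
    then have E: "good n (E n)" for n
      unfolding E_def by (rule LeastI_ex)
    have fits_good: "fits e n (pcode p k)" if "good n e" for e n k
      using that by (auto simp: fits_def good_def pfx_def lenc_pcode nthc_pcode)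
    have good_fits: "good n e" if "fits e n (pcode p k)" "lenc (u e) \<le> k" for e n k
      using that by (auto simp: fits_def good_def pfx_def lenc_pcode nthc_pcode)
    have "t2_out phi p (\<lambda>n. pr1 (E n))"
      unfolding t2_out_def
    proof (intro allI conjI impI)
      fix n
      \<comment> \<open>A prefix of this length covers whatever the codes up to \<open>E n\<close>
        refer to, so every smaller code that is wrong for p has been ruled out.\<close>
      define k where "k = (\<Sum>e\<le>E n. lenc (u e))"
      have k: "lenc (u e) \<le> k" if "e \<le> E n" for e
        unfolding k_def using member_le_sum[of e "{..E n}" "\<lambda>e. lenc (u e)"] that by simp
      have "\<not> fits i n (pcode p k)" if "i < E n" for i
        using good_fits[of i n k] k[of i] not_less_Least[of i "good n"] that unfolding E_def by auto
      then have "rf_eval phi [n, pcode p k] (pr1 (E n))"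
        unfolding phi using fits_good[OF E] k[of "E n"]
        by (intro exI[of _ "E n"]) (simp add: lenc_pcode)
      then show "\<exists>k v. rf_eval phi [n, pcode p k] v" by blast
    next
      fix n k v assume "rf_eval phi [n, pcode p k] v"
      then obtain e where e: "fits e n (pcode p k)" "\<forall>i<e. \<not> fits i n (pcode p k)"
        "lenc (u e) \<le> k" "v = pr1 e"
        by (auto simp: phi lenc_pcode)
      \<comment> \<open>The code e refers only to the given prefix, so fitting it means being
        correct for p. A smaller correct code would also fit, contradicting minimality; thus all
        prefixes on which the machine halts give the same output.\<close>
      have "e = E n"
        unfolding E_def
        by (rule sym, rule Least_equality) (use e good_fits fits_good not_less in blast)+
      with e(4) show "v = pr1 (E n)" by simp
    qed
    moreover have "S p n (pr1 (E n))" for n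
      using E[of n] ST'[of n "pr1 (E n)"] by (auto simp: good_def acc_def u_def)
    ultimately show "\<exists>q. t2_out phi p q \<and> (\<forall>n. S p n (q n))"
      by blast
  qed
qed

section \<open>Computable rationals and reals\<close>

abbreviation nuR :: "nat \<Rightarrow> real" where
  "nuR c \<equiv> real_of_rat (nu_Q c)"

lemma ex_nu_Q: "\<exists>c. nu_Q c = r"
proof -
  obtain a b where ab: "r = of_int a / of_int b" "b > 0"
    by (metis quotient_of_denom_pos quotient_of_div surj_pair)
  have "nu_Q (pair (int_encode a) (nat b - 1)) = r"
    using ab by (simp add: nu_Q_def of_nat_diff)
  then show ?thesis by blast
qed

lemma nuR_dense: "x < y \<Longrightarrow> \<exists>c. x < nuR c \<and> nuR c < y"
  by (metis ex_nu_Q of_rat_dense)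

lemma nuR_approx: "e > 0 \<Longrightarrow> \<exists>c. \<bar>nuR c - x\<bar> < e"
  using nuR_dense[of "x - e" "x + e"] by (auto simp: abs_less_iff algebra_simps)

lemma nuR_0: "nuR 0 = 0"
  by (simp add: nu_Q_def prod_decode_0 int_decode_def sum_decode_def)

text \<open>Computable sequences of rationals, viewed in the reals. Writing the numerator as a
  difference of naturals reduces arithmetic and order to natural numbers, after
  cross-multiplication.\<close>

definition cq :: "(nat \<Rightarrow> real) \<Rightarrow> bool" where
  "cq r \<longleftrightarrow> (\<exists>a b c. computable_seq a \<and> computable_seq b \<and> computable_seq c \<and>
     (\<forall>x. 0 < c x \<and> r x = (real (a x) - real (b x)) / real (c x)))"

lemma cqI:
  assumes "computable_seq a" "computable_seq b" "computable_seq c"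
    "\<And>x. 0 < c x" "\<And>x. r x = (real (a x) - real (b x)) / real (c x)"
  shows "cq r"
  using assms unfolding cq_def by blast

lemma cqE:
  assumes "cq r"
  obtains a b c where "computable_seq a" "computable_seq b" "computable_seq c"
    "\<And>x. 0 < c x" "\<And>x. r x = (real (a x) - real (b x)) / real (c x)"
  using assms unfolding cq_def by blast

lemma cq_subst:
  assumes "cq r" "computable_seq f"
  shows "cq (\<lambda>x. r (f x))"
  using assms(1)
proof (rule cqE)
  fix a b c
  assume *: "computable_seq a" "computable_seq b" "computable_seq c"
    "\<And>x. 0 < c x" "\<And>x. r x = (real (a x) - real (b x)) / real (c x)"
  show ?thesis
    by (rule cqI[of "\<lambda>x. a (f x)" "\<lambda>x. b (f x)" "\<lambda>x. c (f x)"])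
      (use * assms(2) in \<open>auto intro: tc_comp\<close>)
qed

lemma cq_add:
  assumes "cq r" "cq s"
  shows "cq (\<lambda>x. r x + s x)"
proof -
  obtain a b c where r: "computable_seq a" "computable_seq b" "computable_seq c"
    "\<And>x. 0 < c x" "\<And>x. r x = (real (a x) - real (b x)) / real (c x)"
    using assms(1) by (rule cqE) blast
  obtain a' b' c' where s: "computable_seq a'" "computable_seq b'" "computable_seq c'"
    "\<And>x. 0 < c' x" "\<And>x. s x = (real (a' x) - real (b' x)) / real (c' x)"
    using assms(2) by (rule cqE) blast
  show ?thesis
  proof (rule cqI)
    show "computable_seq (\<lambda>x. a x * c' x + a' x * c x)" "computable_seq (\<lambda>x. b x * c' x + b' x * c x)"
      "computable_seq (\<lambda>x. c x * c' x)"
      by (intro tc_add tc_mult r s)+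
    fix x
    show "0 < c x * c' x" using r(4) s(4) by simp
    have "real (c x) \<noteq> 0" "real (c' x) \<noteq> 0" using r(4)[of x] s(4)[of x] by auto
    then show "r x + s x = (real (a x * c' x + a' x * c x) - real (b x * c' x + b' x * c x)) / real (c x * c' x)"
      by (simp add: r(5) s(5) field_simps)
  qed
qed

lemma cq_mult:
  assumes "cq r" "cq s"
  shows "cq (\<lambda>x. r x * s x)"
proof -
  obtain a b c where r: "computable_seq a" "computable_seq b" "computable_seq c"
    "\<And>x. 0 < c x" "\<And>x. r x = (real (a x) - real (b x)) / real (c x)"
    using assms(1) by (rule cqE) blast
  obtain a' b' c' where s: "computable_seq a'" "computable_seq b'" "computable_seq c'"
    "\<And>x. 0 < c' x" "\<And>x. s x = (real (a' x) - real (b' x)) / real (c' x)"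
    using assms(2) by (rule cqE) blast
  show ?thesis
  proof (rule cqI)
    show "computable_seq (\<lambda>x. a x * a' x + b x * b' x)" "computable_seq (\<lambda>x. a x * b' x + b x * a' x)"
      "computable_seq (\<lambda>x. c x * c' x)"
      by (intro tc_add tc_mult r s)+
    fix x
    show "0 < c x * c' x" using r(4) s(4) by simp
    have "real (c x) \<noteq> 0" "real (c' x) \<noteq> 0" using r(4)[of x] s(4)[of x] by auto
    then show "r x * s x = (real (a x * a' x + b x * b' x) - real (a x * b' x + b x * a' x)) / real (c x * c' x)"
      by (simp add: r(5) s(5) field_simps)
  qed
qed

lemma cq_uminus:
  assumes "cq r"
  shows "cq (\<lambda>x. - r x)"
  using assms
proof (rule cqE)
  fix a b c
  assume *: "computable_seq a" "computable_seq b" "computable_seq c"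
    "\<And>x. 0 < c x" "\<And>x. r x = (real (a x) - real (b x)) / real (c x)"
  show ?thesis
    by (rule cqI[of b a c]) (simp_all add: * minus_divide_left)
qed

lemma cq_diff: "cq r \<Longrightarrow> cq s \<Longrightarrow> cq (\<lambda>x. r x - s x)"
  using cq_add[OF _ cq_uminus, of r s] by simp

lemma cq_real: "computable_seq f \<Longrightarrow> cq (\<lambda>x. real (f x))"
  by (rule cqI[of f "\<lambda>x. 0" "\<lambda>x. 1"]) (auto intro: tc_const)

lemma cq_nuR:
  assumes "computable_seq f"
  shows "cq (\<lambda>x. nuR (f x))"
proof -
  \<comment> \<open>\<open>int_decode\<close> maps an even n to \<open>n div 2\<close> and an odd n
    to \<open>- (n div 2) - 1\<close>; a and b are the positive and the negative part of this
    integer.\<close>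
  define a where "a n = (if n = 2 * (n div 2) then n div 2 else 0)" for n :: nat
  define b where "b n = (if n = 2 * (n div 2) then 0 else Suc (n div 2))" for n :: nat
  have "n = 2 * (n div 2) \<longleftrightarrow> even n" for n :: nat
    by presburger
  then have "real_of_int (int_decode n) = real (a n) - real (b n)" for n
    by (simp add: int_decode_def sum_decode_def a_def b_def)
  then have "nuR c = (real (a (pr1 c)) - real (b (pr1 c))) / real (Suc (pr2 c))" for c
    by (simp add: nu_Q_def of_rat_divide case_prod_beta del: of_nat_Suc)
  moreover have "computable_seq (\<lambda>x. a (pr1 x))" "computable_seq (\<lambda>x. b (pr1 x))"
    unfolding a_def b_def by (intro tc_intros dec_intros)+
  moreover have "computable_seq (\<lambda>x. Suc (pr2 x))"
    by (intro tc_intros)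
  ultimately have "cq nuR"
    by (intro cqI[of "\<lambda>x. a (pr1 x)" "\<lambda>x. b (pr1 x)" "\<lambda>x. Suc (pr2 x)"]) auto
  from cq_subst[OF this assms] show ?thesis by simp
qed

lemma cq_half_power: 
  assumes "computable_seq f"
  shows "cq (\<lambda>x. (1/2) ^ f x)"
  by (rule cqI[of "\<lambda>x. 1" "\<lambda>x. 0" "\<lambda>x. 2 ^ f x"])
    (use assms in \<open>auto intro: tc_const tc_power simp: power_one_over\<close>)

lemma cq_const_nat: "cq (\<lambda>x. real n)"
  by (intro cq_real tc_const)

lemma cq_0: "cq (\<lambda>x. 0)" and cq_1: "cq (\<lambda>x. 1)" and cq_numeral: "cq (\<lambda>x. numeral k)"
  using cq_const_nat[of 0] cq_const_nat[of 1] cq_const_nat[of "numeral k"] by simp_all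

lemma cq_sum:
  assumes "finite A" "\<And>i. i \<in> A \<Longrightarrow> cq (r i)"
  shows "cq (\<lambda>x. \<Sum>i\<in>A. r i x)"
  using assms by (induction A) (auto intro: cq_0 cq_add)

lemma dec_less_cq:
  assumes "cq r" "cq s"
  shows "dec (\<lambda>x. r x < s x)"
proof -
  obtain a b c where r: "computable_seq a" "computable_seq b" "computable_seq c"
    "\<And>x. 0 < c x" "\<And>x. r x = (real (a x) - real (b x)) / real (c x)"
    using assms(1) by (rule cqE) blast
  obtain a' b' c' where s: "computable_seq a'" "computable_seq b'" "computable_seq c'"
    "\<And>x. 0 < c' x" "\<And>x. s x = (real (a' x) - real (b' x)) / real (c' x)"
    using assms(2) by (rule cqE) blast
  have "r x < s x \<longleftrightarrow> a x * c' x + b' x * c x < a' x * c x + b x * c' x" for x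
  proof -
    have "real (c x) > 0" "real (c' x) > 0" using r(4)[of x] s(4)[of x] by auto
    then have "r x < s x \<longleftrightarrow> real (a x * c' x + b' x * c x) < real (a' x * c x + b x * c' x)"
      by (simp add: r(5) s(5) field_simps)
    then show ?thesis by (simp only: of_nat_less_iff)
  qed
  moreover have "dec (\<lambda>x. a x * c' x + b' x * c x < a' x * c x + b x * c' x)"
    by (intro dec_less tc_add tc_mult r s)
  ultimately show ?thesis by simp
qed

lemma dec_le_cq: "cq r \<Longrightarrow> cq s \<Longrightarrow> dec (\<lambda>x. r x \<le> s x)"
  using dec_not[OF dec_less_cq, of s r] by (simp add: not_less)

lemma cq_if:
  assumes "dec P" "cq r" "cq s"
  shows "cq (\<lambda>x. if P x then r x else s x)"
proof -
  have "cq (\<lambda>x. real (of_bool (P x)) * r x + real (of_bool (\<not> P x)) * s x)"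
    by (intro cq_add cq_mult cq_real assms assms(1)[unfolded dec_def]
        dec_not[OF assms(1), unfolded dec_def])
  moreover have "real (of_bool (P x)) * r x + real (of_bool (\<not> P x)) * s x = (if P x then r x else s x)" for x
    by simp
  ultimately show ?thesis by simp
qed

lemma cq_abs: "cq r \<Longrightarrow> cq (\<lambda>x. \<bar>r x\<bar>)"
  unfolding abs_if by (intro cq_if dec_less_cq cq_0 cq_uminus)

lemmas cq_intros = cq_0 cq_1 cq_numeral cq_add cq_diff cq_mult cq_uminus cq_real cq_nuR
  cq_half_power cq_abs cq_sum

section \<open>Reals with semidecidable cuts\<close>

text \<open>Both cuts of the real \<open>u p x\<close> are semidecidable, uniformly in \<open>x\<close> and in the oracles
  \<open>p\<close> in \<open>D\<close>.\<close>

definition cr :: "((nat \<Rightarrow> nat) \<Rightarrow> bool) \<Rightarrow> ((nat \<Rightarrow> nat) \<Rightarrow> nat \<Rightarrow> real) \<Rightarrow> bool" where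
  "cr D u \<longleftrightarrow> sg D (\<lambda>p z. nuR (pr1 z) < u p (pr2 z)) \<and> sg D (\<lambda>p z. u p (pr2 z) < nuR (pr1 z))"

lemma cr_subst:
  assumes "cr D u" "computable_seq f"
  shows "cr D (\<lambda>p x. u p (f x))"
proof -
  have f: "computable_seq (\<lambda>z. pair (pr1 z) (f (pr2 z)))"
    by (intro tc_intros tc_comp[OF assms(2)])
  show ?thesis
    using assms(1) sg_subst[OF _ f, of D "\<lambda>p z. nuR (pr1 z) < u p (pr2 z)"]
      sg_subst[OF _ f, of D "\<lambda>p z. u p (pr2 z) < nuR (pr1 z)"]
    by (simp add: cr_def)
qed

lemma cr_cong:
  assumes "cr D u" "\<And>p x. D p \<Longrightarrow> v p x = u p x"
  shows "cr D v"
  using assms(1) unfolding cr_def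
  by (elim conjE, intro conjI) (erule sg_cong, simp add: assms(2))+

lemma sg_cr_lower:
  assumes "cr D u" "computable_seq f" "computable_seq g"
  shows "sg D (\<lambda>p x. nuR (g x) < u p (f x))"
  using sg_subst[OF _ tc_pair[OF assms(3,2)], of D "\<lambda>p z. nuR (pr1 z) < u p (pr2 z)"] assms(1)
  by (simp add: cr_def)

lemma sg_cr_upper:
  assumes "cr D u" "computable_seq f" "computable_seq g"
  shows "sg D (\<lambda>p x. u p (f x) < nuR (g x))"
  using sg_subst[OF _ tc_pair[OF assms(3,2)], of D "\<lambda>p z. u p (pr2 z) < nuR (pr1 z)"] assms(1)
  by (simp add: cr_def)

lemma cr_cq: "cq r \<Longrightarrow> cr D (\<lambda>p. r)"
  unfolding cr_def
proof
  assume r: "cq r"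
  show "sg D (\<lambda>p z. nuR (pr1 z) < r (pr2 z))" "sg D (\<lambda>p z. r (pr2 z) < nuR (pr1 z))"
    by (intro sg_dec dec_less_cq cq_intros cq_subst[OF r] tc_intros)+
qed

text \<open>A rational strictly between the two reals is a finite witness of the inequality.\<close>

lemma sg_less:
  assumes "cr D u" "cr D v"
  shows "sg D (\<lambda>p x. u p x < v p x)"
proof -
  have "sg D (\<lambda>p x. \<exists>c. u p x < nuR c \<and> nuR c < v p x)"
    by (intro sg_ex sg_conj sg_cr_upper[OF assms(1)] sg_cr_lower[OF assms(2)] tc_intros)
  then show ?thesis
    by (rule sg_cong) (metis nuR_dense less_trans)
qed

lemma crI:
  assumes "sg D (\<lambda>p z. nuR (pr1 z) < u p (pr2 z))" "sg D (\<lambda>p z. u p (pr2 z) < nuR (pr1 z))"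
  shows "cr D u"
  using assms by (simp add: cr_def)

lemma cr_uminus:
  assumes "cr D u"
  shows "cr D (\<lambda>p x. - u p x)"
proof (rule crI)
  have u: "cr D (\<lambda>p z. u p (pr2 z))" and n: "cr D (\<lambda>p z. - nuR (pr1 z))"
    by (intro cr_subst[OF assms] tc_intros cr_cq cq_intros)+
  show "sg D (\<lambda>p z. nuR (pr1 z) < - u p (pr2 z))"
    by (rule sg_cong[OF sg_less[OF u n]]) linarith
  show "sg D (\<lambda>p z. - u p (pr2 z) < nuR (pr1 z))"
    by (rule sg_cong[OF sg_less[OF n u]]) linarith
qed

lemma cr_add:
  assumes "cr D u" "cr D v"
  shows "cr D (\<lambda>p x. u p x + v p x)"
proof (rule crI)
  have u: "cr D (\<lambda>p z. u p (f z))" and v: "cr D (\<lambda>p z. v p (f z))"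
    if "computable_seq f" for f
    by (intro cr_subst[OF assms(1)] cr_subst[OF assms(2)] that)+
  have "sg D (\<lambda>p z. \<exists>c. nuR c < u p (pr2 z) \<and> nuR (pr1 z) - nuR c < v p (pr2 z))"
    by (intro sg_ex sg_conj sg_less u v cr_cq cq_intros tc_intros)
  then show "sg D (\<lambda>p z. nuR (pr1 z) < u p (pr2 z) + v p (pr2 z))"
  proof (rule sg_cong)
    show "a < x + y \<longleftrightarrow> (\<exists>c. nuR c < x \<and> a - nuR c < y)" for a x y
      using nuR_dense[of "a - y" x] by (auto simp: algebra_simps)
  qed
  have "sg D (\<lambda>p z. \<exists>c. u p (pr2 z) < nuR c \<and> v p (pr2 z) < nuR (pr1 z) - nuR c)"
    by (intro sg_ex sg_conj sg_less u v cr_cq cq_intros tc_intros)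
  then show "sg D (\<lambda>p z. u p (pr2 z) + v p (pr2 z) < nuR (pr1 z))"
  proof (rule sg_cong)
    show "x + y < a \<longleftrightarrow> (\<exists>c. x < nuR c \<and> y < a - nuR c)" for a x y
      using nuR_dense[of x "a - y"] by (auto simp: algebra_simps)
  qed
qed

lemma cr_diff: "cr D u \<Longrightarrow> cr D v \<Longrightarrow> cr D (\<lambda>p x. u p x - v p x)"
  using cr_add[OF _ cr_uminus, of D u v] by simp

text \<open>In its application c is rational, so its sign can be decided; the sign determines
  whether a lower or an upper bound of x is called for. Products with one rational factor suffice
  later, because the matrices multiplied with real ones are rational.\<close>

lemma less_mult_iff_approx:
  "a < c * x \<longleftrightarrow> (0 < c \<and> (\<exists>b. nuR b < x \<and> a < c * nuR b)) \<or>
     (c < 0 \<and> (\<exists>b. x < nuR b \<and> a < c * nuR b)) \<or> (\<not> 0 < c \<and> \<not> c < 0 \<and> a < 0)" (is "_ \<longleftrightarrow> ?R")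
proof (cases c "0::real" rule: linorder_cases)
  case less
  have "\<exists>b. x < nuR b \<and> a < c * nuR b" if "a < c * x"
    using nuR_dense[of x "a / c"] that less by (auto simp: field_simps)
  moreover have "a < c * x" if "x < nuR b" "a < c * nuR b" for b
    using mult_strict_left_mono_neg[OF that(1) less] that(2) by linarith
  ultimately show ?thesis using less by auto
next
  case greater
  have "\<exists>b. nuR b < x \<and> a < c * nuR b" if "a < c * x"
    using nuR_dense[of "a / c" x] that greater by (auto simp: field_simps)
  moreover have "a < c * x" if "nuR b < x" "a < c * nuR b" for b
    using mult_strict_left_mono[OF that(1) greater] that(2) by linarith
  ultimately show ?thesis using greater by auto
qed auto

lemma sg_less_scale:
  assumes "cq a" "cq c" "cr D u"
  shows "sg D (\<lambda>p x. a x < c x * u p x)"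
proof -
  have "sg D (\<lambda>p x. (0 < c x \<and> (\<exists>b. nuR b < u p x \<and> a x < c x * nuR b)) \<or>
     (c x < 0 \<and> (\<exists>b. u p x < nuR b \<and> a x < c x * nuR b)) \<or> (\<not> 0 < c x \<and> \<not> c x < 0 \<and> a x < 0))"
    by (intro sg_disj sg_conj sg_ex sg_dec[OF dec_less_cq] sg_dec[OF dec_not[OF dec_less_cq]]
        sg_cr_upper[OF assms(3)] sg_cr_lower[OF assms(3)] cq_mult cq_nuR cq_0 assms(1,2)
        cq_subst[OF assms(1)] cq_subst[OF assms(2)] tc_intros)
  then show ?thesis
    by (rule sg_cong) (rule less_mult_iff_approx)
qed

lemma cr_scale:
  assumes "cq c" "cr D u"
  shows "cr D (\<lambda>p x. c x * u p x)"
proof (rule crI)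
  have c: "cq (\<lambda>z. c (pr2 z))" and u: "cr D (\<lambda>p z. u p (pr2 z))"
    by (intro cq_subst[OF assms(1)] cr_subst[OF assms(2)] tc_intros)+
  have n: "cq (\<lambda>z. nuR (pr1 z))" by (intro cq_intros tc_intros)
  show "sg D (\<lambda>p z. nuR (pr1 z) < c (pr2 z) * u p (pr2 z))"
    by (rule sg_less_scale[OF n c u])
  show "sg D (\<lambda>p z. c (pr2 z) * u p (pr2 z) < nuR (pr1 z))"
    using sg_less_scale[OF cq_uminus[OF n] cq_uminus[OF c] u] by simp
qed

lemma cr_sum:
  assumes "finite A" "\<And>i. i \<in> A \<Longrightarrow> cr D (u i)"
  shows "cr D (\<lambda>p x. \<Sum>i\<in>A. u i p x)"
  using assms by (induction A) (auto intro: cr_cq cq_0 cr_add)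

lemma cr_abs:
  assumes "cr D u"
  shows "cr D (\<lambda>p x. \<bar>u p x\<bar>)"
proof (rule crI)
  have u: "cr D (\<lambda>p z. u p (pr2 z))" and n: "cr D (\<lambda>p z. nuR (pr1 z))"
    by (intro cr_subst[OF assms] cr_cq cq_intros tc_intros)+
  have "sg D (\<lambda>p z. nuR (pr1 z) < u p (pr2 z) \<or> nuR (pr1 z) < - u p (pr2 z))"
    by (intro sg_disj sg_less u n cr_uminus)
  then show "sg D (\<lambda>p z. nuR (pr1 z) < \<bar>u p (pr2 z)\<bar>)"
    by (rule sg_cong) linarith
  have "sg D (\<lambda>p z. u p (pr2 z) < nuR (pr1 z) \<and> - u p (pr2 z) < nuR (pr1 z))"
    by (intro sg_conj sg_less u n cr_uminus)
  then show "sg D (\<lambda>p z. \<bar>u p (pr2 z)\<bar> < nuR (pr1 z))"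
    by (rule sg_cong) linarith
qed

lemma cr_if:
  assumes P: "dec P" and "cr D u" "cr D v"
  shows "cr D (\<lambda>p x. if P x then u p x else v p x)"
proof (rule crI)
  have u: "cr D (\<lambda>p z. u p (pr2 z))" and v: "cr D (\<lambda>p z. v p (pr2 z))"
    and n: "cr D (\<lambda>p z. nuR (pr1 z))"
    by (intro cr_subst[OF assms(2)] cr_subst[OF assms(3)] cr_cq cq_intros tc_intros)+
  have "sg D (\<lambda>p z. (P (pr2 z) \<and> nuR (pr1 z) < u p (pr2 z)) \<or> (\<not> P (pr2 z) \<and> nuR (pr1 z) < v p (pr2 z)))"
    by (intro sg_disj sg_conj sg_less u v n sg_dec dec_not dec_comp[OF P] tc_intros)
  then show "sg D (\<lambda>p z. nuR (pr1 z) < (if P (pr2 z) then u p (pr2 z) else v p (pr2 z)))"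
    by (rule sg_cong) simp
  have "sg D (\<lambda>p z. (P (pr2 z) \<and> u p (pr2 z) < nuR (pr1 z)) \<or> (\<not> P (pr2 z) \<and> v p (pr2 z) < nuR (pr1 z)))"
    by (intro sg_disj sg_conj sg_less u v n sg_dec dec_not dec_comp[OF P] tc_intros)
  then show "sg D (\<lambda>p z. (if P (pr2 z) then u p (pr2 z) else v p (pr2 z)) < nuR (pr1 z))"
    by (rule sg_cong) simp
qed

lemma half_power_arbitrarily_small: "(e::real) > 0 \<Longrightarrow> \<exists>i. (1/2) ^ i < e"
  by (rule real_arch_pow_inv) auto

text \<open>S may relate several approximations to the same precision. Each of them encloses the
  real in an interval, and a rational lies strictly below or above the real exactly when some
  enclosure shows it, so no choice of approximation is required.\<close>

lemma cr_of_approx: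
  assumes S: "sg D (\<lambda>p z. S p (pr1 z) (pr1 (pr2 z)) (pr2 (pr2 z)))"
    and sound: "\<And>p v i x. D p \<Longrightarrow> S p v i x \<Longrightarrow> \<bar>nuR v - u p x\<bar> \<le> (1/2) ^ i"
    and complete: "\<And>p i x. D p \<Longrightarrow> \<exists>v. S p v i x"
  shows "cr D u"
proof (rule crI)
  have S': "sg D (\<lambda>p z. S p (a z) (b z) (c z))"
    if "computable_seq a" "computable_seq b" "computable_seq c" for a b c
    using sg_subst[OF S tc_pair[OF that(1) tc_pair[OF that(2,3)]]] by simp
  have "sg D (\<lambda>p z. \<exists>i v. S p v i (pr2 z) \<and> nuR (pr1 z) + (1/2) ^ i < nuR v)"
    by (intro sg_ex sg_conj S' sg_dec dec_less_cq cq_intros tc_intros)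
  then show "sg D (\<lambda>p z. nuR (pr1 z) < u p (pr2 z))"
  proof (rule sg_cong)
    fix p z assume p: "D p"
    show "nuR (pr1 z) < u p (pr2 z) \<longleftrightarrow> (\<exists>i v. S p v i (pr2 z) \<and> nuR (pr1 z) + (1/2) ^ i < nuR v)"
    proof
      assume "nuR (pr1 z) < u p (pr2 z)"
      \<comment> \<open>Half of the gap: the error of v uses \<open>(1/2) ^ i\<close> once, and the
        margin demanded of v uses it a second time.\<close>
      then obtain i where i: "(1/2) ^ i < (u p (pr2 z) - nuR (pr1 z)) / 2"
        using half_power_arbitrarily_small[of "(u p (pr2 z) - nuR (pr1 z)) / 2"] by auto
      obtain v where v: "S p v i (pr2 z)" using complete[OF p] by blast
      from sound[OF p v] i have "nuR (pr1 z) + (1/2) ^ i < nuR v" by (simp add: field_simps abs_le_iff)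
      with v show "\<exists>i v. S p v i (pr2 z) \<and> nuR (pr1 z) + (1/2) ^ i < nuR v" by blast
    next
      assume "\<exists>i v. S p v i (pr2 z) \<and> nuR (pr1 z) + (1/2) ^ i < nuR v"
      then obtain i v where "S p v i (pr2 z)" "nuR (pr1 z) + (1/2) ^ i < nuR v" by blast
      with sound[OF p this(1)] show "nuR (pr1 z) < u p (pr2 z)" by linarith
    qed
  qed
  have "sg D (\<lambda>p z. \<exists>i v. S p v i (pr2 z) \<and> nuR v < nuR (pr1 z) - (1/2) ^ i)"
    by (intro sg_ex sg_conj S' sg_dec dec_less_cq cq_intros tc_intros)
  then show "sg D (\<lambda>p z. u p (pr2 z) < nuR (pr1 z))"
  proof (rule sg_cong)
    fix p z assume p: "D p"
    show "u p (pr2 z) < nuR (pr1 z) \<longleftrightarrow> (\<exists>i v. S p v i (pr2 z) \<and> nuR v < nuR (pr1 z) - (1/2) ^ i)"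
    proof
      assume "u p (pr2 z) < nuR (pr1 z)"
      then obtain i where i: "(1/2) ^ i < (nuR (pr1 z) - u p (pr2 z)) / 2"
        using half_power_arbitrarily_small[of "(nuR (pr1 z) - u p (pr2 z)) / 2"] by auto
      obtain v where v: "S p v i (pr2 z)" using complete[OF p] by blast
      from sound[OF p v] i have "nuR v < nuR (pr1 z) - (1/2) ^ i" by (simp add: field_simps abs_le_iff)
      with v show "\<exists>i v. S p v i (pr2 z) \<and> nuR v < nuR (pr1 z) - (1/2) ^ i" by blast
    next
      assume "\<exists>i v. S p v i (pr2 z) \<and> nuR v < nuR (pr1 z) - (1/2) ^ i"
      then obtain i v where "S p v i (pr2 z)" "nuR v < nuR (pr1 z) - (1/2) ^ i" by blast
      with sound[OF p this(1)] show "u p (pr2 z) < nuR (pr1 z)" by linarith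
    qed
  qed
qed



section \<open>Names of vectors and machines\<close>

lemma inj_cidx: "inj (cidx :: 'n::finite \<Rightarrow> nat)"
proof -
  have "\<exists>h. bij_betw h (UNIV :: 'n set) {..<CARD('n)}"
    using ex_bij_betw_finite_nat[of "UNIV :: 'n set"] by (simp add: atLeast0LessThan)
  then have "bij_betw (cidx :: 'n \<Rightarrow> nat) UNIV {..<CARD('n)}"
    unfolding cidx_def by (rule someI_ex)
  then show ?thesis by (rule bij_betw_imp_inj_on)
qed

lemma cidx_eq_iff [simp]: "cidx i = cidx j \<longleftrightarrow> i = j"
  using inj_cidx by (auto dest: injD)

lemma rho_n_iff: "rho_n p x \<longleftrightarrow> (\<forall>j k. \<bar>nuR (p (pair (cidx j) k)) - x $ j\<bar> \<le> (1/2) ^ k)"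
  by (simp add: rho_n_def rep_vec_def rho_def)

lemma rho_mat_iff: "rho_mat p A \<longleftrightarrow>
    (\<forall>a b k. \<bar>nuR (p (pair (cidx a) (pair (cidx b) k))) - A $ a $ b\<bar> \<le> (1/2) ^ k)"
  by (simp add: rho_mat_def rep_vec_def rho_def)

text \<open>This makes the point a well-defined function of the oracle, so that it can be written as
  a definite description in the computability arguments.\<close>

lemma rho_n_unique:
  assumes "rho_n p x" "rho_n p y"
  shows "x = y"
proof (rule vec_eq_iff[THEN iffD2], rule allI, rule ccontr)
  fix j assume "x $ j \<noteq> y $ j"
  then obtain k where k: "2 * (1/2) ^ k < \<bar>x $ j - y $ j\<bar>"
    using half_power_arbitrarily_small[of "\<bar>x $ j - y $ j\<bar> / 2"] by (auto simp: field_simps)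
  have "\<bar>nuR (p (pair (cidx j) k)) - x $ j\<bar> \<le> (1/2) ^ k" "\<bar>nuR (p (pair (cidx j) k)) - y $ j\<bar> \<le> (1/2) ^ k"
    using assms by (simp_all add: rho_n_iff)
  moreover have "False" if "2 * h < \<bar>a - b\<bar>" "\<bar>c - a\<bar> \<le> h" "\<bar>c - b\<bar> \<le> h" for a b c h :: real
    using that by linarith
  ultimately show False using k by blast
qed

text \<open>Names are total sequences: a position whose index m numbers no coordinate must be filled
  as well, and any value will do there.\<close>

lemma ex_approx_indexed:
  fixes x :: "real ^ 'n::finite"
  assumes "e > 0"
  shows "\<exists>c. \<forall>j. cidx j = m \<longrightarrow> \<bar>nuR c - x $ j\<bar> < e"
proof (cases "\<exists>j::'n. cidx j = m")
  case True
  then obtain j :: 'n where j: "cidx j = m" by blast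
  obtain c where "\<bar>nuR c - x $ j\<bar> < e" using nuR_approx[OF assms] by blast
  with j show ?thesis by (intro exI[of _ c]) auto
qed auto

text \<open>The accuracy is one binary digit better than a name requires. This slack lets a finite
  part of the sequence begin a name of every nearby point too.\<close>

lemma ex_strict_name:
  fixes x :: "real ^ 'n::finite"
  shows "\<exists>p. \<forall>n j. cidx j = pr1 n \<longrightarrow> \<bar>nuR (p n) - x $ j\<bar> < (1/2) ^ Suc (pr2 n)"
  by (rule choice) (intro allI ex_approx_indexed, simp)

section \<open>Machines for a single real component of a function\<close>

definition realizes :: "recf \<Rightarrow> (real ^ 'n::finite) set \<Rightarrow> (real ^ 'n \<Rightarrow> real) \<Rightarrow> bool" where
  "realizes phi X h \<longleftrightarrow> (\<forall>x\<in>X. \<forall>p. rho_n p x \<longrightarrow> (\<exists>q. t2_out phi p q \<and> rho q (h x)))"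

lemma t2_out_reindex:
  assumes "computable_seq g"
  shows "\<exists>phi'. \<forall>p q. t2_out phi p q \<longrightarrow> t2_out phi' p (\<lambda>n. q (g n))"
proof -
  obtain K where K: "\<And>xs. length xs = 2 \<Longrightarrow> rf_eval K xs (g (xs ! 0))"
    using rcf_compose[OF assms rcf_nth[of 0 2]] unfolding rcf_def by auto
  have K': "rf_eval K [n, s] (g n)" for n s
    using K[of "[n, s]"] by simp
  have I: "rf_eval (Idx 1) [n, s] s" for n s
    using rf_eval.proj[of 1 "[n, s]"] by simp
  define phi' where "phi' = Cn phi [K, Idx 1]"
  have *: "rf_eval phi' [n, s] v \<longleftrightarrow> rf_eval phi [g n, s] v" for n s v
  proof
    assume "rf_eval phi' [n, s] v"
    then obtain ys where ys: "list_all2 (\<lambda>g. rf_eval g [n, s]) [K, Idx 1] ys" "rf_eval phi ys v"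
      unfolding phi'_def by (rule Cn_elim)
    then obtain a b where ab: "ys = [a, b]" "rf_eval K [n, s] a" "rf_eval (Idx 1) [n, s] b"
      by (auto simp: list_all2_Cons1)
    with ys(2) show "rf_eval phi [g n, s] v"
      using rf_eval_det[OF ab(2) K'] rf_eval_det[OF ab(3) I] by simp
  next
    assume "rf_eval phi [g n, s] v"
    then show "rf_eval phi' [n, s] v"
      unfolding phi'_def using K' I by (intro rf_eval.comp[where ys = "[g n, s]"]) auto
  qed
  show ?thesis
    by (rule exI[of _ phi']) (simp add: t2_out_def *)
qed

lemma realizes_comp_fun_vec:
  fixes f :: "real ^ 'n::finite \<Rightarrow> real ^ 'm::finite"
  assumes "comp_fun rho_n rho_n X f"
  shows "\<exists>phi. realizes phi X (\<lambda>x. f x $ j)"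
proof -
  obtain phi where phi: "\<And>p x. x \<in> X \<Longrightarrow> rho_n p x \<Longrightarrow> \<exists>q. rho_n q (f x) \<and> t2_out phi p q"
    using assms unfolding comp_fun_def comp_mv_def by blast
  have "computable_seq (\<lambda>k. pair (cidx j) k)"
    by (intro tc_intros)
  from t2_out_reindex[OF this, of phi] obtain phi' where
    phi': "\<And>p q. t2_out phi p q \<Longrightarrow> t2_out phi' p (\<lambda>k. q (pair (cidx j) k))" by blast
  have "realizes phi' X (\<lambda>x. f x $ j)"
    unfolding realizes_def
  proof (intro ballI allI impI)
    fix x p assume "x \<in> X" "rho_n p x"
    with phi obtain q where "rho_n q (f x)" "t2_out phi p q" by blast
    then show "\<exists>q. t2_out phi' p q \<and> rho q (f x $ j)"
      by (intro exI[of _ "\<lambda>k. q (pair (cidx j) k)"]) (auto intro: phi' simp: rho_def rho_n_iff)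
  qed
  then show ?thesis by blast
qed

lemma realizes_comp_fun_mat:
  fixes f :: "real ^ 'n::finite \<Rightarrow> real ^ 'b::finite ^ 'a::finite"
  assumes "comp_fun rho_n rho_mat X f"
  shows "\<exists>phi. realizes phi X (\<lambda>x. f x $ a $ b)"
proof -
  obtain phi where phi: "\<And>p x. x \<in> X \<Longrightarrow> rho_n p x \<Longrightarrow> \<exists>q. rho_mat q (f x) \<and> t2_out phi p q"
    using assms unfolding comp_fun_def comp_mv_def by blast
  have "computable_seq (\<lambda>k. pair (cidx a) (pair (cidx b) k))"
    by (intro tc_intros)
  from t2_out_reindex[OF this, of phi] obtain phi' where
    phi': "\<And>p q. t2_out phi p q \<Longrightarrow> t2_out phi' p (\<lambda>k. q (pair (cidx a) (pair (cidx b) k)))" by blast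
  have "realizes phi' X (\<lambda>x. f x $ a $ b)"
    unfolding realizes_def
  proof (intro ballI allI impI)
    fix x p assume "x \<in> X" "rho_n p x"
    with phi obtain q where "rho_mat q (f x)" "t2_out phi p q" by blast
    then show "\<exists>q. t2_out phi' p q \<and> rho q (f x $ a $ b)"
      by (intro exI[of _ "\<lambda>k. q (pair (cidx a) (pair (cidx b) k))"])
        (auto intro: phi' simp: rho_def rho_mat_iff)
  qed
  then show ?thesis by blast
qed

text \<open>The word \<open>w\<close> is a prefix of a name of every point whose coordinates are within
  \<open>(1/2) ^ N\<close> of those of \<open>y\<close>. Hence a single halting computation on \<open>w\<close> controls the realized
  function on a whole neighbourhood of \<open>y\<close>.\<close>

definition loc :: "recf \<Rightarrow> real ^ 'n::finite \<Rightarrow> nat \<Rightarrow> nat \<Rightarrow> nat \<Rightarrow> bool" where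
  "loc phi y i N v \<longleftrightarrow> (\<exists>w. (\<forall>n<lenc w. \<forall>j. cidx j = pr1 n \<longrightarrow>
     \<bar>nuR (nthc w n) - y $ j\<bar> + (1/2) ^ N < (1/2) ^ pr2 n) \<and> rf_eval phi [i, w] v)"

text \<open>The inequality in \<open>loc\<close> is strict, so it can be confirmed from the cuts of
  the coordinates; halting on w is semidecidable, and only finitely many positions and coordinates
  are involved.\<close>

lemma sg_loc:
  fixes u :: "(nat \<Rightarrow> nat) \<Rightarrow> nat \<Rightarrow> real ^ 'n::finite"
  assumes u: "\<And>j. cr D (\<lambda>p x. u p x $ j)"
    and abc: "computable_seq a" "computable_seq b" "computable_seq c"
  shows "sg D (\<lambda>p x. loc phi (u p x) (a x) (b x) (c x))"
  unfolding loc_def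
  by (intro sg_ex sg_conj sg_ball sg_finite_all sg_imp sg_rf_eval dec_eq
      sg_less cr_add cr_abs cr_diff cr_cq cq_nuR cq_half_power cr_subst[OF u] tc_intros'
      tc_comp[OF abc(1)] tc_comp[OF abc(2)] tc_comp[OF abc(3)])

lemma loc_mono:
  assumes "loc phi y i N v" "N \<le> N'"
  shows "loc phi y i N' v"
proof -
  have "(1/2) ^ N' \<le> (1/2 :: real) ^ N"
    using assms(2) by (intro power_decreasing) auto
  with assms(1) show ?thesis
    unfolding loc_def by (meson add_left_mono le_less_trans)
qed

text \<open>The word w, continued by an accurate name of x, is a name of x. \<open>t2_out\<close>
  requires every value produced on a prefix of a name to be the correct output, so v must
  approximate \<open>h x\<close>.\<close>

lemma loc_sound:
  fixes x y :: "real ^ 'n::finite"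
  assumes phi: "realizes phi X h" and loc: "loc phi y i N v"
    and x: "x \<in> X" "\<And>j. \<bar>x $ j - y $ j\<bar> \<le> (1/2) ^ N"
  shows "\<bar>nuR v - h x\<bar> \<le> (1/2) ^ i"
proof -
  obtain w where w: "\<And>n j. n < lenc w \<Longrightarrow> cidx j = pr1 n \<Longrightarrow>
     \<bar>nuR (nthc w n) - y $ j\<bar> + (1/2) ^ N < (1/2) ^ pr2 n" "rf_eval phi [i, w] v"
    using loc unfolding loc_def by blast
  obtain p0 where p0: "\<And>n j. cidx j = pr1 n \<Longrightarrow> \<bar>nuR (p0 n) - x $ j\<bar> < (1/2) ^ Suc (pr2 n)"
    using ex_strict_name[of x] by blast
  define p where "p n = (if n < lenc w then nthc w n else p0 n)" for n
  have "rho_n p x"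
    unfolding rho_n_iff
  proof (intro allI)
    fix j :: 'n and k
    let ?n = "pair (cidx j) k"
    have "\<bar>nuR (p0 ?n) - x $ j\<bar> \<le> (1/2) ^ k"
      by (rule order_trans[OF less_imp_le[OF p0] power_decreasing]) auto
    moreover have "\<bar>nuR (nthc w ?n) - x $ j\<bar> \<le> (1/2) ^ k" if "?n < lenc w"
      using w(1)[OF that, of j] x(2)[of j] by simp
    ultimately show "\<bar>nuR (p ?n) - x $ j\<bar> \<le> (1/2) ^ k"
      by (simp add: p_def)
  qed
  then obtain q where q: "t2_out phi p q" "rho q (h x)"
    using phi x(1) unfolding realizes_def by blast
  have "prefix p (lenc w) = list_decode w"
    by (rule nth_equalityI) (simp_all add: prefix_def lenc_eq p_def nthc_eq)
  then have "pcode p (lenc w) = w" by simp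
  then have "v = q i"
    using q(1) w(2) unfolding t2_out_def by metis
  with q(2) show ?thesis by (simp add: rho_def)
qed

lemma loc_complete:
  fixes y :: "real ^ 'n::finite"
  assumes phi: "realizes phi X h" and y: "y \<in> X"
  shows "\<exists>N v. loc phi y i N v"
proof -
  obtain p where p: "\<And>n j. cidx j = pr1 n \<Longrightarrow> \<bar>nuR (p n) - y $ j\<bar> < (1/2) ^ Suc (pr2 n)"
    using ex_strict_name[of y] by blast
  have "rho_n p y"
    unfolding rho_n_iff
  proof (intro allI)
    fix j k show "\<bar>nuR (p (pair (cidx j) k)) - y $ j\<bar> \<le> (1/2) ^ k"
      by (rule order_trans[OF less_imp_le[OF p] power_decreasing]) auto
  qed
  then obtain q where "t2_out phi p q"
    using phi y unfolding realizes_def by blast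
  then obtain k v where v: "rf_eval phi [i, pcode p k] v"
    unfolding t2_out_def by blast
  \<comment> \<open>One exponent serves all positions: for n < k we have
    \<open>pr2 n \<le> n\<close>, so \<open>(1/2) ^ Suc k\<close> is at most the slack
    \<open>(1/2) ^ Suc (pr2 n)\<close> of the strict name.\<close>
  have "\<bar>nuR (nthc (pcode p k) n) - y $ j\<bar> + (1/2) ^ Suc k < (1/2) ^ pr2 n"
    if n: "n < lenc (pcode p k)" "cidx j = pr1 n" for n j
  proof -
    have "pr2 n \<le> n"
      using le_prod_encode_2[of "pr2 n" "pr1 n"] by simp
    then have "(1/2 :: real) ^ Suc k \<le> (1/2) ^ Suc (pr2 n)"
      using n(1) by (intro power_decreasing) (auto simp: lenc_pcode)
    moreover have "\<bar>nuR (nthc (pcode p k) n) - y $ j\<bar> < (1/2) ^ Suc (pr2 n)"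
      using p[OF n(2)] n(1) by (simp add: nthc_pcode lenc_pcode)
    ultimately have "\<bar>nuR (nthc (pcode p k) n) - y $ j\<bar> + (1/2) ^ Suc k <
        (1/2) ^ Suc (pr2 n) + (1/2) ^ Suc (pr2 n)"
      by (intro add_less_le_mono)
    then show ?thesis by simp
  qed
  with v show ?thesis unfolding loc_def by blast
qed

text \<open>No name of the argument is constructed. The word on which the machine halts is searched
  for, with the cuts of the coordinates certifying that it begins such a name.\<close>

lemma cr_apply:
  fixes u :: "(nat \<Rightarrow> nat) \<Rightarrow> nat \<Rightarrow> real ^ 'n::finite"
  assumes phi: "realizes phi X h" and u: "\<And>j. cr D (\<lambda>p x. u p x $ j)"
    and X: "\<And>p x. D p \<Longrightarrow> u p x \<in> X"
  shows "cr D (\<lambda>p x. h (u p x))"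
proof (rule cr_of_approx)
  show "sg D (\<lambda>p z. \<exists>N. loc phi (u p (pr2 (pr2 z))) (pr1 (pr2 z)) N (pr1 z))"
    by (intro sg_ex sg_loc cr_subst[OF u] tc_intros)
  show "\<bar>nuR v - h (u p x)\<bar> \<le> (1/2) ^ i" if "D p" "\<exists>N. loc phi (u p x) i N v" for p v i x
    using that loc_sound[OF phi _ X] by fastforce
  show "\<exists>v N. loc phi (u p x) i N v" if "D p" for p i x
    using loc_complete[OF phi X[OF that]] by blast
qed

lemma cr_name:
  assumes "computable_seq g" "\<And>p. D p \<Longrightarrow> rho_n (\<lambda>i. p (g i)) (Y p)"
  shows "cr D (\<lambda>p x. Y p $ j)"
proof (rule cr_of_approx)
  show "sg D (\<lambda>p z. p (g (pair (cidx j) (pr1 (pr2 z)))) = pr1 z)"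
    by (intro sg_oracle tc_comp[OF assms(1)] tc_intros)
  show "\<bar>nuR v - Y p $ j\<bar> \<le> (1/2) ^ i" if "D p" "p (g (pair (cidx j) i)) = v" for p v i and x :: nat
    using assms(2)[OF that(1)] that(2) by (auto simp: rho_n_iff)
qed auto

lemma cr_computable_elem:
  assumes "computable_elem rho_n x0"
  shows "cr D (\<lambda>p x. x0 $ j)"
proof -
  obtain p0 where p0: "computable_seq p0" "rho_n p0 x0"
    using assms unfolding computable_elem_def by blast
  show ?thesis
  proof (rule cr_of_approx)
    show "sg D (\<lambda>p z. p0 (pair (cidx j) (pr1 (pr2 z))) = pr1 z)"
      by (intro sg_dec dec_eq tc_comp[OF p0(1)] tc_intros)
    show "\<bar>nuR v - x0 $ j\<bar> \<le> (1/2) ^ i" if "p0 (pair (cidx j) i) = v" for v i and x :: nat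
      using p0(2) that by (auto simp: rho_n_iff)
  qed auto
qed

text \<open>The way back from cuts to names: for each position, uniformization selects some rational
  within the prescribed error. The error is tested strictly, because only this is semidecidable, and
  strictness implies what \<open>rho_n\<close> asks for.\<close>

lemma comp_fun_vec_of_cr:
  fixes g :: "real ^ 'm::finite \<Rightarrow> real ^ 'n::finite"
  assumes D: "\<And>p y. y \<in> B \<Longrightarrow> rho_n p y \<Longrightarrow> D p \<and> Y p = y"
    and cr: "\<And>j. cr D (\<lambda>p x. g (Y p) $ j)"
  shows "comp_fun rho_n rho_n B g"
proof -
  have "\<exists>phi. \<forall>p. D p \<longrightarrow> (\<exists>q. t2_out phi p q \<and>
      (\<forall>n j. cidx j = pr1 n \<longrightarrow> \<bar>nuR (q n) - g (Y p) $ j\<bar> < (1/2) ^ pr2 n))"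
  proof (rule sg_uniformize)
    show "sg D (\<lambda>p z. \<forall>j. cidx j = pr1 (pr1 z) \<longrightarrow>
        \<bar>nuR (pr2 z) - g (Y p) $ j\<bar> < (1/2) ^ pr2 (pr1 z))"
      by (intro sg_finite_all sg_imp dec_eq sg_less cr_abs cr_diff
          cr_cq cq_nuR cq_half_power cr tc_intros)
    show "\<exists>v. \<forall>j. cidx j = pr1 n \<longrightarrow> \<bar>nuR v - g (Y p) $ j\<bar> < (1/2) ^ pr2 n" for p n
      using ex_approx_indexed[of "(1/2) ^ pr2 n" "pr1 n" "g (Y p)"] by auto
  qed
  then obtain phi where phi: "\<And>p. D p \<Longrightarrow> \<exists>q. t2_out phi p q \<and>
      (\<forall>n j. cidx j = pr1 n \<longrightarrow> \<bar>nuR (q n) - g (Y p) $ j\<bar> < (1/2) ^ pr2 n)" by blast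
  show ?thesis
    unfolding comp_fun_def comp_mv_def
  proof (intro exI[of _ phi] allI impI)
    fix p y assume "y \<in> B" "rho_n p y"
    with D have Dp: "D p" "Y p = y" by auto
    obtain q where q: "t2_out phi p q"
      "\<And>n j. cidx j = pr1 n \<longrightarrow> \<bar>nuR (q n) - g y $ j\<bar> < (1/2) ^ pr2 n"
      using phi[OF Dp(1)] Dp(2) by auto
    have "rho_n q (g y)"
      unfolding rho_n_iff
    proof (intro allI)
      fix j k show "\<bar>nuR (q (pair (cidx j) k)) - g y $ j\<bar> \<le> (1/2) ^ k"
        using q(2)[of j "pair (cidx j) k"] by simp
    qed
    with q(1) show "\<exists>q z. z = g y \<and> rho_n q z \<and> t2_out phi p q" by blast
  qed
qed

lemma comp_fun_mat_of_cr:
  fixes g :: "real ^ 'm::finite \<Rightarrow> real ^ 'b::finite ^ 'a::finite"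
  assumes D: "\<And>p y. y \<in> B \<Longrightarrow> rho_n p y \<Longrightarrow> D p \<and> Y p = y"
    and cr: "\<And>a b. cr D (\<lambda>p x. g (Y p) $ a $ b)"
  shows "comp_fun rho_n rho_mat B g"
proof -
  have "\<exists>phi. \<forall>p. D p \<longrightarrow> (\<exists>q. t2_out phi p q \<and>
      (\<forall>n a b. cidx a = pr1 n \<longrightarrow> cidx b = pr1 (pr2 n) \<longrightarrow>
        \<bar>nuR (q n) - g (Y p) $ a $ b\<bar> < (1/2) ^ pr2 (pr2 n)))"
  proof (rule sg_uniformize)
    show "sg D (\<lambda>p z. \<forall>a b. cidx a = pr1 (pr1 z) \<longrightarrow> cidx b = pr1 (pr2 (pr1 z)) \<longrightarrow>
        \<bar>nuR (pr2 z) - g (Y p) $ a $ b\<bar> < (1/2) ^ pr2 (pr2 (pr1 z)))"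
      by (intro sg_finite_all sg_imp dec_eq sg_less cr_abs cr_diff
          cr_cq cq_nuR cq_half_power cr tc_intros)
    show "\<exists>v. \<forall>a b. cidx a = pr1 n \<longrightarrow> cidx b = pr1 (pr2 n) \<longrightarrow>
        \<bar>nuR v - g (Y p) $ a $ b\<bar> < (1/2) ^ pr2 (pr2 n)" for p n
    \<comment> \<open>If the position encodes no row, every value is admissible; otherwise
      injectivity of \<open>cidx\<close> leaves one row, and a single rational has to be
      found.\<close>
    proof (cases "\<exists>a::'a. cidx a = pr1 n")
      case True
      then obtain a :: 'a where a: "cidx a = pr1 n" by blast
      obtain v where "\<forall>b. cidx b = pr1 (pr2 n) \<longrightarrow> \<bar>nuR v - g (Y p) $ a $ b\<bar> < (1/2) ^ pr2 (pr2 n)"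
        using ex_approx_indexed[of "(1/2) ^ pr2 (pr2 n)" "pr1 (pr2 n)" "g (Y p) $ a"] by auto
      with a show ?thesis
        by (intro exI[of _ v]) (metis cidx_eq_iff)
    qed auto
  qed
  then obtain phi where phi: "\<And>p. D p \<Longrightarrow> \<exists>q. t2_out phi p q \<and>
      (\<forall>n a b. cidx a = pr1 n \<longrightarrow> cidx b = pr1 (pr2 n) \<longrightarrow>
        \<bar>nuR (q n) - g (Y p) $ a $ b\<bar> < (1/2) ^ pr2 (pr2 n))" by blast
  show ?thesis
    unfolding comp_fun_def comp_mv_def
  proof (intro exI[of _ phi] allI impI)
    fix p y assume "y \<in> B" "rho_n p y"
    with D have Dp: "D p" "Y p = y" by auto
    obtain q where q: "t2_out phi p q"
      "\<And>n a b. cidx a = pr1 n \<longrightarrow> cidx b = pr1 (pr2 n) \<longrightarrow>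
        \<bar>nuR (q n) - g y $ a $ b\<bar> < (1/2) ^ pr2 (pr2 n)"
      using phi[OF Dp(1)] Dp(2) by auto
    have "rho_mat q (g y)"
      unfolding rho_mat_iff
    proof (intro allI)
      fix a b k show "\<bar>nuR (q (pair (cidx a) (pair (cidx b) k))) - g y $ a $ b\<bar> \<le> (1/2) ^ k"
        using q(2)[of a "pair (cidx a) (pair (cidx b) k)" b] by simp
    qed
    with q(1) show "\<exists>q z. z = g y \<and> rho_mat q z \<and> t2_out phi p q" by blast
  qed
qed

section \<open>The entrywise matrix norm\<close>

text \<open>The entrywise l1 norm: a finite sum of absolute values, so its cuts come directly from
  those of the entries. It is submultiplicative and dominates both the Euclidean and the operator
  norm.\<close>

definition msum :: "real ^ 'b::finite ^ 'a::finite \<Rightarrow> real" where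
  "msum A = (\<Sum>a\<in>UNIV. \<Sum>b\<in>UNIV. \<bar>A $ a $ b\<bar>)"

lemma msum_nonneg: "0 \<le> msum A"
  unfolding msum_def by (intro sum_nonneg) simp

lemma abs_entry_le_msum: "\<bar>A $ a $ b\<bar> \<le> msum A"
proof -
  have "\<bar>A $ a $ b\<bar> \<le> (\<Sum>b\<in>UNIV. \<bar>A $ a $ b\<bar>)"
    by (intro member_le_sum) auto
  also have "\<dots> \<le> msum A"
    unfolding msum_def
    by (rule member_le_sum[where f = "\<lambda>a. \<Sum>b\<in>UNIV. \<bar>A $ a $ b\<bar>"]) (auto intro: sum_nonneg)
  finally show ?thesis .
qed

lemma msum_add: "msum (A + B) \<le> msum A + msum B"
  unfolding msum_def sum.distrib[symmetric] by (intro sum_mono) simp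

lemma msum_minus: "msum (- A) = msum A"
  by (simp add: msum_def)

lemma msum_diff: "msum (A - B) \<le> msum A + msum B"
  using msum_add[of A "- B"] by (simp add: msum_minus)

lemma norm_le_msum: "norm A \<le> msum A"
proof -
  have "norm A \<le> (\<Sum>a\<in>UNIV. norm (A $ a))"
    by (simp add: norm_vec_def L2_set_le_sum)
  also have "\<dots> \<le> msum A"
    unfolding msum_def by (intro sum_mono norm_le_l1_cart)
  finally show ?thesis .
qed

lemma norm_matrix_vector_le_msum:
  fixes A :: "real ^ 'b::finite ^ 'a::finite"
  shows "norm (A *v x) \<le> msum A * norm x"
proof -
  have "norm (A *v x) \<le> (\<Sum>a\<in>UNIV. \<bar>(A *v x) $ a\<bar>)"
    by (rule norm_le_l1_cart)
  also have "\<dots> \<le> (\<Sum>a\<in>UNIV. \<Sum>b\<in>UNIV. \<bar>A $ a $ b\<bar> * norm x)"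
  proof (intro sum_mono)
    fix a
    have "\<bar>(A *v x) $ a\<bar> \<le> (\<Sum>b\<in>UNIV. \<bar>A $ a $ b * x $ b\<bar>)"
      by (simp add: matrix_vector_mult_def sum_abs)
    also have "\<dots> \<le> (\<Sum>b\<in>UNIV. \<bar>A $ a $ b\<bar> * norm x)"
      unfolding abs_mult by (intro sum_mono mult_left_mono component_le_norm_cart) auto
    finally show "\<bar>(A *v x) $ a\<bar> \<le> (\<Sum>b\<in>UNIV. \<bar>A $ a $ b\<bar> * norm x)" .
  qed
  also have "\<dots> = msum A * norm x"
    by (simp add: msum_def sum_distrib_right)
  finally show ?thesis .
qed

lemma msum_mult:
  fixes A :: "real ^ 'b::finite ^ 'a::finite" and B :: "real ^ 'c::finite ^ 'b"
  shows "msum (A ** B) \<le> msum A * msum B"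
proof -
  have "msum (A ** B) \<le> (\<Sum>a\<in>UNIV. \<Sum>c\<in>UNIV. \<Sum>b\<in>UNIV. \<bar>A $ a $ b\<bar> * \<bar>B $ b $ c\<bar>)"
    unfolding msum_def matrix_matrix_mult_def
    by (intro sum_mono) (simp add: abs_mult[symmetric] sum_abs)
  also have "\<dots> = (\<Sum>a\<in>UNIV. \<Sum>b\<in>UNIV. \<bar>A $ a $ b\<bar> * (\<Sum>c\<in>UNIV. \<bar>B $ b $ c\<bar>))"
    unfolding sum_distrib_left by (intro sum.cong refl sum.swap)
  also have "\<dots> \<le> (\<Sum>a\<in>UNIV. \<Sum>b\<in>UNIV. \<bar>A $ a $ b\<bar> * msum B)"
  proof (intro sum_mono mult_left_mono)
    fix b
    show "(\<Sum>c\<in>UNIV. \<bar>B $ b $ c\<bar>) \<le> msum B"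
      unfolding msum_def
      by (rule member_le_sum[where f = "\<lambda>b. \<Sum>c\<in>UNIV. \<bar>B $ b $ c\<bar>"]) (auto intro: sum_nonneg)
  qed auto
  also have "\<dots> = msum A * msum B"
    by (simp add: msum_def sum_distrib_right)
  finally show ?thesis .
qed

lemma msum_le_const:
  fixes A :: "real ^ 'b::finite ^ 'a::finite"
  assumes "\<And>a b. \<bar>A $ a $ b\<bar> \<le> e"
  shows "msum A \<le> real (CARD('a) * CARD('b)) * e"
proof -
  have "msum A \<le> (\<Sum>a\<in>(UNIV::'a set). \<Sum>b\<in>(UNIV::'b set). e)"
    unfolding msum_def by (intro sum_mono assms)
  then show ?thesis by simp
qed

lemma matrix_diff_ldistrib: "A ** (B - C) = A ** B - A ** (C :: real ^ 'c ^ 'b::finite)"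
  by (simp add: vec_eq_iff matrix_matrix_mult_def right_diff_distrib sum_subtractf)

lemma matrix_diff_rdistrib: "(A - B) ** C = A ** C - B ** (C :: real ^ 'c ^ 'b::finite)"
  by (simp add: vec_eq_iff matrix_matrix_mult_def left_diff_distrib sum_subtractf)

text \<open>A kernel vector x satisfies \<open>(A - mat 1) *v x = - x\<close>, which forces its norm
  to be at most half of itself.\<close>

lemma near_identity_inverse:
  fixes A :: "real ^ 'm::finite ^ 'm"
  assumes A: "msum (A - mat 1) \<le> 1/2"
  shows "\<exists>W. A ** W = mat 1 \<and> W ** A = mat 1"
proof -
  have "x = 0" if "A *v x = 0" for x
  proof -
    have "(A - mat 1) *v x = - x"
      using that by (simp add: matrix_vector_mult_diff_rdistrib)
    then have "norm x \<le> msum (A - mat 1) * norm x"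
      using norm_matrix_vector_le_msum[of "A - mat 1" x] by simp
    also have "\<dots> \<le> 1/2 * norm x"
      using A by (intro mult_right_mono) auto
    finally show ?thesis by simp
  qed
  then have "\<exists>B. B ** A = mat 1"
    unfolding matrix_left_invertible_ker by blast
  then show ?thesis
    using matrix_left_right_inverse by blast
qed

text \<open>From \<open>W = mat 1 - (A - mat 1) ** W\<close> the norm of W is at most that of the
  identity plus half of its own. The norm of the identity remains in the bound because
  \<open>msum\<close> is not normalized to 1 there.\<close>

lemma near_identity_inverse_bound:
  fixes A W :: "real ^ 'm::finite ^ 'm"
  assumes A: "msum (A - mat 1) \<le> 1/2" and W: "A ** W = mat 1"
  shows "msum W \<le> 2 * msum (mat 1 :: real ^ 'm ^ 'm)"
proof -
  have "W = mat 1 - (A - mat 1) ** W"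
    by (simp add: matrix_diff_rdistrib W)
  from arg_cong[OF this, of msum]
  have "msum W \<le> msum (mat 1 :: real ^ 'm ^ 'm) + msum ((A - mat 1) ** W)"
    using msum_diff[of "mat 1" "(A - mat 1) ** W"] by (rule ord_eq_le_trans)
  also have "msum ((A - mat 1) ** W) \<le> 1/2 * msum W"
    using mult_right_mono[OF A msum_nonneg[of W]] msum_mult[of "A - mat 1" W] by linarith
  finally show ?thesis by linarith
qed

text \<open>As \<open>V - W = W ** (A ** V - mat 1)\<close>, the residual of a candidate V bounds
  its distance to the inverse, and the residual can be evaluated without knowing W.\<close>

lemma near_identity_inverse_approx:
  fixes A W V :: "real ^ 'm::finite ^ 'm"
  assumes A: "msum (A - mat 1) \<le> 1/2" and W: "A ** W = mat 1" "W ** A = mat 1"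
  shows "msum (V - W) \<le> 2 * msum (mat 1 :: real ^ 'm ^ 'm) * msum (A ** V - mat 1)"
proof -
  have "V - W = W ** (A ** V - mat 1)"
    by (simp add: matrix_diff_ldistrib matrix_mul_assoc W)
  from arg_cong[OF this, of msum]
  have "msum (V - W) \<le> msum W * msum (A ** V - mat 1)"
    using msum_mult[of W "A ** V - mat 1"] by (rule ord_eq_le_trans)
  also have "\<dots> \<le> 2 * msum (mat 1 :: real ^ 'm ^ 'm) * msum (A ** V - mat 1)"
    by (intro mult_right_mono near_identity_inverse_bound[OF A W(1)] msum_nonneg)
  finally show ?thesis .
qed

section \<open>A quantitative right inverse function theorem\<close>

text \<open>After composing \<open>f\<close> with the affine map \<open>z \<mapsto> x0 + M z\<close>, where \<open>M\<close> approximates a right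
  inverse of \<open>f' x0\<close>, the derivative is close to the identity on a ball of radius \<open>r\<close>.\<close>

locale local_chart =
  fixes f :: "real ^ 'n::finite \<Rightarrow> real ^ 'm::finite" and Df :: "real ^ 'n \<Rightarrow> real ^ 'n ^ 'm"
    and X :: "(real ^ 'n) set" and x0 :: "real ^ 'n" and M :: "real ^ 'm ^ 'n" and r :: real
  assumes C1: "C1_with_deriv f Df X" and r: "0 < r"
    and in_X: "\<And>z. norm z < r \<Longrightarrow> x0 + M *v z \<in> X"
    and near: "\<And>z. norm z < r \<Longrightarrow> msum (Df (x0 + M *v z) ** M - mat 1) \<le> 1/2"
begin

definition F :: "real ^ 'm \<Rightarrow> real ^ 'm" where
  "F z = f (x0 + M *v z)"

lemma F_0: "F 0 = f x0"
  by (simp add: F_def)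

lemma F_has_derivative:
  assumes "norm z < r"
  shows "(F has_derivative (\<lambda>h. (Df (x0 + M *v z) ** M) *v h)) (at z)"
proof -
  have "((\<lambda>z. x0 + M *v z) has_derivative (\<lambda>h. M *v h)) (at z)"
    by (auto intro!: derivative_eq_intros bounded_linear_imp_has_derivative)
  moreover have "(f has_derivative (\<lambda>h. Df (x0 + M *v z) *v h)) (at (x0 + M *v z))"
    using C1 in_X[OF assms] unfolding C1_with_deriv_def by blast
  ultimately have "(F has_derivative (\<lambda>h. Df (x0 + M *v z) *v (M *v h))) (at z)"
    unfolding F_def[abs_def] by (rule has_derivative_compose)
  then show ?thesis by (simp add: matrix_vector_mul_assoc)
qed

lemma F_minus_id_contracts:
  assumes "norm z < r" "norm z' < r"
  shows "norm ((F z - z) - (F z' - z')) \<le> 1/2 * norm (z - z')"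
proof (rule differentiable_bound[where S = "ball 0 r"
      and f' = "\<lambda>z h. (Df (x0 + M *v z) ** M) *v h - h" and f = "\<lambda>z. F z - z"])
  fix z :: "real ^ 'm" assume "z \<in> ball 0 r"
  then have z: "norm z < r" by simp
  show "((\<lambda>z. F z - z) has_derivative (\<lambda>h. (Df (x0 + M *v z) ** M) *v h - h)) (at z within ball 0 r)"
    by (rule has_derivative_at_withinI) (intro has_derivative_diff F_has_derivative z has_derivative_ident)
  show "onorm (\<lambda>h. (Df (x0 + M *v z) ** M) *v h - h) \<le> 1/2"
  proof (rule onorm_le)
    fix h
    have "norm ((Df (x0 + M *v z) ** M) *v h - h) = norm ((Df (x0 + M *v z) ** M - mat 1) *v h)"
      by (simp add: matrix_vector_mult_diff_rdistrib)
    also have "\<dots> \<le> msum (Df (x0 + M *v z) ** M - mat 1) * norm h"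
      by (rule norm_matrix_vector_le_msum)
    also have "\<dots> \<le> 1/2 * norm h"
      by (intro mult_right_mono near z) auto
    finally show "norm ((Df (x0 + M *v z) ** M) *v h - h) \<le> 1/2 * norm h" .
  qed
qed (use assms in auto)

lemma F_expands:
  assumes "norm z < r" "norm z' < r"
  shows "norm (z - z') \<le> 2 * norm (F z - F z')"
proof -
  have "norm (z - z') \<le> norm (F z - F z') + norm ((F z - z) - (F z' - z'))"
    using norm_triangle_ineq4[of "F z - F z'" "(F z - z) - (F z' - z')"] by (simp add: algebra_simps)
  with F_minus_id_contracts[OF assms] show ?thesis by linarith
qed

lemma F_surj:
  assumes y: "norm (y - f x0) < r / 2"
  shows "\<exists>z. norm z < r \<and> F z = y"
proof -
  \<comment> \<open>A fixed point of \<open>z + (y - F z)\<close> is a preimage of y. This map sends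
    the closed ball of radius s into the one of radius \<open>norm (y - f x0) + s / 2\<close>, which
    equals s for this choice; closedness gives completeness, and s < r keeps the ball inside the
    domain of the estimates.\<close>
  define s where "s = 2 * norm (y - f x0)"
  have s: "0 \<le> s" "s < r" using y by (auto simp: s_def)
  have T: "norm (z + (y - F z)) \<le> s" if "norm z \<le> s" for z
  proof -
    have "z + (y - F z) = (y - f x0) - ((F z - z) - (F 0 - 0))"
      by (simp add: F_0)
    from arg_cong[OF this, of norm]
    have "norm (z + (y - F z)) \<le> norm (y - f x0) + norm ((F z - z) - (F 0 - 0))"
      using norm_triangle_ineq4[of "y - f x0" "(F z - z) - (F 0 - 0)"] by (rule ord_eq_le_trans)
    also have "\<dots> \<le> norm (y - f x0) + 1/2 * norm (z - 0)"
      using F_minus_id_contracts[of z 0] that s r by simp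
    also have "\<dots> \<le> s"
      using that by (simp add: s_def)
    finally show ?thesis .
  qed
  have "\<exists>!z\<in>cball 0 s. z + (y - F z) = z"
  proof (rule Banach_fix[where c = "1/2"])
    show "complete (cball (0 :: real ^ 'm) s)" by (simp add: compact_imp_complete)
    show "cball (0 :: real ^ 'm) s \<noteq> {}" using s by simp
    show "(\<lambda>z. z + (y - F z)) ` cball 0 s \<subseteq> cball 0 s" using T by auto
    show "dist (z + (y - F z)) (z' + (y - F z')) \<le> 1/2 * dist z z'"
      if "z \<in> cball 0 s" "z' \<in> cball 0 s" for z z'
    proof -
      have "dist (z + (y - F z)) (z' + (y - F z')) = norm ((F z - z) - (F z' - z'))"
        by (simp add: dist_norm norm_minus_commute algebra_simps)
      then show ?thesis
        using F_minus_id_contracts[of z z'] that s by (simp add: dist_norm)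
    qed
  qed auto
  then obtain z where "norm z \<le> s" "z + (y - F z) = z" by auto
  then show ?thesis using s by (intro exI[of _ z]) auto
qed

end



lemma continuous_on_matrix_mult_const:
  fixes A :: "'x::topological_space \<Rightarrow> real ^ 'b::finite ^ 'a::finite" and C :: "real ^ 'c::finite ^ 'b"
  shows "continuous_on S A \<Longrightarrow> continuous_on S (\<lambda>x. A x ** C)"
  unfolding matrix_matrix_mult_def by (intro continuous_intros)

lemma continuous_on_matrix_const_mult:
  fixes A :: "'x::topological_space \<Rightarrow> real ^ 'b::finite ^ 'a::finite" and C :: "real ^ 'a ^ 'c::finite"
  shows "continuous_on S A \<Longrightarrow> continuous_on S (\<lambda>x. C ** A x)"
  unfolding matrix_matrix_mult_def by (intro continuous_intros)

section \<open>The local right inverse and its continuous derivative\<close>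

context local_chart
begin

abbreviation target :: "(real ^ 'm) set" where
  "target \<equiv> ball (f x0) (r / 2)"

text \<open>On \<open>target\<close> the point is unique, since \<open>F_expands\<close> makes F
  injective on the ball of radius r.\<close>

definition Z :: "real ^ 'm \<Rightarrow> real ^ 'm" where
  "Z y = (SOME z. norm z < r \<and> F z = y)"

definition g :: "real ^ 'm \<Rightarrow> real ^ 'n" where
  "g y = x0 + M *v Z y"

text \<open>For y in \<open>target\<close>, the inverse of the derivative of F at
  \<open>Z y\<close>, that is, the derivative of Z at y.\<close>

definition W :: "real ^ 'm \<Rightarrow> real ^ 'm ^ 'm" where
  "W y = (SOME V. (Df (g y) ** M) ** V = mat 1 \<and> V ** (Df (g y) ** M) = mat 1)"

definition Dg :: "real ^ 'm \<Rightarrow> real ^ 'm ^ 'n" where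
  "Dg y = M ** W y"

lemma Z_props:
  assumes "y \<in> target"
  shows "norm (Z y) < r" "F (Z y) = y"
proof -
  have "\<exists>z. norm z < r \<and> F z = y"
    using assms by (intro F_surj) (simp add: dist_norm norm_minus_commute)
  from someI_ex[OF this] show "norm (Z y) < r" "F (Z y) = y"
    unfolding Z_def by auto
qed

lemma f_x0_in_target: "f x0 \<in> target"
  using r by simp

lemma g_x0: "g (f x0) = x0"
proof -
  have "norm (Z (f x0) - 0) \<le> 2 * norm (F (Z (f x0)) - F 0)"
    using Z_props[OF f_x0_in_target] r by (intro F_expands) auto
  then show ?thesis
    using Z_props(2)[OF f_x0_in_target] by (simp add: F_0 g_def)
qed

lemma g_in_X: "y \<in> target \<Longrightarrow> g y \<in> X"
  unfolding g_def by (intro in_X Z_props)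

lemma f_g: "y \<in> target \<Longrightarrow> f (g y) = y"
  using Z_props(2)[of y] by (simp add: g_def F_def)

lemma near_g: "y \<in> target \<Longrightarrow> msum (Df (g y) ** M - mat 1) \<le> 1/2"
  unfolding g_def by (intro near Z_props)

lemma W_props:
  assumes "y \<in> target"
  shows "(Df (g y) ** M) ** W y = mat 1" "W y ** (Df (g y) ** M) = mat 1"
  using someI_ex[OF near_identity_inverse[OF near_g[OF assms]]] unfolding W_def by auto

lemma continuous_on_Z: "continuous_on target Z"
  unfolding continuous_on_iff
proof (intro ballI allI impI)
  fix y e assume y: "y \<in> target" and "0 < (e::real)"
  have "dist (Z y') (Z y) < e" if "y' \<in> target" "dist y' y < e / 2" for y'
    using F_expands[OF Z_props(1)[OF that(1)] Z_props(1)[OF y]] that(2)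
    by (simp add: dist_norm Z_props(2)[OF that(1)] Z_props(2)[OF y])
  with \<open>0 < e\<close> show "\<exists>d>0. \<forall>y'\<in>target. dist y' y < d \<longrightarrow> dist (Z y') (Z y) < e"
    by (intro exI[of _ "e / 2"]) auto
qed

lemma continuous_on_g: "continuous_on target g"
  unfolding g_def[abs_def]
  by (intro continuous_intros bounded_linear.continuous_on[OF matrix_vector_mul_bounded_linear]
      continuous_on_Z)

text \<open>The fixed matrix \<open>W y\<close> serves as an approximate inverse at a nearby y'. Its
  residual bounds the distance to \<open>W y'\<close>, depends continuously on y' and vanishes at
  y.\<close>

lemma continuous_on_W: "continuous_on target W"
  unfolding continuous_on_def
proof
  fix y assume y: "y \<in> target"
  define A where "A y = Df (g y) ** M" for y
  define m where "m = 2 * msum (mat 1 :: real ^ 'm ^ 'm)"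
  have "continuous_on X Df"
    using C1 by (simp add: C1_with_deriv_def)
  then have "continuous_on target (\<lambda>y. Df (g y))"
    by (rule continuous_on_compose2[OF _ continuous_on_g]) (auto intro: g_in_X)
  then have "continuous_on target (\<lambda>y'. m * msum (A y' ** W y - mat 1))"
    unfolding msum_def A_def
    by (intro continuous_intros continuous_on_matrix_mult_const)
  then have "((\<lambda>y'. m * msum (A y' ** W y - mat 1)) \<longlongrightarrow> m * msum (A y ** W y - mat 1)) (at y within target)"
    using y unfolding continuous_on_def by blast
  then have lim: "((\<lambda>y'. m * msum (A y' ** W y - mat 1)) \<longlongrightarrow> 0) (at y within target)"
    by (simp add: A_def W_props(1)[OF y] msum_def)
  have "\<forall>\<^sub>F y' in at y within target. norm (W y' - W y) \<le> m * msum (A y' ** W y - mat 1)"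
    unfolding eventually_at_filter
  proof (intro always_eventually allI impI)
    fix y' assume "y' \<in> target"
    then have "msum (W y - W y') \<le> m * msum (A y' ** W y - mat 1)"
      unfolding m_def A_def by (intro near_identity_inverse_approx near_g W_props)
    then show "norm (W y' - W y) \<le> m * msum (A y' ** W y - mat 1)"
      using norm_le_msum[of "W y - W y'"] by (simp add: norm_minus_commute)
  qed
  then have "((\<lambda>y'. W y' - W y) \<longlongrightarrow> 0) (at y within target)"
    using lim by (rule Lim_null_comparison)
  then show "(W \<longlongrightarrow> W y) (at y within target)"
    by (simp add: Lim_null[symmetric])
qed

lemma C1_g: "C1_with_deriv g Dg target"
  unfolding C1_with_deriv_def
proof (intro conjI ballI)
  fix y assume y: "y \<in> target"
  have "(Z has_derivative (\<lambda>h. W y *v h)) (at y)"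
  proof (rule has_derivative_inverse_basic[where f = F and T = target])
    show "(F has_derivative (\<lambda>h. (Df (g y) ** M) *v h)) (at (Z y))"
      unfolding g_def by (intro F_has_derivative Z_props y)
    show "bounded_linear ((*v) (W y))"
      by (rule matrix_vector_mul_bounded_linear)
    show "(*v) (W y) \<circ> (*v) (Df (g y) ** M) = id"
      using W_props(2)[OF y] by (auto simp: matrix_vector_mul_assoc)
    show "continuous (at y) Z"
      using continuous_on_Z y by (simp add: continuous_on_eq_continuous_at)
  qed (use y Z_props in auto)
  then have "((\<lambda>y. M *v Z y) has_derivative (\<lambda>h. M *v (W y *v h))) (at y)"
    by (rule bounded_linear.has_derivative[OF matrix_vector_mul_bounded_linear])
  then show "(g has_derivative (\<lambda>h. Dg y *v h)) (at y)"
    unfolding g_def[abs_def] Dg_def by (auto intro!: derivative_eq_intros simp: matrix_vector_mul_assoc)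
next
  show "continuous_on target Dg"
    unfolding Dg_def[abs_def] by (rule continuous_on_matrix_const_mult[OF continuous_on_W])
qed

end

section \<open>Rational vectors and matrices\<close>

lemma qvec_nth: "qvec c $ j = nuR (nthc c (cidx j))"
  by (simp add: qvec_def nthc_eq nuR_0 Let_def)

lemma cq_qvec: "computable_seq f \<Longrightarrow> cq (\<lambda>x. qvec (f x) $ j)"
  unfolding qvec_nth by (intro cq_nuR tc_nthc tc_const)

definition qmat :: "nat \<Rightarrow> real ^ 'b::finite ^ 'a::finite" where
  "qmat c = (\<chi> a b. nuR (nthc c (pair (cidx a) (cidx b))))"

lemma qmat_nth: "qmat c $ a $ b = nuR (nthc c (pair (cidx a) (cidx b)))"
  by (simp add: qmat_def)

lemma cq_qmat: "computable_seq f \<Longrightarrow> cq (\<lambda>x. qmat (f x) $ a $ b)"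
  unfolding qmat_nth by (intro cq_nuR tc_nthc tc_const)

lemma ex_code_on_finite:
  assumes "inj (h :: 'i::finite \<Rightarrow> nat)"
  shows "\<exists>c. \<forall>i. nthc c (h i) = s i"
proof -
  define N where "N = Suc (\<Sum>i\<in>UNIV. h i)"
  have "h i < N" for i
    using member_le_sum[of i UNIV h] by (simp add: N_def less_Suc_eq_le)
  moreover obtain c where "\<forall>k<N. nthc c k = s (inv h k)"
    using ex_code_of_fun[of N "\<lambda>k. s (inv h k)"] by blast
  ultimately show ?thesis
    using assms by (intro exI[of _ c]) (simp add: inv_f_f)
qed

lemma ex_qvec_approx:
  fixes x :: "real ^ 'n::finite"
  assumes "e > 0"
  shows "\<exists>c. (\<Sum>j\<in>UNIV. \<bar>qvec c $ j - x $ j\<bar>) < e"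
proof -
  have "\<forall>j. \<exists>c. \<bar>nuR c - x $ j\<bar> < e / real CARD('n)"
    using assms by (intro allI nuR_approx) simp
  then obtain s where s: "\<And>j. \<bar>nuR (s j) - x $ j\<bar> < e / real CARD('n)"
    by metis
  obtain c where "\<forall>j::'n. nthc c (cidx j) = s j"
    using ex_code_on_finite[OF inj_cidx] by blast
  then have "(\<Sum>j\<in>UNIV. \<bar>qvec c $ j - x $ j\<bar>) < (\<Sum>j\<in>(UNIV :: 'n set). e / real CARD('n))"
    using s by (intro sum_strict_mono) (auto simp: qvec_nth)
  then show ?thesis by auto
qed

lemma ex_qmat_approx:
  fixes A :: "real ^ 'b::finite ^ 'a::finite"
  assumes "e > 0"
  shows "\<exists>c. msum (qmat c - A) < e"
proof -
  let ?e = "e / real (CARD('a) * CARD('b))"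
  have "\<forall>ab. \<exists>c. \<bar>nuR c - A $ fst ab $ snd ab\<bar> < ?e"
    using assms by (intro allI nuR_approx) simp
  then obtain s where s: "\<And>ab. \<bar>nuR (s ab) - A $ fst ab $ snd ab\<bar> < ?e"
    by metis
  have "inj (\<lambda>ab :: 'a \<times> 'b. pair (cidx (fst ab)) (cidx (snd ab)))"
    by (auto intro!: injI simp: prod_eq_iff)
  from ex_code_on_finite[OF this, of s] obtain c where
    c: "\<And>a b. nthc c (pair (cidx a) (cidx b)) = s (a, b)" by auto
  have "msum (qmat c - A) < (\<Sum>a\<in>(UNIV :: 'a set). \<Sum>b\<in>(UNIV :: 'b set). ?e)"
    unfolding msum_def
    using s[of "(_, _)"] by (intro sum_strict_mono) (auto simp: qmat_nth c)
  then show ?thesis by auto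
qed

text \<open>Full row rank gives an exact right inverse R, and rational matrices are dense. The
  summand 1 in \<open>msum A + 1\<close> only avoids dividing by zero.\<close>

lemma ex_qmat_right_inverse:
  fixes A :: "real ^ 'n::finite ^ 'm::finite"
  assumes "rank A = CARD('m)" "e > 0"
  shows "\<exists>c. msum (A ** qmat c - mat 1) < e"
proof -
  obtain R where R: "A ** R = mat 1"
    using assms(1) full_rank_surjective matrix_right_invertible_surjective by blast
  have pos: "0 < msum A + 1" using msum_nonneg[of A] by linarith
  obtain c where c: "msum (qmat c - R) < e / (msum A + 1)"
    using ex_qmat_approx[of "e / (msum A + 1)" R] assms(2) pos by auto
  have "msum (A ** qmat c - mat 1) \<le> msum A * msum (qmat c - R)"
    using msum_mult[of A "qmat c - R"] by (simp add: matrix_diff_ldistrib R)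
  also have "\<dots> \<le> (msum A + 1) * msum (qmat c - R)"
    by (intro mult_right_mono msum_nonneg) simp
  also have "\<dots> < e"
    using c pos by (simp add: field_simps)
  finally show ?thesis by blast
qed

text \<open>Continuity of the derivative yields a radius without any computation, as suits the first
  part. The radius has the form \<open>2 * (1/2) ^ k\<close> so that the image covers a ball of
  radius \<open>(1/2) ^ k\<close>.\<close>

lemma ex_local_chart:
  fixes f :: "real ^ 'n::finite \<Rightarrow> real ^ 'm::finite"
  assumes C1: "C1_with_deriv f Df X" and X: "open X" "x0 \<in> X"
    and M: "msum (Df x0 ** M - mat 1) < 1/2"
  shows "\<exists>k. local_chart f Df X x0 M (2 * (1/2) ^ k)"
proof -
  let ?h = "\<lambda>x. msum (Df x ** M - mat 1)"
  have "continuous_on X Df"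
    using C1 by (simp add: C1_with_deriv_def)
  then have "continuous_on X ?h"
    unfolding msum_def by (intro continuous_intros continuous_on_matrix_mult_const)
  then have "open (X \<inter> ?h -` {..<1/2})"
    using X(1) by (intro continuous_open_preimage) auto
  then obtain e where e: "e > 0" "ball x0 e \<subseteq> X \<inter> ?h -` {..<1/2}"
    using M X(2) unfolding open_contains_ball by (metis IntI lessThan_iff vimageI)
  have pos: "0 < msum M + 1" using msum_nonneg[of M] by linarith
  obtain k where k: "(1/2) ^ k < e / (2 * (msum M + 1))"
    using half_power_arbitrarily_small[of "e / (2 * (msum M + 1))"] e(1) pos by auto
  have *: "x0 + M *v z \<in> ball x0 e" if "norm z < 2 * (1/2) ^ k" for z
  proof -
    have "norm (M *v z) \<le> msum M * norm z"
      by (rule norm_matrix_vector_le_msum)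
    also have "\<dots> \<le> (msum M + 1) * (2 * (1/2) ^ k)"
      using that pos msum_nonneg[of M] by (intro mult_mono) auto
    also have "\<dots> < e"
      using k pos by (simp add: field_simps)
    finally show ?thesis by (simp add: dist_norm)
  qed
  show ?thesis
  proof (rule exI[of _ k], unfold_locales)
    show "C1_with_deriv f Df X" by (rule C1)
    show "0 < 2 * (1/2 :: real) ^ k" by simp
    fix z :: "real ^ 'm" assume "norm z < 2 * (1/2) ^ k"
    from *[OF this] e(2) have "x0 + M *v z \<in> X \<inter> ?h -` {..<1/2}" by blast
    then show "x0 + M *v z \<in> X" "?h (x0 + M *v z) \<le> 1/2" by auto
  qed
qed

text \<open>Squaring removes the root, so comparing the norm of a rational vector with a positive
  rational becomes decidable.\<close>

lemma norm_less_iff_sum_squares: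
  fixes z :: "real ^ 'n::finite"
  assumes "0 < r"
  shows "norm z < r \<longleftrightarrow> (\<Sum>i\<in>UNIV. z $ i * z $ i) < r * r"
proof -
  have "norm z * norm z = (\<Sum>i\<in>UNIV. z $ i * z $ i)"
    using power2_norm_eq_inner[of z] by (simp add: power2_eq_square inner_vec_def)
  moreover have "norm z < r \<longleftrightarrow> norm z * norm z < r * r"
    using assms by (meson mult_strict_mono' norm_ge_zero not_less mult_mono less_imp_le)
  ultimately show ?thesis by simp
qed

lemma msum_mat_1: "msum (mat 1 :: real ^ 'm::finite ^ 'm) = real CARD('m)"
proof -
  have "\<bar>(mat 1 :: real ^ 'm ^ 'm) $ a $ b\<bar> = (if a = b then 1 else 0)" for a b
    by (simp add: mat_def)
  then show ?thesis by (simp add: msum_def)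
qed

lemma cq_mat_1: "cq (\<lambda>x. (mat 1 :: real ^ 'm::finite ^ 'm) $ a $ b)"
  by (cases "a = b") (simp_all add: mat_def cq_0 cq_1)

lemma cr_matrix_mult_cq:
  fixes A :: "(nat \<Rightarrow> nat) \<Rightarrow> nat \<Rightarrow> real ^ 'b::finite ^ 'a::finite" and B :: "nat \<Rightarrow> real ^ 'c::finite ^ 'b"
  assumes "\<And>a b. cr D (\<lambda>p x. A p x $ a $ b)" "\<And>b c. cq (\<lambda>x. B x $ b $ c)"
  shows "cr D (\<lambda>p x. (A p x ** B x) $ a $ c)"
proof -
  have "cr D (\<lambda>p x. \<Sum>b\<in>UNIV. B x $ b $ c * A p x $ a $ b)"
    by (intro cr_sum cr_scale assms finite)
  then show ?thesis
    by (simp add: matrix_matrix_mult_def mult.commute)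
qed

lemma cr_msum:
  fixes A :: "(nat \<Rightarrow> nat) \<Rightarrow> nat \<Rightarrow> real ^ 'b::finite ^ 'a::finite"
  assumes "\<And>a b. cr D (\<lambda>p x. A p x $ a $ b)"
  shows "cr D (\<lambda>p x. msum (A p x))"
  unfolding msum_def by (intro cr_sum cr_abs assms finite)

lemma cr_msum_diff_1:
  fixes A :: "(nat \<Rightarrow> nat) \<Rightarrow> nat \<Rightarrow> real ^ 'm::finite ^ 'm"
  assumes "\<And>a b. cr D (\<lambda>p x. A p x $ a $ b)"
  shows "cr D (\<lambda>p x. msum (A p x - mat 1))"
  by (intro cr_msum) (simp add: cr_diff assms cr_cq cq_mat_1)

section \<open>Computability of the local inverse\<close>

lemma computable_local_inverse:
  fixes f :: "real ^ 'n::finite \<Rightarrow> real ^ 'm::finite"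
  assumes chart: "local_chart f Df X x0 (qmat c0) (2 * (1/2) ^ k)"
    and f: "comp_fun rho_n rho_n X f" and Df: "comp_fun rho_n rho_mat X Df"
    and x0: "computable_elem rho_n x0"
  shows "comp_fun rho_n rho_n (ball (f x0) ((1/2) ^ k)) (local_chart.g f x0 (qmat c0) (2 * (1/2) ^ k))"
    and "comp_fun rho_n rho_mat (ball (f x0) ((1/2) ^ k)) (local_chart.Dg f Df x0 (qmat c0) (2 * (1/2) ^ k))"
proof -
  define M :: "real ^ 'm ^ 'n" where "M = qmat c0"
  define r :: real where "r = 2 * (1/2) ^ k"
  interpret local_chart f Df X x0 M r
    using chart by (simp add: M_def r_def)
  define D where "D p \<longleftrightarrow> (\<exists>y\<in>target. rho_n p y)" for p
  define Y :: "(nat \<Rightarrow> nat) \<Rightarrow> real ^ 'm" where "Y p = (THE y. rho_n p y)" for p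
  have Y_eq: "Y p = y" if "rho_n p y" for p y
    unfolding Y_def using that by (intro the_equality) (auto intro: rho_n_unique)
  have DY: "D p \<and> Y p = y" if "y \<in> target" "rho_n p y" for p y
    using that by (auto simp: D_def Y_eq)
  have Y: "Y p \<in> target" "rho_n p (Y p)" if "D p" for p
    using that by (auto simp: D_def Y_eq)
  have cr_Y: "cr D (\<lambda>p x. Y p $ a)" for a
    using cr_name[OF tc_id, of D Y] Y(2) by simp
  have cr_x0: "cr D (\<lambda>p x. x0 $ j)" for j
    by (rule cr_computable_elem[OF x0])
  have cq_M: "cq (\<lambda>x. M $ j $ a)" for j a
    unfolding M_def by (intro cq_qmat tc_const)
  have cq_r: "cq (\<lambda>x. r)"
    unfolding r_def by (intro cq_intros tc_const)

  define small where "small q \<longleftrightarrow> (\<Sum>i\<in>UNIV. (qvec q :: real ^ 'm) $ i * qvec q $ i) < r * r" for q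
  have small_iff: "small q \<longleftrightarrow> norm (qvec q :: real ^ 'm) < r" for q
    unfolding small_def using norm_less_iff_sum_squares[OF r] by blast
  have dec_small: "dec small"
    unfolding small_def[abs_def] by (intro dec_less_cq cq_sum cq_mult cq_qvec cq_r tc_id finite)
  \<comment> \<open>Evaluating f by its machine needs an argument in X for every code q; codes
    outside the ball are sent to the harmless default x0.\<close>
  define u where "u q = (if small q then x0 + M *v qvec q else x0)" for q
  have u_X: "u q \<in> X" for q
    using in_X[of 0] in_X[of "qvec q"] r by (auto simp: u_def small_iff)
  have cr_u: "cr D (\<lambda>p q. u q $ j)" for j
  proof -
    have "cr D (\<lambda>p q. if small q then x0 $ j + (\<Sum>a\<in>UNIV. M $ j $ a * qvec q $ a) else x0 $ j)"
      by (intro cr_if dec_small cr_add cr_x0 cr_cq cq_sum cq_mult cq_M cq_qvec tc_id finite)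
    then show ?thesis
      by (rule cr_cong) (simp add: u_def matrix_vector_mult_def)
  qed
  have cr_f: "cr D (\<lambda>p q. f (u q) $ a)" for a
  proof -
    obtain phi where "realizes phi X (\<lambda>x. f x $ a)"
      using realizes_comp_fun_vec[OF f] by blast
    then show ?thesis by (rule cr_apply[OF _ cr_u u_X])
  qed

  have cr_Z: "cr D (\<lambda>p x. Z (Y p) $ a)" for a
  proof (rule cr_of_approx)
    \<comment> \<open>The residual is taken at precision \<open>Suc i\<close> because passing from
      values of F back to arguments costs a factor of 2.\<close>
    let ?S = "\<lambda>p v i (x::nat). \<exists>q. small q \<and> v = nthc q (cidx a) \<and>
        (\<Sum>b\<in>UNIV. \<bar>f (u q) $ b - Y p $ b\<bar>) < (1/2) ^ Suc i"
    show "sg D (\<lambda>p z. ?S p (pr1 z) (pr1 (pr2 z)) (pr2 (pr2 z)))"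
      by (intro sg_ex sg_conj sg_dec[OF dec_comp[OF dec_small]] sg_dec[OF dec_eq] sg_less cr_sum
          cr_abs cr_diff cr_subst[OF cr_f] cr_Y cr_cq cq_half_power tc_intros' finite)
  next
    fix p v i and x :: nat
    assume p: "D p" and "\<exists>q. small q \<and> v = nthc q (cidx a) \<and>
        (\<Sum>b\<in>UNIV. \<bar>f (u q) $ b - Y p $ b\<bar>) < (1/2) ^ Suc i"
    then obtain q where q: "small q" "v = nthc q (cidx a)"
      "(\<Sum>b\<in>UNIV. \<bar>f (u q) $ b - Y p $ b\<bar>) < (1/2) ^ Suc i" by blast
    have "\<bar>nuR v - Z (Y p) $ a\<bar> \<le> norm (qvec q - Z (Y p))"
      using component_le_norm_cart[of "qvec q - Z (Y p)" a] by (simp add: q(2) qvec_nth)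
    also have "\<dots> \<le> 2 * norm (F (qvec q) - F (Z (Y p)))"
      using q(1) Z_props(1)[OF Y(1)[OF p]] by (intro F_expands) (auto simp: small_iff)
    also have "norm (F (qvec q) - F (Z (Y p))) \<le> (\<Sum>b\<in>UNIV. \<bar>f (u q) $ b - Y p $ b\<bar>)"
      using norm_le_l1_cart[of "F (qvec q) - F (Z (Y p))"] q(1)
      by (simp add: Z_props(2)[OF Y(1)[OF p]]) (simp add: F_def u_def)
    also note q(3)
    finally show "\<bar>nuR v - Z (Y p) $ a\<bar> \<le> (1/2) ^ i" by simp
  next
    fix p i and x :: nat
    assume p: "D p"
    let ?z = "Z (Y p)"
    let ?h = "\<lambda>z. \<Sum>b\<in>UNIV. \<bar>F z $ b - Y p $ b\<bar>"
    note z = Z_props[OF Y(1)[OF p]]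
    have "isCont F ?z"
      using F_has_derivative[OF z(1)] by (rule has_derivative_continuous)
    then have "isCont ?h ?z" by (intro continuous_intros)
    moreover have "?h ?z = 0" by (simp add: z(2))
    then have "?h ?z < (1/2) ^ Suc i" by simp
    ultimately have "\<forall>\<^sub>F z in nhds ?z. ?h z < (1/2) ^ Suc i"
      unfolding continuous_at by (intro order_tendstoD(2)[OF tendsto_at_iff_tendsto_nhds[THEN iffD1]])
    moreover have "\<forall>\<^sub>F z in nhds ?z. z \<in> ball 0 r"
      using z(1) by (intro eventually_nhds_in_open) auto
    ultimately have "\<forall>\<^sub>F z in nhds ?z. ?h z < (1/2) ^ Suc i \<and> z \<in> ball 0 r"
      by (rule eventually_conj)
    then obtain d where d: "d > 0" "\<And>z. dist z ?z < d \<Longrightarrow> ?h z < (1/2) ^ Suc i \<and> norm z < r"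
      unfolding eventually_nhds_metric by auto
    obtain q where "(\<Sum>j\<in>UNIV. \<bar>qvec q $ j - ?z $ j\<bar>) < d"
      using ex_qvec_approx[OF d(1)] by blast
    then have "dist (qvec q) ?z < d"
      using norm_le_l1_cart[of "qvec q - ?z"] by (simp add: dist_norm)
    from d(2)[OF this] have "small q" "(\<Sum>b\<in>UNIV. \<bar>f (u q) $ b - Y p $ b\<bar>) < (1/2) ^ Suc i"
      by (auto simp: small_iff u_def F_def)
    then show "\<exists>v q. small q \<and> v = nthc q (cidx a) \<and>
        (\<Sum>b\<in>UNIV. \<bar>f (u q) $ b - Y p $ b\<bar>) < (1/2) ^ Suc i" by blast
  qed

  have cr_g: "cr D (\<lambda>p x. g (Y p) $ j)" for j
  proof -
    have "cr D (\<lambda>p x. x0 $ j + (\<Sum>a\<in>UNIV. M $ j $ a * Z (Y p) $ a))"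
      by (intro cr_add cr_x0 cr_sum cr_scale cq_M cr_Z finite)
    then show ?thesis by (simp add: g_def matrix_vector_mult_def)
  qed
  have cr_Df: "cr D (\<lambda>p x. Df (g (Y p)) $ a $ b)" for a b
  proof -
    obtain phi where "realizes phi X (\<lambda>x. Df x $ a $ b)"
      using realizes_comp_fun_mat[OF Df] by blast
    then show ?thesis by (rule cr_apply[OF _ cr_g]) (intro g_in_X Y)
  qed
  define A where "A p = Df (g (Y p)) ** M" for p
  have cr_A: "cr D (\<lambda>p x. A p $ a $ b)" for a b
    unfolding A_def by (intro cr_matrix_mult_cq cr_Df cq_M)

  have cr_W: "cr D (\<lambda>p x. W (Y p) $ a $ b)" for a b
  proof (rule cr_of_approx)
    \<comment> \<open>The factor from the residual estimate for inverses, with the norm of the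
      identity evaluated to the dimension.\<close>
    let ?m = "2 * real CARD('m)"
    let ?S = "\<lambda>p v i (x::nat). \<exists>q. v = nthc q (pair (cidx a) (cidx b)) \<and>
        ?m * msum (A p ** qmat q - mat 1) < (1/2) ^ i"
    show "sg D (\<lambda>p z. ?S p (pr1 z) (pr1 (pr2 z)) (pr2 (pr2 z)))"
      by (intro sg_ex sg_conj sg_dec[OF dec_eq] sg_less cr_scale cr_msum_diff_1 cr_matrix_mult_cq cr_A
          cq_qmat cq_mult cq_numeral cq_const_nat cr_cq cq_half_power tc_intros')
  next
    fix p v i and x :: nat
    assume p: "D p" and "\<exists>q. v = nthc q (pair (cidx a) (cidx b)) \<and>
        2 * real CARD('m) * msum (A p ** qmat q - mat 1) < (1/2) ^ i"
    then obtain q where q: "v = nthc q (pair (cidx a) (cidx b))"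
      "2 * real CARD('m) * msum (A p ** qmat q - mat 1) < (1/2) ^ i" by blast
    have "\<bar>nuR v - W (Y p) $ a $ b\<bar> \<le> msum (qmat q - W (Y p))"
      using abs_entry_le_msum[of "qmat q - W (Y p)" a b] by (simp add: q(1) qmat_nth)
    also have "\<dots> \<le> 2 * real CARD('m) * msum (A p ** qmat q - mat 1)"
      unfolding A_def msum_mat_1[symmetric]
      by (intro near_identity_inverse_approx near_g W_props Y p)
    finally show "\<bar>nuR v - W (Y p) $ a $ b\<bar> \<le> (1/2) ^ i"
      using q(2) by simp
  next
    fix p i and x :: nat
    assume p: "D p"
    have AW: "A p ** W (Y p) = mat 1"
      unfolding A_def by (intro W_props Y p)
    define K where "K = 2 * real CARD('m) * (msum (A p) + 1)"
    have K: "0 < K" using msum_nonneg[of "A p"] by (simp add: K_def add_nonneg_pos)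
    obtain q where q: "msum (qmat q - W (Y p)) < (1/2) ^ i / K"
      using ex_qmat_approx[of "(1/2) ^ i / K"] K by auto
    have "msum (A p ** qmat q - mat 1) \<le> msum (A p) * msum (qmat q - W (Y p))"
      using msum_mult[of "A p" "qmat q - W (Y p)"] by (simp add: matrix_diff_ldistrib AW)
    also have "\<dots> \<le> (msum (A p) + 1) * msum (qmat q - W (Y p))"
      by (intro mult_right_mono msum_nonneg) simp
    finally have "2 * real CARD('m) * msum (A p ** qmat q - mat 1) \<le> K * msum (qmat q - W (Y p))"
      unfolding K_def by (simp add: mult.assoc)
    also have "\<dots> < (1/2) ^ i"
      using q K by (simp add: field_simps)
    finally show "\<exists>v q. v = nthc q (pair (cidx a) (cidx b)) \<and>
        2 * real CARD('m) * msum (A p ** qmat q - mat 1) < (1/2) ^ i" by blast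
  qed
  have cr_Dg: "cr D (\<lambda>p x. Dg (Y p) $ j $ b)" for j b
  proof -
    have "cr D (\<lambda>p x. \<Sum>a\<in>UNIV. M $ j $ a * W (Y p) $ a $ b)"
      by (intro cr_sum cr_scale cq_M cr_W finite)
    then show ?thesis by (simp add: Dg_def matrix_matrix_mult_def)
  qed
  have target: "target = ball (f x0) ((1/2) ^ k)"
    by (simp add: r_def)
  show "comp_fun rho_n rho_n (ball (f x0) ((1/2) ^ k)) (local_chart.g f x0 (qmat c0) (2 * (1/2) ^ k))"
    unfolding target[symmetric] M_def[symmetric] r_def[symmetric]
    using DY cr_g by (rule comp_fun_vec_of_cr)
  show "comp_fun rho_n rho_mat (ball (f x0) ((1/2) ^ k)) (local_chart.Dg f Df x0 (qmat c0) (2 * (1/2) ^ k))"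
    unfolding target[symmetric] M_def[symmetric] r_def[symmetric]
    using DY cr_Dg by (rule comp_fun_mat_of_cr)
qed

text \<open>One value v computed near x0 is within \<open>(1/2) ^ l\<close> of the entry both at x0
  and at any point of the small ball, so each entry of the derivative varies by at most twice that.
  The variation times M contributes \<open>1/4\<close>, the residual at x0 another
  \<open>1/4\<close>. The chart is set over U rather than X, which makes the inverse take values in
  U.\<close>

lemma local_chart_of_certificate:
  fixes f :: "real ^ 'n::finite \<Rightarrow> real ^ 'm::finite" and M :: "real ^ 'm ^ 'n"
  assumes C1: "C1_with_deriv f Df X" and phi: "\<And>a b. realizes (phi a b) X (\<lambda>x. Df x $ a $ b)"
    and U: "U \<subseteq> X" "x0 \<in> U" "cball x0 ((1/2) ^ N) \<subseteq> U"
    and loc: "\<And>a b. \<exists>v. loc (phi a b) x0 l N v"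
    and M: "msum (Df x0 ** M - mat 1) \<le> 1/4"
    and l: "real (CARD('m) * CARD('n)) * (2 * (1/2) ^ l) * msum M \<le> 1/4"
    and k: "msum M * (2 * (1/2) ^ k) \<le> (1/2) ^ N"
  shows "local_chart f Df U x0 M (2 * (1/2) ^ k)"
proof
  show "C1_with_deriv f Df U"
    using C1 U(1) unfolding C1_with_deriv_def by (auto intro: continuous_on_subset)
  show "0 < 2 * (1/2 :: real) ^ k" by simp
  fix z :: "real ^ 'm" assume z: "norm z < 2 * (1/2) ^ k"
  have "norm (M *v z) \<le> msum M * norm z"
    by (rule norm_matrix_vector_le_msum)
  also have "\<dots> \<le> msum M * (2 * (1/2) ^ k)"
    using z msum_nonneg[of M] by (intro mult_left_mono) auto
  also note k
  finally have Mz: "norm (M *v z) \<le> (1/2) ^ N" .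
  then have "x0 + M *v z \<in> cball x0 ((1/2) ^ N)"
    by (simp add: dist_norm)
  with U(3) show in_U: "x0 + M *v z \<in> U" by blast
  let ?E = "Df (x0 + M *v z) - Df x0"
  have "\<bar>?E $ a $ b\<bar> \<le> 2 * (1/2) ^ l" for a b
  proof -
    obtain v where v: "loc (phi a b) x0 l N v" using loc by blast
    have "\<bar>(x0 + M *v z) $ j - x0 $ j\<bar> \<le> (1/2) ^ N" for j
      using component_le_norm_cart[of "M *v z" j] Mz by simp
    then have "\<bar>nuR v - Df (x0 + M *v z) $ a $ b\<bar> \<le> (1/2) ^ l"
      using loc_sound[OF phi v] in_U U(1) by blast
    moreover have "\<bar>nuR v - Df x0 $ a $ b\<bar> \<le> (1/2) ^ l"
      using loc_sound[OF phi v, of x0] U by auto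
    ultimately show ?thesis by simp
  qed
  then have E: "msum ?E \<le> real (CARD('m) * CARD('n)) * (2 * (1/2) ^ l)"
    by (rule msum_le_const)
  have "Df (x0 + M *v z) ** M - mat 1 = (Df x0 ** M - mat 1) + ?E ** M"
    by (simp add: matrix_diff_rdistrib)
  from arg_cong[OF this, of msum]
  have "msum (Df (x0 + M *v z) ** M - mat 1) \<le> msum (Df x0 ** M - mat 1) + msum (?E ** M)"
    using msum_add[of "Df x0 ** M - mat 1" "?E ** M"] by (rule ord_eq_le_trans)
  also have "msum (?E ** M) \<le> msum ?E * msum M"
    by (rule msum_mult)
  also have "msum ?E * msum M \<le> real (CARD('m) * CARD('n)) * (2 * (1/2) ^ l) * msum M"
    by (intro mult_right_mono E msum_nonneg)
  finally show "msum (Df (x0 + M *v z) ** M - mat 1) \<le> 1/2"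
    using M l by linarith
qed

text \<open>The detour through c', rational in its use, separates the two difficulties: the real
  point x0 enters only a sum of absolute values, and the Euclidean distance is only taken between
  rational points, where it can be squared.\<close>

lemma cball_subset_ball_certificate:
  fixes x0 c c' :: "real ^ 'n::finite"
  assumes "(\<Sum>j\<in>UNIV. \<bar>c' $ j - x0 $ j\<bar>) + e < s" "s < R"
    "(\<Sum>j\<in>UNIV. (c $ j - c' $ j) * (c $ j - c' $ j)) < (R - s) * (R - s)"
  shows "cball x0 e \<subseteq> ball c R"
proof
  fix x assume x: "x \<in> cball x0 e"
  have "dist c c' < R - s"
    using norm_less_iff_sum_squares[of "R - s" "c - c'"] assms(2,3) by (simp add: dist_norm)
  moreover have "dist c' x0 \<le> (\<Sum>j\<in>UNIV. \<bar>c' $ j - x0 $ j\<bar>)"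
    using norm_le_l1_cart[of "c' - x0"] by (simp add: dist_norm)
  moreover have "dist c x \<le> dist c c' + dist c' x0 + dist x0 x"
    using dist_triangle[of c x c'] dist_triangle[of c' x x0] by linarith
  ultimately show "x \<in> ball c R"
    using x assms(1) by simp
qed

lemma ex_ball_certificate:
  fixes x0 c :: "real ^ 'n::finite"
  assumes "x0 \<in> ball c R"
  shows "\<exists>N q s. (\<Sum>j\<in>UNIV. \<bar>qvec q $ j - x0 $ j\<bar>) + (1/2) ^ N < nuR s \<and> nuR s < R \<and>
    (\<Sum>j\<in>UNIV. (c $ j - qvec q $ j) * (c $ j - qvec q $ j)) < (R - nuR s) * (R - nuR s)"
proof -
  \<comment> \<open>The gap e is divided so that both tests succeed strictly: q and the radius cost
    less than \<open>e / 4\<close> each, together less than \<open>e / 2 < nuR s\<close>, while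
    \<open>nuR s < 3 * e / 4\<close> leaves room for moving from x0 to q.\<close>
  define e where "e = R - dist c x0"
  have e: "0 < e" "e \<le> R" using assms by (auto simp: e_def)
  obtain q where q: "(\<Sum>j\<in>UNIV. \<bar>(qvec q :: real ^ 'n) $ j - x0 $ j\<bar>) < e / 4"
    using ex_qvec_approx[of "e / 4" x0] e by auto
  obtain N where N: "(1/2) ^ N < e / 4"
    using half_power_arbitrarily_small[of "e / 4"] e by auto
  obtain s where s: "e / 2 < nuR s" "nuR s < 3 * e / 4"
    using nuR_dense[of "e / 2" "3 * e / 4"] e by auto
  have "dist x0 (qvec q) < e / 4"
    using norm_le_l1_cart[of "qvec q - x0"] q by (simp add: dist_norm norm_minus_commute)
  then have "dist c (qvec q) < R - nuR s"
    using dist_triangle[of c "qvec q" x0] s(2) by (simp add: e_def)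
  moreover have "nuR s < R" using s(2) e by linarith
  ultimately have "(\<Sum>j\<in>UNIV. (c $ j - qvec q $ j) * (c $ j - qvec q $ j)) < (R - nuR s) * (R - nuR s)"
    using norm_less_iff_sum_squares[of "R - nuR s" "c - qvec q"] by (simp add: dist_norm)
  moreover have "(\<Sum>j\<in>UNIV. \<bar>qvec q $ j - x0 $ j\<bar>) + (1/2) ^ N < nuR s"
    using q N s(1) by linarith
  ultimately show ?thesis
    using \<open>nuR s < R\<close> by blast
qed

lemma computable_inverse_radius:
  fixes f :: "real ^ 'n::finite \<Rightarrow> real ^ 'm::finite"
  assumes C1: "C1_with_deriv f Df X" and Df: "comp_fun rho_n rho_mat X Df"
  defines "I \<equiv> (\<lambda>(Ux :: (real ^ 'n) set \<times> (real ^ 'n)) (k::nat).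
                     snd Ux \<in> fst Ux \<and> fst Ux \<subseteq> X \<and> open (fst Ux) \<and>
                     rank (Df (snd Ux)) = CARD('m) \<and>
                     (\<exists>g :: real ^ 'm \<Rightarrow> real ^ 'n.
                        (\<forall>y\<in>ball (f (snd Ux)) ((1/2) ^ k). g y \<in> fst Ux) \<and>
                        g (f (snd Ux)) = snd Ux \<and>
                        (\<forall>y\<in>ball (f (snd Ux)) ((1/2) ^ k). f (g y) = y)))"
  shows "comp_mv (rep_prod theta_lt rho_n) nu_N {Ux. \<exists>k. I Ux k} I"
proof -
  have "\<forall>a b. \<exists>phi. realizes phi X (\<lambda>x. Df x $ a $ b)"
    using realizes_comp_fun_mat[OF Df] by blast
  then obtain phi where phi: "\<And>a b. realizes (phi a b) X (\<lambda>x. Df x $ a $ b)"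
    by metis
  define D where "D p \<longleftrightarrow> (\<exists>Ux k. rep_prod theta_lt rho_n p Ux \<and> I Ux k)" for p
  define U :: "(nat \<Rightarrow> nat) \<Rightarrow> (real ^ 'n) set"
    where "U p = (\<Union>i. ball (qvec (pr1 (p (2 * i)))) (nuR (pr2 (p (2 * i)))))" for p
  define x0 :: "(nat \<Rightarrow> nat) \<Rightarrow> real ^ 'n" where "x0 p = (THE x. rho_n (\<lambda>i. p (2 * i + 1)) x)" for p
  have names: "Ux = (U p, x0 p)" if "rep_prod theta_lt rho_n p Ux" for p Ux
  proof -
    have "fst Ux = U p" "rho_n (\<lambda>i. p (2 * i + 1)) (snd Ux)"
      using that by (auto simp: rep_prod_def theta_lt_def U_def)
    moreover from this(2) have "x0 p = snd Ux"
      unfolding x0_def by (intro the_equality) (auto intro: rho_n_unique)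
    ultimately show ?thesis by (simp add: prod_eq_iff)
  qed
  have D: "rho_n (\<lambda>i. p (2 * i + 1)) (x0 p)" "x0 p \<in> U p" "U p \<subseteq> X" "rank (Df (x0 p)) = CARD('m)"
    if p: "D p" for p
  proof -
    obtain Ux k where *: "rep_prod theta_lt rho_n p Ux" "I Ux k"
      using p unfolding D_def by blast
    then show "rho_n (\<lambda>i. p (2 * i + 1)) (x0 p)" "x0 p \<in> U p" "U p \<subseteq> X" "rank (Df (x0 p)) = CARD('m)"
      using names[OF *(1)] by (auto simp: rep_prod_def I_def)
  qed
  have cr_x0: "cr D (\<lambda>p x. x0 p $ j)" for j
  proof (rule cr_name)
    show "computable_seq (\<lambda>i. 2 * i + 1)" by (intro tc_intros)
  qed (rule D)
  have cr_Df: "cr D (\<lambda>p x. Df (x0 p) $ a $ b)" for a b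
    by (rule cr_apply[OF phi cr_x0]) (use D in blast)
  \<comment> \<open>A semidecidable sufficient condition for the closed ball about x0 to lie in U:
    one listed ball already contains it. Naming the oracle value t isolates the query, after which
    the balls are given by computable rationals.\<close>
  define inU where "inU p N \<longleftrightarrow> (\<exists>i t q s. p (2 * i) = t \<and>
      (\<Sum>j\<in>UNIV. \<bar>(qvec q :: real ^ 'n) $ j - x0 p $ j\<bar>) + (1/2) ^ N < nuR s \<and> nuR s < nuR (pr2 t) \<and>
      (\<Sum>j\<in>UNIV. ((qvec (pr1 t) :: real ^ 'n) $ j - qvec q $ j) * (qvec (pr1 t) $ j - qvec q $ j)) <
        (nuR (pr2 t) - nuR s) * (nuR (pr2 t) - nuR s))" for p :: "nat \<Rightarrow> nat" and N
  \<comment> \<open>The residual involves the real matrix \<open>Df (x0 p)\<close>, so it is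
    compared strictly; the last two conditions concern rationals only and may be weak
    inequalities.\<close>
  define S where "S p (n::nat) k \<longleftrightarrow> (\<exists>c N l. inU p N \<and> (\<forall>a b. \<exists>v. loc (phi a b) (x0 p) l N v) \<and>
      msum (Df (x0 p) ** qmat c - mat 1) < 1/4 \<and>
      real (CARD('m) * CARD('n)) * (2 * (1/2) ^ l) * msum (qmat c :: real ^ 'm ^ 'n) \<le> 1/4 \<and>
      msum (qmat c :: real ^ 'm ^ 'n) * (2 * (1/2) ^ k) \<le> (1/2) ^ N)" for p n k
  have cq_msum: "cq (\<lambda>x. msum (qmat (h x) :: real ^ 'm ^ 'n))" if "computable_seq h" for h
    unfolding msum_def by (intro cq_sum cq_abs cq_qmat that finite)
  have cq_quarter: "cq (\<lambda>x. 1/4)"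
    using cq_half_power[OF tc_const[of 2]] by (simp add: power2_eq_square)
  have sg_inU: "sg D (\<lambda>p x. inU p (h x))" if "computable_seq h" for h
    unfolding inU_def
    by (intro sg_ex sg_conj sg_oracle sg_less cr_add cr_sum cr_abs cr_diff cr_x0 cr_cq cq_qvec cq_sum
        cq_mult cq_diff cq_nuR cq_half_power tc_intros tc_comp[OF that] finite)
  have "sg D (\<lambda>p z. S p (pr1 z) (pr2 z))"
    unfolding S_def
    by (intro sg_ex sg_conj sg_inU sg_finite_all sg_loc sg_less sg_dec[OF dec_le_cq] cr_x0
        cr_msum_diff_1 cr_matrix_mult_cq cr_Df cr_cq cq_qmat cq_quarter cq_mult cq_const_nat cq_numeral
        cq_half_power cq_msum tc_intros)
  moreover have "\<exists>k. S p n k" if p: "D p" for p n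
  proof -
    \<comment> \<open>The dependencies run one way: l is fixed from the matrix, N from l and the
      listed ball, and k from N and the matrix.\<close>
    obtain c where c: "msum (Df (x0 p) ** (qmat c :: real ^ 'm ^ 'n) - mat 1) < 1/4"
      using ex_qmat_right_inverse[OF D(4)[OF p], of "1/4"] by auto
    define M :: "real ^ 'm ^ 'n" where "M = qmat c"
    have M: "0 < msum M + 1" using msum_nonneg[of M] by linarith
    define K where "K = real (CARD('m) * CARD('n)) * 2 * (msum M + 1)"
    have K: "0 < K" using M by (simp add: K_def)
    obtain l where l: "(1/2) ^ l < 1/4 / K"
      using half_power_arbitrarily_small[of "1/4 / K"] K by auto
    have "real (CARD('m) * CARD('n)) * (2 * (1/2) ^ l) * msum M \<le>
        real (CARD('m) * CARD('n)) * (2 * (1/2) ^ l) * (msum M + 1)"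
      by (intro mult_left_mono) auto
    also have "\<dots> = K * (1/2) ^ l" by (simp add: K_def)
    also have "\<dots> \<le> 1/4" using l K by (simp add: field_simps)
    finally have l': "real (CARD('m) * CARD('n)) * (2 * (1/2) ^ l) * msum M \<le> 1/4" .
    have "x0 p \<in> X"
      using D[OF p] by blast
    then have "\<forall>a b. \<exists>N v. loc (phi a b) (x0 p) l N v"
      using loc_complete[OF phi] by blast
    then obtain Nf where Nf: "\<And>a b. \<exists>v. loc (phi a b) (x0 p) l (Nf a b) v"
      by metis
    obtain i where "x0 p \<in> ball (qvec (pr1 (p (2 * i)))) (nuR (pr2 (p (2 * i))))"
      using D(2)[OF p] unfolding U_def by blast
    from ex_ball_certificate[OF this] obtain N' where N': "inU p N'"
      unfolding inU_def by blast
    \<comment> \<open>The sum is a common upper bound. Enlarging N preserves both \<open>loc\<close>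
      and \<open>inU\<close>, since it only shrinks the neighbourhood.\<close>
    define N where "N = N' + (\<Sum>a\<in>UNIV. \<Sum>b\<in>UNIV. Nf a b)"
    have "Nf a b \<le> N" for a b
    proof -
      have "Nf a b \<le> (\<Sum>b\<in>UNIV. Nf a b)" by (intro member_le_sum) auto
      also have "\<dots> \<le> (\<Sum>a\<in>UNIV. \<Sum>b\<in>UNIV. Nf a b)"
        by (rule member_le_sum[where f = "\<lambda>a. \<Sum>b\<in>UNIV. Nf a b"]) auto
      finally show ?thesis by (simp add: N_def)
    qed
    then have N: "\<exists>v. loc (phi a b) (x0 p) l N v" for a b
      using Nf loc_mono by blast
    have "(1/2 :: real) ^ N \<le> (1/2) ^ N'"
      by (intro power_decreasing) (auto simp: N_def)
    then have mono: "t + (1/2) ^ N' < s \<Longrightarrow> t + (1/2) ^ N < s" for t s :: real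
      by linarith
    have "inU p N"
      using N' unfolding inU_def by (blast intro: mono)
    obtain k where k: "(1/2) ^ k < (1/2) ^ N / (2 * (msum M + 1))"
      using half_power_arbitrarily_small[of "(1/2) ^ N / (2 * (msum M + 1))"] M by auto
    have "msum M * (2 * (1/2) ^ k) \<le> (msum M + 1) * (2 * (1/2) ^ k)"
      by (intro mult_right_mono) auto
    also have "\<dots> = (1/2) ^ k * (2 * (msum M + 1))" by (simp only: mult_ac)
    also have "\<dots> \<le> (1/2) ^ N"
    proof -
      have "0 < 2 * (msum M + 1)" using M by simp
      from k[unfolded pos_less_divide_eq[OF this]] show ?thesis by (rule less_imp_le)
    qed
    finally have k': "msum M * (2 * (1/2) ^ k) \<le> (1/2) ^ N" .
    have "S p n k"
      unfolding S_def
      by (rule exI[of _ c], rule exI[of _ N], rule exI[of _ l])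
        (use \<open>inU p N\<close> N c l' k' in \<open>simp only: M_def\<close>, simp)
    then show ?thesis by blast
  qed
  ultimately have "\<exists>psi. \<forall>p. D p \<longrightarrow> (\<exists>q. t2_out psi p q \<and> (\<forall>n. S p n (q n)))"
    by (rule sg_uniformize)
  then obtain psi where psi: "\<And>p. D p \<Longrightarrow> \<exists>q. t2_out psi p q \<and> (\<forall>n. S p n (q n))"
    by blast
  have sound: "I (U p, x0 p) k" if p: "D p" and "S p n k" for p n k
  proof -
    obtain c N l where S: "inU p N" "\<And>a b. \<exists>v. loc (phi a b) (x0 p) l N v"
      "msum (Df (x0 p) ** (qmat c :: real ^ 'm ^ 'n) - mat 1) < 1/4"
      "real (CARD('m) * CARD('n)) * (2 * (1/2) ^ l) * msum (qmat c :: real ^ 'm ^ 'n) \<le> 1/4"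
      "msum (qmat c :: real ^ 'm ^ 'n) * (2 * (1/2) ^ k) \<le> (1/2) ^ N"
      using \<open>S p n k\<close> unfolding S_def by blast
    from S(1) obtain i where "cball (x0 p) ((1/2) ^ N) \<subseteq>
        ball (qvec (pr1 (p (2 * i)))) (nuR (pr2 (p (2 * i))))"
      unfolding inU_def by (auto dest: cball_subset_ball_certificate)
    then have "cball (x0 p) ((1/2) ^ N) \<subseteq> U p"
      unfolding U_def by blast
    then interpret local_chart f Df "U p" "x0 p" "qmat c" "2 * (1/2) ^ k"
      by (rule local_chart_of_certificate[OF C1 phi D(3,2)[OF p] _ S(2) less_imp_le[OF S(3)] S(4,5)])
    have "target = ball (f (x0 p)) ((1/2) ^ k)" by simp
    then have "\<exists>g. (\<forall>y\<in>ball (f (x0 p)) ((1/2) ^ k). g y \<in> U p) \<and> g (f (x0 p)) = x0 p \<and>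
        (\<forall>y\<in>ball (f (x0 p)) ((1/2) ^ k). f (g y) = y)"
      using g_in_X g_x0 f_g by (intro exI[of _ g]) auto
    moreover have "open (U p)"
      unfolding U_def by auto
    ultimately show ?thesis
      using D[OF p] by (simp add: I_def)
  qed
  show ?thesis
    unfolding comp_mv_def
  proof (intro exI[of _ psi] allI impI)
    fix p Ux assume *: "Ux \<in> {Ux. \<exists>k. I Ux k}" "rep_prod theta_lt rho_n p Ux"
    have p: "D p" using * unfolding D_def by blast
    then obtain q where "t2_out psi p q" "S p 0 (q 0)"
      using psi by blast
    then show "\<exists>q k. I Ux k \<and> nu_N q k \<and> t2_out psi p q"
      using sound[OF p] names[OF *(2)] by (auto simp: nu_N_def)
  qed
qed

theorem theorem4:
  fixes dummy_n :: "'n::finite itself" and dummy_m :: "'m::finite itself"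
  shows
  "(\<forall>(U :: (real ^ 'n) set) (f :: real ^ 'n \<Rightarrow> real ^ 'm) (Df :: real ^ 'n \<Rightarrow> real ^ 'n ^ 'm) x0.
      re_open U \<and> comp_fun rho_n rho_n U f \<and> C1_with_deriv f Df U \<and> comp_fun rho_n rho_mat U Df \<and>
      x0 \<in> U \<and> computable_elem rho_n x0 \<and> rank (Df x0) = CARD('m)
      \<longrightarrow> (\<exists>(\<delta>::rat) (g :: real ^ 'm \<Rightarrow> real ^ 'n) (Dg :: real ^ 'm \<Rightarrow> real ^ 'm ^ 'n).
             0 < \<delta> \<and>
             (\<forall>y\<in>ball (f x0) (real_of_rat \<delta>). g y \<in> U) \<and>
             comp_fun rho_n rho_n (ball (f x0) (real_of_rat \<delta>)) g \<and>
             C1_with_deriv g Dg (ball (f x0) (real_of_rat \<delta>)) \<and>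
             comp_fun rho_n rho_mat (ball (f x0) (real_of_rat \<delta>)) Dg \<and>
             g (f x0) = x0 \<and>
             (\<forall>y\<in>ball (f x0) (real_of_rat \<delta>). f (g y) = y)))
   \<and>
   (\<forall>(X :: (real ^ 'n) set) (f :: real ^ 'n \<Rightarrow> real ^ 'm) (Df :: real ^ 'n \<Rightarrow> real ^ 'n ^ 'm).
      re_open X \<and> comp_fun rho_n rho_n X f \<and> C1_with_deriv f Df X \<and> comp_fun rho_n rho_mat X Df
      \<longrightarrow> (let I = (\<lambda>(Ux :: (real ^ 'n) set \<times> (real ^ 'n)) (k::nat).
                     snd Ux \<in> fst Ux \<and> fst Ux \<subseteq> X \<and> open (fst Ux) \<and>
                     rank (Df (snd Ux)) = CARD('m) \<and>
                     (\<exists>g :: real ^ 'm \<Rightarrow> real ^ 'n.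
                        (\<forall>y\<in>ball (f (snd Ux)) ((1/2) ^ k). g y \<in> fst Ux) \<and>
                        g (f (snd Ux)) = snd Ux \<and>
                        (\<forall>y\<in>ball (f (snd Ux)) ((1/2) ^ k). f (g y) = y)))
           in comp_mv (rep_prod theta_lt rho_n) nu_N {Ux. \<exists>k. I Ux k} I))"
proof (intro conjI allI impI, goal_cases)
  case (1 U f Df x0)
  have "open U"
    using 1 unfolding re_open_def computable_elem_def theta_lt_def by auto
  obtain c where c: "msum (Df x0 ** (qmat c :: real ^ 'm ^ 'n) - mat 1) < 1/2"
    using ex_qmat_right_inverse[of "Df x0" "1/2"] 1 by auto
  obtain k where chart: "local_chart f Df U x0 (qmat c) (2 * (1/2) ^ k)"
    using ex_local_chart[of f Df U x0 "qmat c"] \<open>open U\<close> c 1 by blast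
  interpret local_chart f Df U x0 "qmat c" "2 * (1/2) ^ k"
    by (rule chart)
  \<comment> \<open>The rational \<delta> is half of the chart radius, as the expansion factor 2 of
    F dictates.\<close>
  have "real_of_rat ((1/2) ^ k) = 2 * (1/2) ^ k / 2"
    by (simp add: of_rat_power of_rat_divide)
  then have ball: "ball (f x0) (real_of_rat ((1/2) ^ k)) = target"
    by simp
  show ?case
  proof (intro exI conjI)
    show "(0::rat) < (1/2) ^ k" by simp
    show "\<forall>y\<in>ball (f x0) (real_of_rat ((1/2) ^ k)). g y \<in> U"
      unfolding ball by (blast intro: g_in_X)
    show "comp_fun rho_n rho_n (ball (f x0) (real_of_rat ((1/2) ^ k))) g"
      "comp_fun rho_n rho_mat (ball (f x0) (real_of_rat ((1/2) ^ k))) Dg"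
      unfolding ball using computable_local_inverse[OF chart] 1 by simp_all
    show "C1_with_deriv g Dg (ball (f x0) (real_of_rat ((1/2) ^ k)))"
      unfolding ball by (rule C1_g)
    show "g (f x0) = x0" by (rule g_x0)
    show "\<forall>y\<in>ball (f x0) (real_of_rat ((1/2) ^ k)). f (g y) = y"
      unfolding ball by (blast intro: f_g)
  qed
next
  case (2 X f Df)
  then show ?case
    unfolding Let_def by (intro computable_inverse_radius) auto
qed

end
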